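(* Let $\Omega\subset\mathbb{R}^N$ be an arbitrary (not necessarily bounded) domain and let $1<p<N$. Let $\mathcal{A}:\Omega\times\mathbb{R}\times\mathbb{R}^N\to\mathbb{R}^N$ and $\mathcal{B}:\Omega\times\mathbb{R}\times\mathbb{R}^N\to\mathbb{R}$ be Carathéodory functions satisfying, for a.e. $x\in\Omega$ and all $(\zeta,\xi)\in\mathbb{R}\times\mathbb{R}^N$, $$\mathcal{A}(x,\zeta,\xi)\cdot\xi\ \ge\ \lambda|\xi|^p-a_1(x)|\zeta|^p-a_2(x),$$ $$|\mathcal{B}(x,\zeta,\xi)|\ \le\ b_1(x)|\xi|^{p-1}+b_2(x)|\zeta|^{p-1}+b_3(x),$$ where $\lambda>0$ is a fixed constant and $a_1,a_2,b_1,b_2,b_3$ are nonnegative measurable functions on $\Omega$ with $b_1\in L^\infty(\Omega)$ and $a_1,b_2\in L^{q/p}(\Omega)$ for some $q>N$. Let $u\in D^{1,p}(\Omega)$ be a weak solution of $-\operatorname{div}\mathcal{A}(x,u,\nabla u)=\mathcal{B}(x,u,\nabla u)$. Assume furthermore that $u\in L^\beta(\Omega)$ for some $\beta>p$ and that $$a_2\in L^{\beta/p}(\Omega)\cap L^\infty(\Omega),\qquad b_3\in L^{\beta/(p-1)}(\Omega)\cap L^\infty(\Omega).$$ Then there exists $\theta_0=\theta_0(p,\beta,N)$ with $0<\theta_0\le 1$ such that $$|u|_{\infty,\Omega}\ \le\ C\,\max\{|u|_{\beta,\Omega},\ |u|_{\beta,\Omega}^{\theta_0}\},$$ where (for the fixed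 $\lambda$) $C=C\big(p,q,\beta,N,|b_1|_{\infty,\Omega},|a_1|_{q/p,\Omega},|b_2|_{q/p,\Omega},\|a_2\|,\|b_3\|\big)$ with $$\|a_2\|:=|a_2|_{\beta/p,\Omega}+|a_2|_{\infty,\Omega},\qquad \|b_3\|:=|b_3|_{\beta/(p-1),\Omega}+|b_3|_{\infty,\Omega}.$$
   Context: Carathéodory means: measurable in $x$ for every $(\zeta,\xi)$ and continuous in $(\zeta,\xi)$ for a.e. $x$. $D^{1,p}(\Omega)$ is the Beppo-Levi (homogeneous Sobolev) space, the completion of $C_c^\infty(\Omega)$ under the norm $\|u\|_X=\left(\int_\Omega|\nabla u|^p\right)^{1/p}$. $|\cdot|_{r,V}$ denotes the standard norm of $L^r(V)$. A function $u\in D^{1,p}(\Omega)$ is a weak solution of $-\operatorname{div}\mathcal{A}(x,u,\nabla u)=\mathcal{B}(x,u,\nabla u)$ if $$\int_\Omega \mathcal{A}(x,u,\nabla u)\cdot\nabla\phi\,dx=\int_\Omega\mathcal{B}(x,u,\nabla u)\,\phi\,dx\quad\text{for all }\phi\in D^{1,p}(\Omega)$$ (the integrals being understood to exist). Writing $C=C(a,b,\dots)$ means that $C$ depends only on the listed quantities, and the dependence on the data is increasing in its variables. *)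

theory Defs
  imports "HOL-Analysis.Analysis" "HOL-Probability.Essential_Supremum"
begin

text \<open>
  The space $R^N$ is \<^typ>\<open>real^'n\<close>, so that $N$ is \<open>CARD('n)\<close>. Functions on a set \<open>\<Omega>\<close>
  are total functions whose values outside \<open>\<Omega>\<close> are irrelevant, because everything is taken
  with respect to \<open>lebesgue_on \<Omega>\<close>.
\<close>

subsection \<open>Lebesgue spaces\<close>

definition in_Lp :: "real \<Rightarrow> (real^'n) set \<Rightarrow> (real^'n \<Rightarrow> 'b::euclidean_space) \<Rightarrow> bool" where
  "in_Lp r \<Omega> f \<longleftrightarrow>
     f \<in> borel_measurable (lebesgue_on \<Omega>) \<and>
     integrable (lebesgue_on \<Omega>) (\<lambda>x. norm (f x) powr r)"

text \<open>Meaningful only when \<open>in_Lp r \<Omega> f\<close>; the Bochner integral of a non-integrable function is \<open>0\<close>.\<close>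

definition Lp_norm :: "real \<Rightarrow> (real^'n) set \<Rightarrow> (real^'n \<Rightarrow> 'b::euclidean_space) \<Rightarrow> real" where
  "Lp_norm r \<Omega> f = (LINT x|lebesgue_on \<Omega>. norm (f x) powr r) powr (1 / r)"

definition in_Linf :: "(real^'n) set \<Rightarrow> (real^'n \<Rightarrow> real) \<Rightarrow> bool" where
  "in_Linf \<Omega> f \<longleftrightarrow>
     f \<in> borel_measurable (lebesgue_on \<Omega>) \<and>
     esssup (lebesgue_on \<Omega>) (\<lambda>x. ereal \<bar>f x\<bar>) < \<infinity>"

text \<open>Meaningful only when \<open>in_Linf \<Omega> f\<close>; \<^const>\<open>real_of_ereal\<close> sends \<open>\<infinity>\<close> to \<open>0\<close>.\<close>

definition Linf_norm :: "(real^'n) set \<Rightarrow> (real^'n \<Rightarrow> real) \<Rightarrow> real" where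
  "Linf_norm \<Omega> f = real_of_ereal (esssup (lebesgue_on \<Omega>) (\<lambda>x. ereal \<bar>f x\<bar>))"

subsection \<open>Test functions and the Beppo-Levi space\<close>

definition grad :: "(real^'n \<Rightarrow> real) \<Rightarrow> real^'n \<Rightarrow> real^'n" where
  "grad f x = (\<chi> i. frechet_derivative f (at x) (axis i 1))"

primrec C_diff :: "nat \<Rightarrow> (real^'n \<Rightarrow> real) \<Rightarrow> bool" where
  "C_diff 0 f \<longleftrightarrow> continuous_on UNIV f"
| "C_diff (Suc k) f \<longleftrightarrow> (\<forall>x. f differentiable (at x)) \<and> (\<forall>i. C_diff k (\<lambda>x. grad f x $ i))"

definition test_functions :: "(real^'n) set \<Rightarrow> (real^'n \<Rightarrow> real) set" where
  "test_functions \<Omega> =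
     {\<phi>. (\<forall>k. C_diff k \<phi>) \<and> compact (closure {x. \<phi> x \<noteq> 0}) \<and> closure {x. \<phi> x \<noteq> 0} \<subseteq> \<Omega>}"

definition sobolev_conj :: "'n itself \<Rightarrow> real \<Rightarrow> real" where
  "sobolev_conj _ p = real CARD('n) * p / (real CARD('n) - p)"

text \<open>
  \<open>in_D1p \<Omega> p u Du\<close> says that \<open>u\<close> belongs to $D^{1,p}(\Omega)$ and that \<open>Du\<close> is (a representative
  of) its gradient. For $1 < p < N$ the Sobolev inequality makes every sequence of test functions
  that is Cauchy for the gradient norm converge in $L^{p^*}(\Omega)$, with $p^* = Np/(N-p)$, so the
  abstract completion is the space of the limits \<open>u\<close>, and the gradient of \<open>u\<close> is the limit in
  $L^p(\Omega)$ of the gradients. This limit is the distributional gradient of \<open>u\<close>, hence it is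
  determined by \<open>u\<close> up to a null set.
\<close>

definition in_D1p ::
  "(real^'n) set \<Rightarrow> real \<Rightarrow> (real^'n \<Rightarrow> real) \<Rightarrow> (real^'n \<Rightarrow> real^'n) \<Rightarrow> bool" where
  "in_D1p \<Omega> p u Du \<longleftrightarrow>
     in_Lp (sobolev_conj TYPE('n) p) \<Omega> u \<and> in_Lp p \<Omega> Du \<and>
     (\<exists>\<phi>. (\<forall>n. \<phi> n \<in> test_functions \<Omega>) \<and>
          (\<lambda>n::nat. Lp_norm p \<Omega> (\<lambda>x. grad (\<phi> n) x - Du x)) \<longlonglongrightarrow> 0 \<and>
          (\<lambda>n. Lp_norm (sobolev_conj TYPE('n) p) \<Omega> (\<lambda>x. \<phi> n x - u x)) \<longlonglongrightarrow> 0)"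

subsection \<open>The equation\<close>

definition caratheodory ::
  "(real^'n) set \<Rightarrow> (real^'n \<Rightarrow> real \<Rightarrow> real^'n \<Rightarrow> 'b::euclidean_space) \<Rightarrow> bool" where
  "caratheodory \<Omega> F \<longleftrightarrow>
     (\<forall>\<zeta> \<xi>. (\<lambda>x. F x \<zeta> \<xi>) \<in> borel_measurable (lebesgue_on \<Omega>)) \<and>
     (AE x in lebesgue_on \<Omega>. continuous_on UNIV (\<lambda>(\<zeta>, \<xi>). F x \<zeta> \<xi>))"

text \<open>
  The function \<open>u\<close>, with gradient \<open>Du\<close>, is a weak solution in $D^{1,p}(\Omega)$ of
  $-\mathrm{div}\, A(x,u,\nabla u) = B(x,u,\nabla u)$. The existence of the integrals is part of the notion.
\<close>

definition weak_solution ::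
  "(real^'n) set \<Rightarrow> real \<Rightarrow> (real^'n \<Rightarrow> real \<Rightarrow> real^'n \<Rightarrow> real^'n) \<Rightarrow>
   (real^'n \<Rightarrow> real \<Rightarrow> real^'n \<Rightarrow> real) \<Rightarrow> (real^'n \<Rightarrow> real) \<Rightarrow> (real^'n \<Rightarrow> real^'n) \<Rightarrow> bool" where
  "weak_solution \<Omega> p A B u Du \<longleftrightarrow>
     in_D1p \<Omega> p u Du \<and>
     (\<forall>\<phi> D\<phi>. in_D1p \<Omega> p \<phi> D\<phi> \<longrightarrow>
        integrable (lebesgue_on \<Omega>) (\<lambda>x. A x (u x) (Du x) \<bullet> D\<phi> x) \<and>
        integrable (lebesgue_on \<Omega>) (\<lambda>x. B x (u x) (Du x) * \<phi> x) \<and>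
        (LINT x|lebesgue_on \<Omega>. A x (u x) (Du x) \<bullet> D\<phi> x) =
        (LINT x|lebesgue_on \<Omega>. B x (u x) (Du x) * \<phi> x))"

end

theory Submission
  imports Defs
begin

text \<open>
  Moser iteration. Let $m \ge \beta$, let $u \in L^m$, and put $\mu_L(t) = L|t|/(L+|t|)$. The
  test function $u\,\mu_L(u)^{m-p}$ and the structure conditions bound
  $\int \mu_L(u)^{m-p}|\nabla u|^p$; the Sobolev inequality turns this into a bound for
  $v = |u|\,\mu_L(u)^{(m-p)/p}$ in $L^{p^*}$, in which the terms with $a_1$ and $b_2$ are interpolated
  between $\int v^p$ and $\int v^{p^*}$ and absorbed because $q > N$. The terms with $a_2$ and $b_3$
  are controlled by powers of $Y = \int |u|^m$ below the first, so that as $L \to \infty$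
  $$\Big(\int |u|^{m\kappa}\Big)^{1/\kappa} \le C m^\tau \max\{Y, Y^{1-p/m}\}, \qquad \kappa = N/(N-p).$$
  Iterating over $m = \beta\kappa^k$, the constants multiply to a finite limit, and the exponents
  $1 - p/(\beta\kappa^k)$ have a product of at least $\theta_0 = e^{-N/(\beta-p)}$.
\<close>

subsection \<open>Powers of extended nonnegative reals and Hoelder's inequality\<close>

text \<open>Since Omega may have infinite measure, constants need not be integrable, and the usual
  device of iterating with max(|u|, 1) or |u| + k is closed. The data a2 and b3 must instead be
  paired by Hoelder with the power |u|^m at hand, which takes a2 in L^(m/p) and b3 in L^(m/(p-1))
  for every m; interpolating between the two spaces given for each provides this with one bound for
  all m. The price is the term Y^(1-p/m), of lower homogeneity, and with it the maximum and theta_0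
  in the conclusion. The function mu_L is preferred to the cutoff min(|t|, L) because t mu_L(t)^s is
  continuously differentiable with bounded derivative, so that a chain rule for such functions
  suffices in the Beppo-Levi space. The absorption works for data of any size: a1 and b2 leave the
  Sobolev quantity E only to the power N/q < 1. Undoing this power raises the constants to 1/(1 -
  N/q), hence tau = (p+1)/(1 - N/q); a power of m is harmless because the sum of k kappa^(-k)
  converges. The value of theta_0 comes from ln(1-y) >= -y/(1-y) with y = p/(beta kappa^k) <=
  p/beta, a geometric series, and kappa/(kappa-1) = N/p.\<close>

text \<open>The convention $x^0 = 1$ for all $x$, unlike \<open>0 powr 0 = 0\<close>, is needed in \<open>margs_grid_le\<close>.\<close>

definition epow :: "ennreal \<Rightarrow> real \<Rightarrow> ennreal" where
  "epow x a = (if a = 0 then 1 else if x = \<infinity> then \<infinity> else ennreal (enn2real x powr a))"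

lemma epow_0 [simp]: "epow x 0 = 1"
  by (simp add: epow_def)

lemma epow_1 [simp]: "epow x 1 = x"
  by (cases x) (auto simp: epow_def)

lemma epow_zero: "a \<noteq> 0 \<Longrightarrow> epow 0 a = 0"
  by (simp add: epow_def)

lemma epow_top: "a \<noteq> 0 \<Longrightarrow> epow top a = top"
  by (simp add: epow_def)

lemma epow_ennreal: "0 \<le> r \<Longrightarrow> a \<noteq> 0 \<Longrightarrow> epow (ennreal r) a = ennreal (r powr a)"
  by (simp add: epow_def)

lemma epow_pos: "x \<noteq> 0 \<Longrightarrow> epow x a \<noteq> 0"
  by (cases x) (auto simp: epow_def)

lemma epow_mult:
  assumes "0 \<le> a" shows "epow (x * y) a = epow x a * epow y a"
proof (cases "a = 0 \<or> x = 0 \<or> y = 0")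
  case True
  then show ?thesis by (cases "a = 0") (auto simp: epow_zero)
next
  case False
  then have a: "a \<noteq> 0" and xy: "x \<noteq> 0" "y \<noteq> 0" by auto
  have top: "epow x a \<noteq> 0" "epow y a \<noteq> 0" using xy by (auto dest: epow_pos)
  show ?thesis
  proof (cases "x = top \<or> y = top")
    case True
    then show ?thesis
    proof
      assume "x = top"
      with a xy top show ?thesis by (simp add: epow_top ennreal_top_mult)
    next
      assume "y = top"
      with a xy top show ?thesis by (simp add: epow_top ennreal_mult_top)
    qed
  next
    case False
    then obtain r s where "x = ennreal r" "0 \<le> r" "y = ennreal s" "0 \<le> s"
      by (metis ennreal_cases)
    then show ?thesis
      using a by (simp add: epow_ennreal powr_mult flip: ennreal_mult)
  qed
qed

lemma epow_add:
  assumes "0 \<le> a" "0 \<le> b" shows "epow x (a + b) = epow x a * epow x b"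
proof (cases "a = 0 \<or> b = 0")
  case False
  then have "a \<noteq> 0" "b \<noteq> 0" "a + b \<noteq> 0" using assms by auto
  then show ?thesis
    by (cases x) (auto simp: epow_def powr_add ennreal_mult)
qed auto

lemma epow_mono: "x \<le> y \<Longrightarrow> 0 \<le> a \<Longrightarrow> epow x a \<le> epow y a"
  by (cases x; cases y) (auto simp: epow_def powr_mono2 top_unique)

lemma measurable_epow [measurable]:
  assumes [measurable]: "f \<in> borel_measurable M"
  shows "(\<lambda>x. epow (f x) a) \<in> borel_measurable M"
  unfolding epow_def by measurable

text \<open>Jensen's inequality for exp at the points ln (x i). A vanishing x i is split off because
  ln is meaningless there; the product is then 0 even if its weight is 0, since
  \<open>0 powr 0 = 0\<close>.\<close>

lemma weighted_geometric_mean_le: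
  fixes a x :: "'i \<Rightarrow> real"
  assumes "finite I" "\<And>i. i \<in> I \<Longrightarrow> 0 \<le> a i" "(\<Sum>i\<in>I. a i) = 1" "\<And>i. i \<in> I \<Longrightarrow> 0 \<le> x i"
  shows "(\<Prod>i\<in>I. x i powr a i) \<le> (\<Sum>i\<in>I. a i * x i)"
proof (cases "\<exists>i\<in>I. x i = 0")
  case True
  then have "(\<Prod>i\<in>I. x i powr a i) = 0" using assms(1) by (intro prod_zero) auto
  moreover have "0 \<le> (\<Sum>i\<in>I. a i * x i)" using assms by (intro sum_nonneg) auto
  ultimately show ?thesis by linarith
next
  case False
  then have pos: "\<And>i. i \<in> I \<Longrightarrow> 0 < x i" using assms by (metis order_le_less)
  have "I \<noteq> {}" using assms by auto
  have "(\<Prod>i\<in>I. x i powr a i) = exp (\<Sum>i\<in>I. a i *\<^sub>R ln (x i))"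
    using assms(1) by (auto simp: exp_sum powr_def intro!: prod.cong dest: pos)
  also have "\<dots> \<le> (\<Sum>i\<in>I. a i * exp (ln (x i)))"
    by (rule convex_on_sum[OF _ _ exp_convex]) (use assms \<open>I \<noteq> {}\<close> in auto)
  also have "\<dots> = (\<Sum>i\<in>I. a i * x i)" using pos by (intro sum.cong) auto
  finally show ?thesis .
qed

text \<open>Each f i is divided by its integral and the weighted geometric mean inequality is
  integrated pointwise; the right side then sums to one. Indices of weight 0 are dropped first (the
  set J), as their factors are 1 on both sides.\<close>

lemma nn_integral_Hoelder:
  fixes a :: "'i \<Rightarrow> real" and f :: "'i \<Rightarrow> 'a \<Rightarrow> ennreal"
  assumes "finite I" "\<And>i. i \<in> I \<Longrightarrow> 0 \<le> a i" "(\<Sum>i\<in>I. a i) = 1"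
    and meas: "\<And>i. i \<in> I \<Longrightarrow> f i \<in> borel_measurable M"
  shows "(\<integral>\<^sup>+x. (\<Prod>i\<in>I. epow (f i x) (a i)) \<partial>M) \<le> (\<Prod>i\<in>I. epow (\<integral>\<^sup>+x. f i x \<partial>M) (a i))"
proof -
  define J where "J = {i \<in> I. a i \<noteq> 0}"
  have J: "finite J" "J \<subseteq> I" "\<And>i. i \<in> J \<Longrightarrow> 0 < a i" "\<And>i. i \<in> J \<Longrightarrow> a i \<noteq> 0"
    using assms by (auto simp: J_def order_le_less)
  have sumJ: "(\<Sum>i\<in>J. a i) = 1"
    using assms(1,3) unfolding J_def by (subst sum.mono_neutral_left[of I]) auto
  have prodJ: "(\<Prod>i\<in>I. epow (g i) (a i)) = (\<Prod>i\<in>J. epow (g i) (a i))" for g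
    using assms(1) unfolding J_def by (intro prod.mono_neutral_right) auto
  note meas' [measurable] = meas[OF subsetD[OF J(2)]]
  let ?c = "\<lambda>i. \<integral>\<^sup>+x. f i x \<partial>M"
  \<comment> \<open>A vanishing integral has to be handled before an infinite one, because 0 * top =
    0: it makes the left side 0 whatever the other integrals are, whereas an infinite integral makes
    the right side infinite only if no factor is 0.\<close>
  consider (zero) i where "i \<in> J" "?c i = 0"
    | (top) i where "i \<in> J" "?c i = \<infinity>" "\<forall>j\<in>J. ?c j \<noteq> 0"
    | (fin) "\<forall>j\<in>J. ?c j \<noteq> 0 \<and> ?c j \<noteq> \<infinity>" by blast
  then show ?thesis
  proof cases
    case zero
    then have "AE x in M. f i x = 0"
      by (subst (asm) nn_integral_0_iff_AE) (auto simp: meas')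
    then have "AE x in M. (\<Prod>i\<in>J. epow (f i x) (a i)) = 0"
      by eventually_elim (use zero J in \<open>auto intro!: prod_zero bexI[of _ i] simp: epow_zero\<close>)
    then have "(\<integral>\<^sup>+x. (\<Prod>i\<in>J. epow (f i x) (a i)) \<partial>M) = (\<integral>\<^sup>+x. 0 \<partial>M)"
      by (intro nn_integral_cong_AE) auto
    then show ?thesis by (simp add: prodJ)
  next
    case top
    have "(\<Prod>j\<in>J. epow (?c j) (a j)) = epow (?c i) (a i) * (\<Prod>j\<in>J - {i}. epow (?c j) (a j))"
      using top J by (subst prod.remove[of J i]) auto
    moreover have "(\<Prod>j\<in>J - {i}. epow (?c j) (a j)) \<noteq> 0"
      using top J by (auto dest: epow_pos)
    moreover have "epow (?c i) (a i) = top" using top J(4) by (simp add: epow_top)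
    ultimately have "(\<Prod>j\<in>J. epow (?c j) (a j)) = top"
      by (simp only: ennreal_top_mult if_False)
    then show ?thesis unfolding prodJ by (simp only: top_greatest)
  next
    case fin
    define c where "c i = enn2real (?c i)" for i
    have c: "?c i = ennreal (c i)" "0 < c i" if "i \<in> J" for i
      using fin that unfolding c_def
      by (auto simp: enn2real_positive_iff top.not_eq_extremum zero_less_iff_neq_zero)
    have "AE x in M. \<forall>i\<in>J. f i x \<noteq> \<infinity>"
      using J fin nn_integral_noteq_infinite[OF meas'] by (intro AE_finite_allI) auto
    then have "AE x in M. (\<Prod>i\<in>J. epow (f i x) (a i)) \<le>
       ennreal (\<Prod>i\<in>J. c i powr a i) * (\<Sum>i\<in>J. ennreal (a i / c i) * f i x)"
    proof eventually_elim
      case (elim x)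
      define g where "g i = enn2real (f i x)" for i
      have g: "f i x = ennreal (g i)" "0 \<le> g i" if "i \<in> J" for i
        using that elim unfolding g_def by (auto simp: less_top)
      have "(\<Prod>i\<in>J. epow (f i x) (a i)) = (\<Prod>i\<in>J. ennreal (g i powr a i))"
        using J g by (intro prod.cong) (auto simp: epow_ennreal)
      also have "\<dots> = ennreal (\<Prod>i\<in>J. g i powr a i)"
        by (intro prod_ennreal) auto
      also have "(\<Prod>i\<in>J. g i powr a i) = (\<Prod>i\<in>J. c i powr a i) * (\<Prod>i\<in>J. (g i / c i) powr a i)"
        unfolding prod.distrib[symmetric] using g c
        by (intro prod.cong) (auto simp: powr_divide less_imp_le dest: less_imp_neq[OF c(2)])
      also have "\<dots> \<le> (\<Prod>i\<in>J. c i powr a i) * (\<Sum>i\<in>J. a i * (g i / c i))"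
        using J sumJ g c by (intro mult_left_mono weighted_geometric_mean_le)
          (auto simp: less_imp_le intro!: prod_nonneg divide_nonneg_pos)
      also have "ennreal \<dots> = ennreal (\<Prod>i\<in>J. c i powr a i) * (\<Sum>i\<in>J. ennreal (a i / c i) * f i x)"
        using g c J by (subst ennreal_mult)
          (auto intro!: prod_nonneg sum_nonneg arg_cong2[where f="(*)"] sum.cong
            simp: less_imp_le sum_ennreal[symmetric] ennreal_mult'[symmetric] simp del: sum_ennreal)
      finally show ?case using ennreal_leI by blast
    qed
    then have "(\<integral>\<^sup>+x. (\<Prod>i\<in>J. epow (f i x) (a i)) \<partial>M) \<le>
       (\<integral>\<^sup>+x. ennreal (\<Prod>i\<in>J. c i powr a i) * (\<Sum>i\<in>J. ennreal (a i / c i) * f i x) \<partial>M)"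
      by (intro nn_integral_mono_AE)
    also have "\<dots> = ennreal (\<Prod>i\<in>J. c i powr a i) * (\<Sum>i\<in>J. ennreal (a i / c i) * ?c i)"
      by (simp add: nn_integral_cmult nn_integral_sum)
    also have "(\<Sum>i\<in>J. ennreal (a i / c i) * ?c i) = (\<Sum>i\<in>J. ennreal (a i))"
      using c J by (intro sum.cong) (auto simp: ennreal_mult[symmetric] less_imp_le dest: less_imp_neq[OF c(2)])
    also have "\<dots> = 1" using sumJ J by (simp add: sum_ennreal less_imp_le)
    also have "ennreal (\<Prod>i\<in>J. c i powr a i) = (\<Prod>i\<in>J. epow (?c i) (a i))"
      using c J by (subst prod_ennreal[symmetric]) (auto intro!: prod.cong simp: epow_ennreal less_imp_le)
    finally show ?thesis by (simp add: prodJ)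
  qed
qed

subsection \<open>The Gagliardo--Nirenberg--Sobolev inequality\<close>

definition upd :: "real^'n \<Rightarrow> 'n \<Rightarrow> real \<Rightarrow> real^'n" where
  "upd x i t = (\<chi> j. if j = i then t else x $ j)"

lemma upd_nth: "upd x i t $ j = (if j = i then t else x $ j)"
  by (simp add: upd_def)

lemma upd_upd [simp]: "upd (upd x i s) i t = upd x i t"
  by (simp add: vec_eq_iff upd_nth)

lemma upd_commute: "i \<noteq> j \<Longrightarrow> upd (upd x i s) j t = upd (upd x j t) i s"
  by (simp add: vec_eq_iff upd_nth)

lemma upd_same [simp]: "upd x i (x $ i) = x"
  by (simp add: vec_eq_iff upd_nth)

lemma measurable_upd [measurable (raw)]:
  fixes f :: "'a \<Rightarrow> real^'n::finite"
  assumes [measurable]: "f \<in> borel_measurable M" "g \<in> borel_measurable M"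
  shows "(\<lambda>x. upd (f x) i (g x)) \<in> borel_measurable M"
proof -
  have "continuous_on UNIV (\<lambda>z :: (real^'n) \<times> real. upd (fst z) i (snd z))"
    unfolding upd_def
  proof (intro continuous_on_vec_lambda)
    show "continuous_on UNIV (\<lambda>z :: (real^'n) \<times> real. if j = i then snd z else fst z $ j)" for j
      by (cases "j = i") (auto intro!: continuous_intros)
  qed
  then have [measurable]: "(\<lambda>z :: (real^'n) \<times> real. upd (fst z) i (snd z)) \<in> borel_measurable borel"
    by (rule borel_measurable_continuous_onI)
  have "(\<lambda>x. (f x, g x)) \<in> borel_measurable M"
    by measurable
  from measurable_compose[OF this \<open>_ \<in> borel_measurable borel\<close>] show ?thesis
    by simp
qed

lemma borel_measurable_vec_lambda:
  fixes f :: "'a \<Rightarrow> 'n::finite \<Rightarrow> real"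
  assumes "\<And>i. (\<lambda>x. f x i) \<in> borel_measurable M"
  shows "(\<lambda>x. \<chi> i. f x i) \<in> borel_measurable M"
  using assms by (subst borel_measurable_euclidean_space) (auto simp: Basis_vec_def inner_axis)

text \<open>A marginal stays a function on all of R^N that ignores coordinate i, rather than
  becoming one on R^(N-1). All marginals thus live on one space, where they can be multiplied and
  integrated again in any order.\<close>

definition marg :: "'n \<Rightarrow> (real^'n \<Rightarrow> ennreal) \<Rightarrow> real^'n \<Rightarrow> ennreal" where
  "marg i f x = (\<integral>\<^sup>+t. f (upd x i t) \<partial>lborel)"

lemma measurable_marg [measurable]:
  fixes f :: "real^'n::finite \<Rightarrow> ennreal"
  assumes [measurable]: "f \<in> borel_measurable borel"
  shows "marg i f \<in> borel_measurable borel"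
  unfolding marg_def [abs_def] by measurable

lemma marg_upd [simp]: "marg i f (upd x i t) = marg i f x"
  by (simp add: marg_def)

lemma marg_mono: "(\<And>x. f x \<le> g x) \<Longrightarrow> marg i f x \<le> marg i g x"
  unfolding marg_def by (intro nn_integral_mono) auto

lemma marg_commute:
  fixes f :: "real^'n::finite \<Rightarrow> ennreal"
  assumes [measurable]: "f \<in> borel_measurable borel"
  shows "marg i (marg j f) = marg j (marg i f)"
proof (cases "i = j")
  case False
  show ?thesis
  proof
    fix x
    have "marg i (marg j f) x = (\<integral>\<^sup>+t. \<integral>\<^sup>+s. f (upd (upd x i t) j s) \<partial>lborel \<partial>lborel)"
      by (simp add: marg_def)
    also have "\<dots> = (\<integral>\<^sup>+s. \<integral>\<^sup>+t. f (upd (upd x i t) j s) \<partial>lborel \<partial>lborel)"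
      by (rule lborel_pair.Fubini') measurable
    also have "\<dots> = marg j (marg i f) x"
      using False by (simp add: marg_def upd_commute)
    finally show "marg i (marg j f) x = marg j (marg i f) x" .
  qed
qed simp

primrec margs :: "'n list \<Rightarrow> (real^'n \<Rightarrow> ennreal) \<Rightarrow> real^'n \<Rightarrow> ennreal" where
  "margs [] f = f"
| "margs (i # xs) f = margs xs (marg i f)"

lemma margs_mono: "(\<And>x. f x \<le> g x) \<Longrightarrow> margs xs f x \<le> margs xs g x"
  proof (induction xs arbitrary: f g x)
  case (Cons i xs)
  then have "marg i f y \<le> marg i g y" for y by (intro marg_mono)
  then show ?case unfolding margs.simps by (rule Cons.IH)
qed simp

text \<open>The link between integration coordinate by coordinate and Lebesgue measure on vectors:
  both measures give a box the product of its side lengths, which determines Lebesgue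
  measure.\<close>

lemma lborel_vec_eq_PiM:
  "(lborel :: (real^'n::finite) measure) = distr (\<Pi>\<^sub>M i\<in>UNIV. lborel) borel (\<lambda>y. \<chi> i. y i)"
proof (rule lborel_eqI)
  interpret product_sigma_finite "\<lambda>_ :: 'n. lborel :: real measure" ..
  have meas: "(\<lambda>y. \<chi> i. y i) \<in> (\<Pi>\<^sub>M i\<in>(UNIV :: 'n set). lborel :: real measure) \<rightarrow>\<^sub>M borel"
    by (rule borel_measurable_vec_lambda) measurable
  fix l u :: "real^'n"
  assume le: "\<And>b. b \<in> Basis \<Longrightarrow> l \<bullet> b \<le> u \<bullet> b"
  then have le': "l $ i \<le> u $ i" for i
    using le[of "axis i 1"] by (auto simp: Basis_vec_def inner_axis)
  have vimage: "(\<lambda>y. \<chi> i. y i) -` box l u \<inter> space (\<Pi>\<^sub>M i\<in>UNIV. lborel) = Pi\<^sub>E UNIV (\<lambda>i. box (l $ i) (u $ i))"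
    by (auto simp: space_PiM mem_box_cart box_real PiE_def Pi_def)
  have "emeasure (distr (\<Pi>\<^sub>M i\<in>UNIV. lborel) borel (\<lambda>y. \<chi> i. y i)) (box l u) =
      (\<Prod>i\<in>UNIV. ennreal (u $ i - l $ i))"
    by (subst emeasure_distr[OF meas]) (auto simp: vimage emeasure_PiM le')
  also have "\<dots> = ennreal (\<Prod>i\<in>UNIV. u $ i - l $ i)"
    using le' by (intro prod_ennreal) auto
  also have "(\<Prod>i\<in>UNIV. u $ i - l $ i) = (\<Prod>b\<in>Basis. (u - l) \<bullet> b)"
    by (simp add: Basis_vec_def UNION_singleton_eq_range prod.reindex inj_on_def axis_eq_axis inner_axis)
  finally show "emeasure (distr (\<Pi>\<^sub>M i\<in>UNIV. lborel) borel (\<lambda>y. \<chi> i. y i)) (box l u) =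
      ennreal (\<Prod>b\<in>Basis. (u - l) \<bullet> b)" .
qed simp

text \<open>Tonelli, one coordinate at a time; the coordinates outside the list stay frozen at those
  of x. When the list exhausts the index type, the dependence on x disappears.\<close>

lemma margs_eq_nn_integral_PiM:
  fixes f :: "real^'n::finite \<Rightarrow> ennreal"
  assumes "distinct xs" and [measurable]: "f \<in> borel_measurable borel"
  shows "margs xs f x = (\<integral>\<^sup>+y. f (\<chi> j. if j \<in> set xs then y j else x $ j) \<partial>(\<Pi>\<^sub>M i\<in>set xs. lborel))"
  using assms
proof (induction xs arbitrary: f x)
  case Nil
  then show ?case by (simp add: PiM_empty nn_integral_count_space_finite)
next
  case (Cons i xs)
  note [measurable] = Cons.prems(2)
  interpret product_sigma_finite "\<lambda>_ :: 'n. lborel :: real measure" ..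
  have meas: "(\<lambda>y. f (\<chi> j. if j \<in> insert i (set xs) then y j else x $ j))
      \<in> borel_measurable (\<Pi>\<^sub>M i\<in>insert i (set xs). lborel)"
  proof (rule measurable_compose[OF borel_measurable_vec_lambda Cons.prems(2)])
    fix j
    show "(\<lambda>y. if j \<in> insert i (set xs) then y j else x $ j)
        \<in> borel_measurable (\<Pi>\<^sub>M i\<in>insert i (set xs). lborel)"
      by (cases "j \<in> insert i (set xs)") auto
  qed
  have "margs (i # xs) f x =
      (\<integral>\<^sup>+y. marg i f (\<chi> j. if j \<in> set xs then y j else x $ j) \<partial>(\<Pi>\<^sub>M i\<in>set xs. lborel))"
    using Cons by simp
  also have "\<dots> = (\<integral>\<^sup>+y. \<integral>\<^sup>+t. f (\<chi> j. if j \<in> insert i (set xs) then (y(i := t)) j else x $ j) \<partial>lborel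
       \<partial>(\<Pi>\<^sub>M i\<in>set xs. lborel))"
    unfolding marg_def using Cons.prems(1)
    by (intro nn_integral_cong arg_cong[where f = f]) (auto simp: vec_eq_iff upd_nth)
  also have "\<dots> = (\<integral>\<^sup>+y. f (\<chi> j. if j \<in> insert i (set xs) then y j else x $ j)
       \<partial>(\<Pi>\<^sub>M i\<in>insert i (set xs). lborel))"
    using Cons.prems(1) meas by (intro product_nn_integral_insert[symmetric]) auto
  finally show ?case by simp
qed

lemma margs_UNIV:
  fixes f :: "real^'n::finite \<Rightarrow> ennreal"
  assumes "distinct xs" "set xs = UNIV" and [measurable]: "f \<in> borel_measurable borel"
  shows "margs xs f x = (\<integral>\<^sup>+y. f y \<partial>lborel)"
  using assms(2)
  by (simp add: margs_eq_nn_integral_PiM[OF assms(1,3)] lborel_vec_eq_PiM nn_integral_distr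
      borel_measurable_vec_lambda)

text \<open>
  The exponents are chosen for the induction: integrating out one more variable $x_i$ takes the factor
  $(\mathrm{marg}_i f)^w$, which does not depend on $x_i$, out of the integral, and Hoelder's inequality
  for the others, whose weights sum to one, gives the same expression for $\mathrm{marg}_i f$.
\<close>

lemma margs_grid_le:
  fixes f :: "real^'n::finite \<Rightarrow> ennreal"
  assumes "distinct xs" "0 \<le> w" "(real (length xs) - 1) * w \<le> 1" "f \<in> borel_measurable borel"
  shows "margs xs (\<lambda>x. epow (f x) (1 - (real (length xs) - 1) * w) * (\<Prod>i\<in>set xs. epow (marg i f x) w)) x
    \<le> epow (margs xs f x) (1 + w)"
  using assms
proof (induction xs arbitrary: f x)
  \<comment> \<open>For the empty list the exponent is 1 - (0 - 1) * w = 1 + w, so both sides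
    coincide.\<close>
  case Nil
  then show ?case by simp
next
  case (Cons i xs)
  note [measurable] = Cons.prems(4)
  define e where "e = 1 - real (length xs) * w"
  have e: "0 \<le> e" and e': "1 - (real (length (i # xs)) - 1) * w = e"
    "e + w = 1 - (real (length xs) - 1) * w"
    using Cons.prems by (simp_all add: e_def algebra_simps)
  have i: "i \<notin> set xs" "distinct xs" using Cons.prems by auto
  have "marg i (\<lambda>x. epow (f x) e * (\<Prod>j\<in>set (i # xs). epow (marg j f x) w)) y
    \<le> epow (marg i f y) (e + w) * (\<Prod>j\<in>set xs. epow (marg j (marg i f) y) w)" for y
  proof -
    define h where "h k t = (if k = i then f (upd y i t) else marg k f (upd y i t))" for k t
    define a where "a k = (if k = i then e else w)" for k
    have "marg i (\<lambda>x. epow (f x) e * (\<Prod>j\<in>set (i # xs). epow (marg j f x) w)) y =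
      (\<integral>\<^sup>+t. epow (marg i f y) w * (\<Prod>k\<in>insert i (set xs). epow (h k t) (a k)) \<partial>lborel)"
      unfolding marg_def[of i "\<lambda>x. epow (f x) e * _ x"]
    proof (intro nn_integral_cong)
      fix t
      have "(\<Prod>j\<in>set xs. epow (marg j f (upd y i t)) w) = (\<Prod>k\<in>set xs. epow (h k t) (a k))"
        using i by (intro prod.cong) (auto simp: h_def a_def)
      then show "epow (f (upd y i t)) e * (\<Prod>j\<in>set (i # xs). epow (marg j f (upd y i t)) w) =
        epow (marg i f y) w * (\<Prod>k\<in>insert i (set xs). epow (h k t) (a k))"
        using i by (simp add: h_def a_def mult_ac)
    qed
    also have "\<dots> = epow (marg i f y) w * (\<integral>\<^sup>+t. (\<Prod>k\<in>insert i (set xs). epow (h k t) (a k)) \<partial>lborel)"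
      unfolding h_def a_def by (intro nn_integral_cmult) measurable
    also have "\<dots> \<le> epow (marg i f y) w * (\<Prod>k\<in>insert i (set xs). epow (\<integral>\<^sup>+t. h k t \<partial>lborel) (a k))"
    proof (intro mult_left_mono nn_integral_Hoelder)
      have "(\<Sum>k\<in>set xs. a k) = (\<Sum>k\<in>set xs. w)"
        using i by (intro sum.cong) (auto simp: a_def)
      then show "(\<Sum>k\<in>insert i (set xs). a k) = 1"
        using i by (simp add: a_def e_def distinct_card)
      show "0 \<le> a k" for k using e Cons.prems by (simp add: a_def)
      show "h k \<in> borel_measurable lborel" for k unfolding h_def by measurable
    qed auto
    also have "(\<Prod>k\<in>insert i (set xs). epow (\<integral>\<^sup>+t. h k t \<partial>lborel) (a k)) =
      epow (marg i f y) e * (\<Prod>j\<in>set xs. epow (marg j (marg i f) y) w)"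
    proof -
      have "(\<Prod>k\<in>set xs. epow (\<integral>\<^sup>+t. h k t \<partial>lborel) (a k)) = (\<Prod>j\<in>set xs. epow (marg j (marg i f) y) w)"
      proof (rule prod.cong)
        fix k assume "k \<in> set xs"
        with i have "k \<noteq> i" by auto
        then show "epow (\<integral>\<^sup>+t. h k t \<partial>lborel) (a k) = epow (marg k (marg i f) y) w"
          by (subst marg_commute) (auto simp: h_def [abs_def] a_def marg_def[of i "marg k f"])
      qed simp
      then show ?thesis using i by (simp add: h_def a_def marg_def[of i f])
    qed
    also have "epow (marg i f y) w * (epow (marg i f y) e * (\<Prod>j\<in>set xs. epow (marg j (marg i f) y) w)) =
      epow (marg i f y) (e + w) * (\<Prod>j\<in>set xs. epow (marg j (marg i f) y) w)"
      using e Cons.prems by (simp add: epow_add mult_ac)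
    finally show ?thesis .
  qed
  then have "margs (i # xs) (\<lambda>x. epow (f x) e * (\<Prod>j\<in>set (i # xs). epow (marg j f x) w)) x \<le>
    margs xs (\<lambda>y. epow (marg i f y) (e + w) * (\<Prod>j\<in>set xs. epow (marg j (marg i f) y) w)) x"
    unfolding margs.simps by (rule margs_mono)
  also have "\<dots> \<le> epow (margs xs (marg i f) x) (1 + w)"
    unfolding e'(2)
  proof (rule Cons.IH)
    show "(real (length xs) - 1) * w \<le> 1" using Cons.prems by (simp add: algebra_simps)
  qed (use Cons.prems i in auto)
  finally show ?case unfolding e' by simp
qed

text \<open>Gagliardo's argument: with w = 1/(N-1), the power N/(N-1) = N * w of g splits into N
  factors, and the i-th one is estimated by the marginal in direction i. For this w the exponent of
  f in \<open>margs_grid_le\<close> is 0, so exactly the product of the marginals remains.\<close>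

lemma nn_integral_le_of_le_margs:
  fixes f g :: "real^'n::finite \<Rightarrow> ennreal"
  assumes N: "2 \<le> CARD('n)" and [measurable]: "f \<in> borel_measurable borel" "g \<in> borel_measurable borel"
    and le: "\<And>i x. g x \<le> marg i f x"
  shows "(\<integral>\<^sup>+x. epow (g x) (real CARD('n) / (real CARD('n) - 1)) \<partial>lborel)
    \<le> epow (\<integral>\<^sup>+x. f x \<partial>lborel) (real CARD('n) / (real CARD('n) - 1))"
proof -
  define N where "N = real CARD('n)"
  define w where "w = 1 / (N - 1)"
  have N2: "2 \<le> N" using N by (simp add: N_def)
  obtain xs :: "'n list" where xs: "set xs = UNIV" "distinct xs"
    using finite_distinct_list[of "UNIV :: 'n set"] by auto
  have len: "real (length xs) = N" using xs by (simp add: N_def distinct_card[symmetric])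
  have w: "0 \<le> w" "(N - 1) * w = 1" "N / (N - 1) = 1 + w" "N / (N - 1) = N * w"
    using N2 by (auto simp: w_def field_simps)
  have "epow (g x) (N / (N - 1)) \<le> (\<Prod>i\<in>UNIV. epow (marg i f x) w)" for x
  proof -
    have "epow y (real k * w) = epow y w ^ k" for y k
      by (induction k) (use w in \<open>auto simp: epow_add distrib_right\<close>)
    then have "epow (g x) (N / (N - 1)) = (\<Prod>i\<in>(UNIV :: 'n set). epow (g x) w)"
      unfolding w(4) unfolding N_def by simp
    also have "\<dots> \<le> (\<Prod>i\<in>UNIV. epow (marg i f x) w)"
      by (intro prod_mono_ennreal epow_mono le w)
    finally show ?thesis .
  qed
  then have "(\<integral>\<^sup>+x. epow (g x) (N / (N - 1)) \<partial>lborel) \<le>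
      (\<integral>\<^sup>+x. (\<Prod>i\<in>UNIV. epow (marg i f x) w) \<partial>lborel)"
    by (intro nn_integral_mono) auto
  also have "\<dots> = margs xs (\<lambda>x. epow (f x) (1 - (real (length xs) - 1) * w) *
      (\<Prod>i\<in>set xs. epow (marg i f x) w)) 0"
    using xs w len by (simp add: margs_UNIV)
  also have "\<dots> \<le> epow (margs xs f 0) (1 + w)"
    using xs w len by (intro margs_grid_le) auto
  also have "\<dots> = epow (\<integral>\<^sup>+x. f x \<partial>lborel) (N / (N - 1))"
    using xs w by (simp add: margs_UNIV)
  finally show ?thesis unfolding N_def .
qed

section \<open>Hoelder's inequality for Bochner integrals\<close>

text \<open>Strictly positive weights make \<open>powr\<close> and \<open>epow\<close> agree, which
  fails for 0 to the power 0. The finite bound for the extended integral yields integrability of the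
  product as well.\<close>

lemma integral_Hoelder:
  fixes a :: "'i \<Rightarrow> real" and f :: "'i \<Rightarrow> 'a \<Rightarrow> real"
  assumes I: "finite I" "\<And>i. i \<in> I \<Longrightarrow> 0 < a i" "(\<Sum>i\<in>I. a i) = 1"
    and int: "\<And>i. i \<in> I \<Longrightarrow> integrable M (f i)" and nn: "\<And>i x. i \<in> I \<Longrightarrow> 0 \<le> f i x"
  shows "integrable M (\<lambda>x. \<Prod>i\<in>I. f i x powr a i)"
    and "(\<integral>x. (\<Prod>i\<in>I. f i x powr a i) \<partial>M) \<le> (\<Prod>i\<in>I. (\<integral>x. f i x \<partial>M) powr a i)"
proof -
  note [measurable] = borel_measurable_integrable[OF int]
  let ?P = "\<lambda>x. \<Prod>i\<in>I. f i x powr a i"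
  have P: "0 \<le> ?P x" for x by (intro prod_nonneg) auto
  have nz: "a i \<noteq> 0" if "i \<in> I" for i using I(2)[OF that] by simp
  have nnI: "0 \<le> (\<integral>x. f i x \<partial>M)" if "i \<in> I" for i using nn[OF that] by simp
  have "(\<integral>\<^sup>+x. ennreal (?P x) \<partial>M) = (\<integral>\<^sup>+x. (\<Prod>i\<in>I. epow (ennreal (f i x)) (a i)) \<partial>M)"
    using nn nz by (intro nn_integral_cong) (auto simp: epow_ennreal prod_ennreal cong: prod.cong)
  also have "\<dots> \<le> (\<Prod>i\<in>I. epow (\<integral>\<^sup>+x. ennreal (f i x) \<partial>M) (a i))"
    using I by (intro nn_integral_Hoelder) (auto simp: less_imp_le)
  also have "\<dots> = ennreal (\<Prod>i\<in>I. (\<integral>x. f i x \<partial>M) powr a i)"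
    using nn nz int nnI by (subst prod_ennreal[symmetric])
      (auto intro!: prod.cong simp: nn_integral_eq_integral epow_ennreal)
  finally have le: "(\<integral>\<^sup>+x. ennreal (?P x) \<partial>M) \<le> ennreal (\<Prod>i\<in>I. (\<integral>x. f i x \<partial>M) powr a i)" .
  then show *: "integrable M ?P"
    using P by (intro integrableI_nonneg) (auto simp: le_less_trans[OF _ ennreal_less_top])
  show "(\<integral>x. ?P x \<partial>M) \<le> (\<Prod>i\<in>I. (\<integral>x. f i x \<partial>M) powr a i)"
    using le P by (subst (asm) nn_integral_eq_integral[OF *]) (auto simp: ennreal_le_iff prod_nonneg)
qed

lemma Hoelder2:
  fixes f g :: "'a \<Rightarrow> real"
  assumes "0 < a" "0 < b" "a + b = 1" "integrable M f" "integrable M g" "\<And>x. 0 \<le> f x" "\<And>x. 0 \<le> g x"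
  shows "integrable M (\<lambda>x. f x powr a * g x powr b)"
    and "(\<integral>x. f x powr a * g x powr b \<partial>M) \<le> (\<integral>x. f x \<partial>M) powr a * (\<integral>x. g x \<partial>M) powr b"
  using integral_Hoelder[of "UNIV :: bool set" "\<lambda>i. if i then a else b" M "\<lambda>i. if i then f else g"] assms
  by (auto simp: UNIV_bool mult.commute)

lemma Hoelder3:
  fixes f g h :: "'a \<Rightarrow> real"
  assumes "0 < a" "0 < b" "0 < c" "a + b + c = 1" "integrable M f" "integrable M g" "integrable M h"
    "\<And>x. 0 \<le> f x" "\<And>x. 0 \<le> g x" "\<And>x. 0 \<le> h x"
  shows "integrable M (\<lambda>x. f x powr a * g x powr b * h x powr c)"
    and "(\<integral>x. f x powr a * g x powr b * h x powr c \<partial>M) \<le>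
      (\<integral>x. f x \<partial>M) powr a * (\<integral>x. g x \<partial>M) powr b * (\<integral>x. h x \<partial>M) powr c"
proof -
  let ?a = "\<lambda>i :: nat. if i = 0 then a else if i = 1 then b else c"
  let ?f = "\<lambda>i :: nat. if i = 0 then f else if i = 1 then g else h"
  have "integrable M (?f i)" for i using assms by auto
  moreover have "0 \<le> ?f i x" for i x using assms by auto
  ultimately show "integrable M (\<lambda>x. f x powr a * g x powr b * h x powr c)"
    and "(\<integral>x. f x powr a * g x powr b * h x powr c \<partial>M) \<le>
      (\<integral>x. f x \<partial>M) powr a * (\<integral>x. g x \<partial>M) powr b * (\<integral>x. h x \<partial>M) powr c"
    using integral_Hoelder[of "{0, 1, 2}" ?a M ?f] assms(1-4) by (auto simp: mult.assoc add.assoc)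
qed

subsection \<open>Test functions\<close>

lemma grad_derivative:
  fixes f :: "real^'n::finite \<Rightarrow> real"
  assumes "f differentiable (at x)"
  shows "(f has_derivative (\<lambda>h. grad f x \<bullet> h)) (at x)"
proof -
  let ?D = "frechet_derivative f (at x)"
  have D: "(f has_derivative ?D) (at x)" using assms by (simp add: frechet_derivative_works)
  then interpret D: linear ?D by (rule has_derivative_linear)
  have "?D h = grad f x \<bullet> h" for h
  proof -
    have "?D h = ?D (\<Sum>i\<in>UNIV. h $ i *\<^sub>R axis i 1)"
      by (subst basis_expansion[of h, symmetric]) (simp add: scalar_mult_eq_scaleR)
    also have "\<dots> = grad f x \<bullet> h"
      by (simp add: D.sum D.scale inner_vec_def grad_def mult.commute)
    finally show ?thesis .
  qed
  then have "?D = (\<lambda>h. grad f x \<bullet> h)" by auto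
  with D show ?thesis by metis
qed

lemma grad_eqI:
  fixes f :: "real^'n::finite \<Rightarrow> real"
  assumes "(f has_derivative (\<lambda>h. g \<bullet> h)) (at x)"
  shows "grad f x = g"
  unfolding grad_def frechet_derivative_at[OF assms, symmetric] by (simp add: vec_eq_iff inner_axis)

lemma C_diff_Suc_imp: "C_diff (Suc k) f \<Longrightarrow> C_diff k f"
proof (induction k arbitrary: f)
  case 0
  then show ?case
    by (auto simp: continuous_on_eq_continuous_at differentiable_imp_continuous_within)
qed simp

lemma C_diff_imp_differentiable: "C_diff (Suc k) f \<Longrightarrow> f differentiable (at x)"
  by simp

lemma C_diff_const: "C_diff k (\<lambda>x. c)"
proof (induction k arbitrary: c)
  case (Suc k)
  have "grad (\<lambda>x. c) x = (0 :: real^'a)" for x by (intro grad_eqI) simp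
  then show ?case using Suc by simp
qed simp

lemma C_diff_add:
  fixes f g :: "real^'n::finite \<Rightarrow> real"
  shows "C_diff k f \<Longrightarrow> C_diff k g \<Longrightarrow> C_diff k (\<lambda>x. f x + g x)"
proof (induction k arbitrary: f g)
  case (Suc k)
  have "grad (\<lambda>x. f x + g x) x = grad f x + grad g x" for x
    using Suc.prems by (intro grad_eqI)
      (auto simp: inner_add_left intro!: has_derivative_add grad_derivative)
  then show ?case using Suc by simp
qed (auto intro: continuous_intros)

lemma C_diff_mult:
  fixes f g :: "real^'n::finite \<Rightarrow> real"
  shows "C_diff k f \<Longrightarrow> C_diff k g \<Longrightarrow> C_diff k (\<lambda>x. f x * g x)"
proof (induction k arbitrary: f g)
  case (Suc k)
  have "grad (\<lambda>x. f x * g x) x = f x *\<^sub>R grad g x + g x *\<^sub>R grad f x" for x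
  proof (rule grad_eqI)
    have "(f has_derivative (\<lambda>h. grad f x \<bullet> h)) (at x)" "(g has_derivative (\<lambda>h. grad g x \<bullet> h)) (at x)"
      using Suc.prems by (auto intro: grad_derivative)
    from has_derivative_mult[OF this]
    show "((\<lambda>x. f x * g x) has_derivative (\<lambda>h. (f x *\<^sub>R grad g x + g x *\<^sub>R grad f x) \<bullet> h)) (at x)"
      by (simp add: inner_add_left mult.commute)
  qed
  moreover have "C_diff k f" "C_diff k g" using Suc.prems by (blast intro: C_diff_Suc_imp)+
  ultimately show ?case using Suc.prems by (auto intro!: C_diff_add Suc.IH)
qed (auto intro: continuous_intros)

lemma C_diff_power:
  fixes f :: "real^'n::finite \<Rightarrow> real"
  shows "C_diff k f \<Longrightarrow> C_diff k (\<lambda>x. f x ^ m)"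
  by (induction m) (auto intro: C_diff_const C_diff_mult)

lemma C_diff_sum:
  fixes f :: "'i \<Rightarrow> real^'n::finite \<Rightarrow> real"
  shows "(\<And>i. i \<in> I \<Longrightarrow> C_diff k (f i)) \<Longrightarrow> C_diff k (\<lambda>x. \<Sum>i\<in>I. f i x)"
  by (induction I rule: infinite_finite_induct) (auto intro: C_diff_const C_diff_add)

text \<open>The powers start at 1, so the polynomial vanishes wherever \<phi> does and its support
  stays inside that of \<phi>.\<close>

lemma test_functions_polynomial:
  fixes \<phi> :: "real^'n::finite \<Rightarrow> real"
  assumes "\<phi> \<in> test_functions \<Omega>"
  shows "(\<lambda>x. \<Sum>i\<le>m. c i * \<phi> x ^ Suc i) \<in> test_functions \<Omega>"
proof -
  let ?h = "\<lambda>x. \<Sum>i\<le>m. c i * \<phi> x ^ Suc i"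
  have "{x. ?h x \<noteq> 0} \<subseteq> {x. \<phi> x \<noteq> 0}" by (auto simp: sum.neutral)
  then have "closure {x. ?h x \<noteq> 0} \<subseteq> closure {x. \<phi> x \<noteq> 0}" by (rule closure_mono)
  moreover have "C_diff k ?h" for k
    using assms by (intro C_diff_sum C_diff_mult C_diff_const C_diff_power) (auto simp: test_functions_def)
  ultimately show ?thesis
    using assms compact_Int_closed[of "closure {x. \<phi> x \<noteq> 0}" "closure {x. ?h x \<noteq> 0}"]
    by (auto simp: test_functions_def Int_absorb1)
qed

lemma test_functions_differentiable:
  "\<phi> \<in> test_functions \<Omega> \<Longrightarrow> \<phi> differentiable (at x)"
  unfolding test_functions_def by (blast intro: C_diff_imp_differentiable)

lemma test_functions_derivative:
  fixes \<phi> :: "real^'n::finite \<Rightarrow> real"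
  assumes "\<phi> \<in> test_functions \<Omega>"
  shows "(\<phi> has_derivative (\<lambda>h. grad \<phi> x \<bullet> h)) (at x)"
  using assms by (intro grad_derivative test_functions_differentiable)

lemma test_functions_continuous:
  fixes \<phi> :: "real^'n::finite \<Rightarrow> real"
  assumes "\<phi> \<in> test_functions \<Omega>"
  shows "continuous_on UNIV \<phi>" "continuous_on UNIV (grad \<phi>)"
proof -
  have C: "C_diff 0 \<phi>" "C_diff (Suc 0) \<phi>" using assms unfolding test_functions_def by blast+
  then show "continuous_on UNIV \<phi>" by simp
  have "continuous_on UNIV (\<lambda>x. \<chi> i. grad \<phi> x $ i)"
    using C by (intro continuous_on_vec_lambda) simp
  then show "continuous_on UNIV (grad \<phi>)" by simp
qed

lemma test_functions_support:
  fixes \<phi> :: "real^'n::finite \<Rightarrow> real"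
  assumes "\<phi> \<in> test_functions \<Omega>"
  obtains K where "compact K" "K \<subseteq> \<Omega>" "\<And>x. x \<notin> K \<Longrightarrow> \<phi> x = 0" "\<And>x. x \<notin> K \<Longrightarrow> grad \<phi> x = 0"
proof
  let ?K = "closure {x. \<phi> x \<noteq> 0}"
  show "compact ?K" "?K \<subseteq> \<Omega>" using assms by (auto simp: test_functions_def)
  show zero: "\<phi> x = 0" if "x \<notin> ?K" for x using that closure_subset[of "{x. \<phi> x \<noteq> 0}"] by auto
  show "grad \<phi> x = 0" if "x \<notin> ?K" for x
  proof (rule grad_eqI)
    have "((\<lambda>_. 0) has_derivative (\<lambda>h. 0 \<bullet> h)) (at x)" by simp
    then show "(\<phi> has_derivative (\<lambda>h. 0 \<bullet> h)) (at x)"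
    proof (rule has_derivative_transform_within_open[where s = "- ?K"])
      show "0 = \<phi> y" if "y \<in> - ?K" for y using zero[of y] that by simp
      show "open (- ?K)" by (rule open_Compl) simp
    qed (use that in simp_all)
  qed
qed

section \<open>Powers along coordinate lines and the Sobolev inequality on the whole space\<close>

text \<open>Caratheodory's form of the derivative: mere continuity of \<kappa> at 0 is enough. It
  settles the origin both for |y|^\<gamma> and for the truncated powers, whose second factors need
  not be differentiable there.\<close>

lemma DERIV_mult_at_0:
  fixes \<kappa> :: "real \<Rightarrow> real"
  assumes "isCont \<kappa> 0"
  shows "((\<lambda>t. t * \<kappa> t) has_real_derivative \<kappa> 0) (at 0)"
  unfolding CARAT_DERIV using assms by (intro exI[of _ \<kappa>]) (auto simp: mult.commute)

lemma DERIV_abs_powr: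
  fixes y :: real
  assumes "1 < \<gamma>"
  shows "((\<lambda>y. \<bar>y\<bar> powr \<gamma>) has_real_derivative (\<gamma> * sgn y * \<bar>y\<bar> powr (\<gamma> - 1))) (at y)"
proof -
  consider "y = 0" | "0 < y" | "y < 0" by linarith
  then show ?thesis
  proof cases
    case 1
    \<comment> \<open>At the origin, |y|^\<gamma> is y times this factor, which tends to 0 because
      \<gamma> > 1.\<close>
    let ?\<kappa> = "\<lambda>y :: real. sgn y * \<bar>y\<bar> powr (\<gamma> - 1)"
    have "((\<lambda>y :: real. \<bar>y\<bar> powr (\<gamma> - 1)) \<longlongrightarrow> \<bar>0\<bar> powr (\<gamma> - 1)) (at 0)"
      using assms by (intro tendsto_intros) auto
    then have "((\<lambda>y :: real. \<bar>y\<bar> powr (\<gamma> - 1)) \<longlongrightarrow> 0) (at 0)" by simp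
    then have "(?\<kappa> \<longlongrightarrow> 0) (at 0)"
      by (rule Lim_null_comparison[OF always_eventually, rotated]) (auto simp: abs_mult abs_sgn_eq)
    then have "isCont ?\<kappa> 0" by (simp add: isCont_def)
    from DERIV_mult_at_0[OF this]
    have "((\<lambda>y. y * ?\<kappa> y) has_real_derivative 0) (at 0)" by simp
    moreover have "(\<lambda>y. y * ?\<kappa> y) = (\<lambda>y. \<bar>y\<bar> powr \<gamma>)"
    proof
      fix y :: real
      have "y * ?\<kappa> y = \<bar>y\<bar> powr 1 * \<bar>y\<bar> powr (\<gamma> - 1)"
        by (simp add: mult.assoc[symmetric] flip: abs_sgn)
      then show "y * ?\<kappa> y = \<bar>y\<bar> powr \<gamma>" unfolding powr_add[symmetric] by simp
    qed
    ultimately show ?thesis using 1 by simp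
  next
    case 2
    have "((\<lambda>y. y powr \<gamma>) has_real_derivative (\<gamma> * y powr (\<gamma> - 1))) (at y)"
      using 2 by (rule has_real_derivative_powr)
    then have "((\<lambda>y. \<bar>y\<bar> powr \<gamma>) has_real_derivative (\<gamma> * y powr (\<gamma> - 1))) (at y)"
      by (rule has_field_derivative_transform_within_open[where S = "{0<..}"]) (use 2 in auto)
    then show ?thesis using 2 by simp
  next
    case 3
    have "((\<lambda>y. (- y) powr \<gamma>) has_real_derivative (\<gamma> * (- y) powr (\<gamma> - 1) * (-1))) (at y)"
      using 3 by (auto intro!: derivative_eq_intros)
    then have "((\<lambda>y. \<bar>y\<bar> powr \<gamma>) has_real_derivative (\<gamma> * (- y) powr (\<gamma> - 1) * (-1))) (at y)"
      by (rule has_field_derivative_transform_within_open[where S = "{..<0}"]) (use 3 in auto)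
    then show ?thesis using 3 by simp
  qed
qed

lemma upd_has_vector_derivative: "((\<lambda>t. upd x i t) has_vector_derivative axis i 1) (at t within S)"
proof -
  have "upd x i = (\<lambda>t. upd x i 0 + t *\<^sub>R axis i 1)"
    by (auto simp: fun_eq_iff vec_eq_iff upd_nth axis_def)
  moreover have "((\<lambda>t. upd x i 0 + t *\<^sub>R axis i 1) has_vector_derivative axis i 1) (at t within S)"
    by (auto intro!: derivative_eq_intros)
  ultimately show ?thesis by simp
qed

text \<open>The fundamental theorem of calculus along the line through x in direction i, started at
  a point where \<phi> vanishes. The exponent \<gamma> > 1 keeps |\<phi>|^\<gamma> differentiable at
  the zeros of \<phi>, and the integral up to x is enlarged to the whole line.\<close>

lemma test_function_powr_le_marg:
  fixes \<phi> :: "real^'n::finite \<Rightarrow> real"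
  assumes \<phi>: "\<phi> \<in> test_functions \<Omega>" and \<gamma>: "1 < \<gamma>"
  shows "ennreal (\<bar>\<phi> x\<bar> powr \<gamma>) \<le> marg i (\<lambda>x. ennreal (\<gamma> * \<bar>\<phi> x\<bar> powr (\<gamma> - 1) * norm (grad \<phi> x))) x"
proof -
  obtain K where K: "compact K" "\<And>x. x \<notin> K \<Longrightarrow> \<phi> x = 0"
    using test_functions_support[OF \<phi>] by metis
  obtain R where R: "\<And>x. x \<in> K \<Longrightarrow> norm x \<le> R"
    using compact_imp_bounded[OF K(1)] unfolding bounded_iff by auto
  \<comment> \<open>The choice of r puts it to the left of s and below -R, hence outside the
    support.\<close>
  define s r where "s = x $ i" and "r = - \<bar>R\<bar> - \<bar>s\<bar> - 1"
  have "r \<le> s" by (simp add: r_def)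
  have "\<phi> (upd x i r) = 0"
  proof (rule K(2), rule notI)
    assume "upd x i r \<in> K"
    then have "\<bar>upd x i r $ i\<bar> \<le> R" using R component_le_norm_cart order_trans by blast
    then show False by (simp add: upd_nth r_def)
  qed
  define h k l where "h t = \<bar>\<phi> (upd x i t)\<bar> powr \<gamma>"
    and "k t = \<gamma> * sgn (\<phi> (upd x i t)) * \<bar>\<phi> (upd x i t)\<bar> powr (\<gamma> - 1) * (grad \<phi> (upd x i t) $ i)"
    and "l t = \<gamma> * \<bar>\<phi> (upd x i t)\<bar> powr (\<gamma> - 1) * norm (grad \<phi> (upd x i t))" for t
  have deriv: "(h has_vector_derivative k t) (at t within S)" for t S
  proof -
    have "((\<lambda>t. \<phi> (upd x i t)) has_vector_derivative (grad \<phi> (upd x i t) \<bullet> axis i 1)) (at t within S)"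
      using vector_derivative_diff_chain_within[OF upd_has_vector_derivative[of x i t S]
          has_derivative_at_withinI[OF test_functions_derivative[OF \<phi>]]]
      by (simp add: o_def)
    then have "((\<lambda>t. \<phi> (upd x i t)) has_real_derivative (grad \<phi> (upd x i t) $ i)) (at t within S)"
      by (simp add: has_real_derivative_iff_has_vector_derivative inner_axis)
    from DERIV_chain2[OF DERIV_abs_powr[OF \<gamma>] this]
    show ?thesis unfolding h_def k_def by (simp add: has_real_derivative_iff_has_vector_derivative)
  qed
  have "(k has_integral h s - h r) {r..s}"
    by (rule fundamental_theorem_of_calculus[OF \<open>r \<le> s\<close> deriv])
  then have k: "(k has_integral \<bar>\<phi> x\<bar> powr \<gamma>) {r..s}"
    using \<open>\<phi> (upd x i r) = 0\<close> \<gamma> by (simp add: h_def s_def)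
  have upd_cont: "continuous_on UNIV (\<lambda>t. upd x i t)"
    using upd_has_vector_derivative[of x i _ UNIV]
    by (auto simp: continuous_on_eq_continuous_at intro!: has_vector_derivative_continuous)
  have cont: "continuous_on UNIV (\<lambda>t. \<phi> (upd x i t))" "continuous_on UNIV (\<lambda>t. grad \<phi> (upd x i t))"
    by (auto intro: continuous_on_compose2[OF _ upd_cont] test_functions_continuous[OF \<phi>])
  have l_cont: "continuous_on UNIV l"
    unfolding l_def using \<gamma> by (intro continuous_intros continuous_on_powr' cont) auto
  have l: "(l has_integral integral {r..s} l) {r..s}"
    by (intro integrable_integral integrable_continuous_real continuous_on_subset[OF l_cont]) auto
  have "k t \<le> l t" for t
  proof -
    have "k t \<le> \<bar>k t\<bar>" by simp
    also have "\<dots> = \<gamma> * \<bar>sgn (\<phi> (upd x i t))\<bar> * \<bar>\<phi> (upd x i t)\<bar> powr (\<gamma> - 1) * \<bar>grad \<phi> (upd x i t) $ i\<bar>"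
      using \<gamma> by (simp add: k_def abs_mult)
    also have "\<dots> \<le> \<gamma> * 1 * \<bar>\<phi> (upd x i t)\<bar> powr (\<gamma> - 1) * norm (grad \<phi> (upd x i t))"
      using \<gamma> by (intro mult_mono component_le_norm_cart) (auto simp: abs_sgn_eq)
    finally show ?thesis by (simp add: l_def)
  qed
  with k l have "\<bar>\<phi> x\<bar> powr \<gamma> \<le> integral {r..s} l" by (rule has_integral_le)
  then have "ennreal (\<bar>\<phi> x\<bar> powr \<gamma>) \<le> ennreal (integral {r..s} l)" by (rule ennreal_leI)
  also have "ennreal (integral {r..s} l) = (\<integral>\<^sup>+t. ennreal (if t \<in> {r..s} then l t else 0) \<partial>lborel)"
  proof (rule nn_integral_has_integral_lborel[symmetric])
    show "((\<lambda>t. if t \<in> {r..s} then l t else 0) has_integral integral {r..s} l) UNIV"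
      using l by (simp only: has_integral_restrict_UNIV)
    show "(\<lambda>t. if t \<in> {r..s} then l t else 0) \<in> borel_measurable borel"
      using borel_measurable_continuous_onI[OF l_cont] by measurable
  qed (use \<gamma> in \<open>simp add: l_def\<close>)
  also have "\<dots> \<le> (\<integral>\<^sup>+t. ennreal (l t) \<partial>lborel)"
    using \<gamma> by (intro nn_integral_mono ennreal_leI) (auto simp: l_def)
  finally show ?thesis unfolding marg_def l_def .
qed

text \<open>The case of exponent one, applied to |\<phi>|^\<gamma>. The value of \<gamma> is the one
  for which both \<gamma> N/(N-1) and (\<gamma> - 1) p/(p-1) equal P = Np/(N-p), so that after
  Hoelder the same integral E stands on both sides. Dividing by its power 1 - 1/p leaves E to the
  power 1/p - 1/N = 1/P.\<close>

lemma sobolev_test_function_lborel: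
  fixes \<phi> :: "real^'n::finite \<Rightarrow> real"
  assumes p: "1 < p" "p < real CARD('n)" and \<phi>: "\<phi> \<in> test_functions \<Omega>"
  defines "N \<equiv> real CARD('n)"
  shows "(\<integral>x. \<bar>\<phi> x\<bar> powr (N * p / (N - p)) \<partial>lborel) powr ((N - p) / N) \<le>
     (p * (N - 1) / (N - p)) powr p * (\<integral>x. norm (grad \<phi> x) powr p \<partial>lborel)"
proof -
  define \<gamma> where "\<gamma> = p * (N - 1) / (N - p)"
  have N: "p < N" "1 < N" using p by (auto simp: N_def)
  have N2: "2 \<le> CARD('n)" using p by linarith
  have \<gamma>: "1 < \<gamma>" using p N by (simp add: \<gamma>_def field_simps)
  obtain K where K: "compact K" "\<And>x. x \<notin> K \<Longrightarrow> \<phi> x = 0" "\<And>x. x \<notin> K \<Longrightarrow> grad \<phi> x = 0"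
    using test_functions_support[OF \<phi>] by metis
  note cont = test_functions_continuous[OF \<phi>]
  note [measurable] = cont[THEN borel_measurable_continuous_onI]
  have integrableI: "integrable lborel F" if "continuous_on UNIV F" "\<And>x. x \<notin> K \<Longrightarrow> F x = 0"
    for F :: "real^'n \<Rightarrow> real"
  proof -
    have "integrable lborel (\<lambda>x. indicator K x *\<^sub>R F x)"
      using K that by (intro borel_integrable_compact) (auto intro: continuous_on_subset)
    also have "(\<lambda>x. indicator K x *\<^sub>R F x) = F" using that by (auto simp: fun_eq_iff indicator_def)
    finally show ?thesis .
  qed
  define P E D J where "P = N * p / (N - p)" and "E = (\<integral>x. \<bar>\<phi> x\<bar> powr P \<partial>lborel)"
    and "D = (\<integral>x. norm (grad \<phi> x) powr p \<partial>lborel)"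
    and "J = (\<integral>x. \<gamma> * \<bar>\<phi> x\<bar> powr (\<gamma> - 1) * norm (grad \<phi> x) \<partial>lborel)"
  have P: "0 < P" "\<gamma> * (N / (N - 1)) = P" "P * (1 - 1 / p) = \<gamma> - 1"
    using p N by (auto simp: P_def \<gamma>_def divide_simps) (auto simp: algebra_simps)
  have intE: "integrable lborel (\<lambda>x. \<bar>\<phi> x\<bar> powr P)"
    using K P cont by (intro integrableI continuous_on_powr') (auto intro!: continuous_intros)
  have intD: "integrable lborel (\<lambda>x. norm (grad \<phi> x) powr p)"
    using K p cont by (intro integrableI continuous_on_powr') (auto intro!: continuous_intros)
  have intJ: "integrable lborel (\<lambda>x. \<gamma> * \<bar>\<phi> x\<bar> powr (\<gamma> - 1) * norm (grad \<phi> x))"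
    using K \<gamma> cont by (intro integrableI continuous_intros continuous_on_powr') auto
  have nn: "0 \<le> E" "0 \<le> D" "0 \<le> J" using \<gamma> by (auto simp: E_def D_def J_def)
  have exp: "N / (N - 1) \<noteq> 0" using N by auto
  have "ennreal E = (\<integral>\<^sup>+x. epow (ennreal (\<bar>\<phi> x\<bar> powr \<gamma>)) (N / (N - 1)) \<partial>lborel)"
    unfolding E_def using P exp by (simp add: nn_integral_eq_integral[OF intE, symmetric] epow_ennreal powr_powr)
  also have "\<dots> \<le> epow (\<integral>\<^sup>+x. ennreal (\<gamma> * \<bar>\<phi> x\<bar> powr (\<gamma> - 1) * norm (grad \<phi> x)) \<partial>lborel) (N / (N - 1))"
    unfolding N_def using N2 by (intro nn_integral_le_of_le_margs test_function_powr_le_marg[OF \<phi> \<gamma>]) measurable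
  also have "\<dots> = ennreal (J powr (N / (N - 1)))"
    unfolding J_def using \<gamma> exp by (subst nn_integral_eq_integral[OF intJ]) (auto intro!: epow_ennreal)
  finally have EJ: "E \<le> J powr (N / (N - 1))" by (simp add: ennreal_le_iff)
  have "J = \<gamma> * (\<integral>x. (\<bar>\<phi> x\<bar> powr P) powr (1 - 1 / p) * (norm (grad \<phi> x) powr p) powr (1 / p) \<partial>lborel)"
    using p P by (simp add: J_def powr_powr mult.assoc)
  also have "\<dots> \<le> \<gamma> * (E powr (1 - 1 / p) * D powr (1 / p))"
    unfolding E_def D_def using p \<gamma> intE intD
    by (intro mult_left_mono Hoelder2) (auto simp: field_simps)
  finally have JE: "J \<le> \<gamma> * (E powr (1 - 1 / p) * D powr (1 / p))" .
  show ?thesis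
  proof (cases "E = 0")
    case True
    then show ?thesis using nn by (simp add: E_def D_def P_def flip: \<gamma>_def)
  next
    case False
    then have E: "0 < E" using nn by simp
    have "E powr (1 - 1 / N) \<le> (J powr (N / (N - 1))) powr (1 - 1 / N)"
      using EJ E N by (intro powr_mono2) auto
    also have "\<dots> = J"
    proof -
      have "N / (N - 1) * (1 - 1 / N) = 1" using N by (simp add: field_simps)
      then show ?thesis using nn N by (simp add: powr_powr)
    qed
    also note JE
    finally have "E powr (1 - 1 / N) / E powr (1 - 1 / p) \<le> \<gamma> * D powr (1 / p)"
      using E by (simp add: divide_le_eq mult_ac)
    also have "E powr (1 - 1 / N) / E powr (1 - 1 / p) = E powr (1 / p - 1 / N)"
      by (simp add: powr_diff[symmetric])
    finally have "(E powr (1 / p - 1 / N)) powr p \<le> (\<gamma> * D powr (1 / p)) powr p"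
      using p by (intro powr_mono2) auto
    also have "(E powr (1 / p - 1 / N)) powr p = E powr ((N - p) / N)"
    proof -
      have "(1 / p - 1 / N) * p = (N - p) / N" using p N by (auto simp: divide_simps algebra_simps)
      then show ?thesis by (simp only: powr_powr)
    qed
    also have "(\<gamma> * D powr (1 / p)) powr p = \<gamma> powr p * D"
      using p \<gamma> nn by (simp add: powr_mult powr_powr)
    finally show ?thesis by (simp add: E_def D_def P_def \<gamma>_def)
  qed
qed

subsection \<open>The Beppo-Levi space\<close>

lemma powr_norm_add_le:
  fixes a b :: "'a::real_normed_vector"
  assumes "0 < r"
  shows "norm (a + b) powr r \<le> 2 powr r * (norm a powr r + norm b powr r)"
proof -
  let ?m = "max (norm a) (norm b)"
  have "norm (a + b) powr r \<le> (2 * ?m) powr r"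
    using assms norm_triangle_ineq[of a b] by (intro powr_mono2) (auto simp: max_def)
  also have "\<dots> = 2 powr r * ?m powr r" by (simp add: powr_mult)
  also have "\<dots> \<le> 2 powr r * (norm a powr r + norm b powr r)"
    by (intro mult_left_mono) (auto simp: max_def)
  finally show ?thesis .
qed

lemma tendsto_powr_0_iff:
  fixes f :: "nat \<Rightarrow> real"
  assumes "0 < r" "\<And>n. 0 \<le> f n"
  shows "(\<lambda>n. f n powr r) \<longlonglongrightarrow> 0 \<longleftrightarrow> f \<longlonglongrightarrow> 0"
proof
  assume "f \<longlonglongrightarrow> 0"
  then show "(\<lambda>n. f n powr r) \<longlonglongrightarrow> 0" using assms by (intro tendsto_zero_powrI) auto
next
  assume "(\<lambda>n. f n powr r) \<longlonglongrightarrow> 0"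
  then have "(\<lambda>n. (f n powr r) powr (1 / r)) \<longlonglongrightarrow> 0"
    by (rule tendsto_zero_powrI[where b = "1 / r", OF _ tendsto_const]) (use assms in auto)
  then show "f \<longlonglongrightarrow> 0" using assms by (simp add: powr_powr)
qed

lemma Lp_norm_tendsto_0_iff:
  "0 < r \<Longrightarrow> (\<lambda>n. Lp_norm r \<Omega> (f n)) \<longlonglongrightarrow> 0 \<longleftrightarrow> (\<lambda>n. LINT x|lebesgue_on \<Omega>. norm (f n x) powr r) \<longlonglongrightarrow> 0"
  unfolding Lp_norm_def by (subst tendsto_powr_0_iff) auto

lemma in_Lp_add:
  assumes "0 < r" "in_Lp r \<Omega> f" "in_Lp r \<Omega> g"
  shows "in_Lp r \<Omega> (\<lambda>x. f x + g x)"
proof -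
  note [measurable] = assms(2,3)[unfolded in_Lp_def, THEN conjunct1]
  have "integrable (lebesgue_on \<Omega>) (\<lambda>x. 2 powr r * (norm (f x) powr r + norm (g x) powr r))"
    using assms by (auto simp: in_Lp_def)
  then have "integrable (lebesgue_on \<Omega>) (\<lambda>x. norm (f x + g x) powr r)"
    by (rule Bochner_Integration.integrable_bound) (use assms in \<open>auto simp: powr_norm_add_le\<close>)
  then show ?thesis by (simp add: in_Lp_def)
qed

lemma in_Lp_uminus: "in_Lp r \<Omega> f \<Longrightarrow> in_Lp r \<Omega> (\<lambda>x. - f x)"
  by (simp add: in_Lp_def)

lemma in_Lp_diff:
  assumes "0 < r" "in_Lp r \<Omega> f" "in_Lp r \<Omega> g"
  shows "in_Lp r \<Omega> (\<lambda>x. f x - g x)"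
  using in_Lp_add[OF assms(1,2) in_Lp_uminus[OF assms(3)]] by simp

lemma integral_powr_add_le:
  assumes "0 < r" "in_Lp r \<Omega> f" "in_Lp r \<Omega> g"
  shows "(LINT x|lebesgue_on \<Omega>. norm (f x + g x) powr r) \<le>
    2 powr r * ((LINT x|lebesgue_on \<Omega>. norm (f x) powr r) + (LINT x|lebesgue_on \<Omega>. norm (g x) powr r))"
proof -
  have "(LINT x|lebesgue_on \<Omega>. norm (f x + g x) powr r) \<le>
    (LINT x|lebesgue_on \<Omega>. 2 powr r * (norm (f x) powr r + norm (g x) powr r))"
    using assms by (intro integral_mono' powr_norm_add_le) (auto simp: in_Lp_def)
  then show ?thesis using assms by (simp add: in_Lp_def)
qed

lemma borel_measurable_lebesgue_on:
  "f \<in> borel_measurable borel \<Longrightarrow> f \<in> borel_measurable (lebesgue_on \<Omega>)"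
  by (intro measurable_restrict_space1 measurable_completion) simp

text \<open>The Sobolev inequality above is proved on the whole space, whereas the equation lives on
  \<open>lebesgue_on \<Omega>\<close>; functions supported in \<Omega> cross this bridge.\<close>

lemma
  fixes F :: "real^'n::finite \<Rightarrow> real"
  assumes "\<Omega> \<in> sets lebesgue" "F \<in> borel_measurable borel" "\<And>x. x \<notin> \<Omega> \<Longrightarrow> F x = 0"
  shows integral_lebesgue_on_eq_lborel: "(LINT x|lebesgue_on \<Omega>. F x) = (LINT x|lborel. F x)"
    and integrable_lebesgue_on_iff_lborel: "integrable (lebesgue_on \<Omega>) F \<longleftrightarrow> integrable lborel F"
proof -
  have F: "(\<lambda>x. indicator \<Omega> x *\<^sub>R F x) = F" using assms(3) by (auto simp: fun_eq_iff indicator_def)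
  show "(LINT x|lebesgue_on \<Omega>. F x) = (LINT x|lborel. F x)"
    using assms by (subst integral_restrict_space) (auto simp del: real_scaleR_def simp: F integral_completion)
  show "integrable (lebesgue_on \<Omega>) F \<longleftrightarrow> integrable lborel F"
    using assms by (subst integrable_restrict_space) (auto simp del: real_scaleR_def simp: F integrable_completion)
qed

lemma in_Lp_compact_support:
  fixes f :: "real^'n::finite \<Rightarrow> 'b::euclidean_space"
  assumes "\<Omega> \<in> sets lebesgue" "0 < r" "continuous_on UNIV f" "compact K" "K \<subseteq> \<Omega>" "\<And>x. x \<notin> K \<Longrightarrow> f x = 0"
  shows "in_Lp r \<Omega> f"
proof -
  have cont: "continuous_on UNIV (\<lambda>x. norm (f x) powr r)"
    using assms by (intro continuous_on_powr' continuous_intros) auto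
  have "integrable lborel (\<lambda>x. indicator K x *\<^sub>R (norm (f x) powr r))"
    using assms cont by (intro borel_integrable_compact) (auto intro: continuous_on_subset)
  also have "(\<lambda>x. indicator K x *\<^sub>R (norm (f x) powr r)) = (\<lambda>x. norm (f x) powr r)"
    using assms by (auto simp: indicator_def fun_eq_iff)
  finally have "integrable (lebesgue_on \<Omega>) (\<lambda>x. norm (f x) powr r)"
    using assms cont
    by (subst integrable_lebesgue_on_iff_lborel) (auto intro!: borel_measurable_continuous_onI)
  then show ?thesis
    unfolding in_Lp_def using assms
    by (auto intro!: borel_measurable_lebesgue_on borel_measurable_continuous_onI)
qed

lemma test_functions_in_Lp:
  fixes \<phi> :: "real^'n::finite \<Rightarrow> real"
  assumes "\<phi> \<in> test_functions \<Omega>" "\<Omega> \<in> sets lebesgue" "0 < r"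
  shows "in_Lp r \<Omega> \<phi>" "in_Lp r \<Omega> (grad \<phi>)"
  using test_functions_support[OF assms(1)] in_Lp_compact_support[OF assms(2,3)]
    test_functions_continuous[OF assms(1)] by metis+

lemma sobolev_test_function:
  fixes \<phi> :: "real^'n::finite \<Rightarrow> real"
  assumes p: "1 < p" "p < real CARD('n)" and \<phi>: "\<phi> \<in> test_functions \<Omega>" and \<Omega>: "\<Omega> \<in> sets lebesgue"
  defines "N \<equiv> real CARD('n)"
  shows "(LINT x|lebesgue_on \<Omega>. norm (\<phi> x) powr sobolev_conj TYPE('n) p) powr ((N - p) / N) \<le>
     (p * (N - 1) / (N - p)) powr p * (LINT x|lebesgue_on \<Omega>. norm (grad \<phi> x) powr p)"
proof -
  obtain K where K: "K \<subseteq> \<Omega>" "\<And>x. x \<notin> K \<Longrightarrow> \<phi> x = 0" "\<And>x. x \<notin> K \<Longrightarrow> grad \<phi> x = 0"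
    using test_functions_support[OF \<phi>] by metis
  note [measurable] = test_functions_continuous[OF \<phi>, THEN borel_measurable_continuous_onI]
  have "(LINT x|lebesgue_on \<Omega>. norm (\<phi> x) powr sobolev_conj TYPE('n) p) =
      (LINT x|lborel. \<bar>\<phi> x\<bar> powr (N * p / (N - p)))"
    unfolding sobolev_conj_def N_def[symmetric] real_norm_def
    using K \<Omega> by (intro integral_lebesgue_on_eq_lborel) auto
  moreover have "(LINT x|lebesgue_on \<Omega>. norm (grad \<phi> x) powr p) = (LINT x|lborel. norm (grad \<phi> x) powr p)"
    using K \<Omega> by (intro integral_lebesgue_on_eq_lborel) auto
  ultimately show ?thesis
    using sobolev_test_function_lborel[OF p \<phi>] by (simp add: N_def)
qed

lemma in_D1pD:
  fixes u :: "real^'n::finite \<Rightarrow> real"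
  assumes "in_D1p \<Omega> p u Du" "1 < p" "p < real CARD('n)"
  obtains \<phi> where "\<And>n. \<phi> n \<in> test_functions \<Omega>"
    "(\<lambda>n. LINT x|lebesgue_on \<Omega>. norm (grad (\<phi> n) x - Du x) powr p) \<longlonglongrightarrow> 0"
    "(\<lambda>n. LINT x|lebesgue_on \<Omega>. norm (\<phi> n x - u x) powr sobolev_conj TYPE('n) p) \<longlonglongrightarrow> 0"
proof -
  have "0 < sobolev_conj TYPE('n) p" using assms by (simp add: sobolev_conj_def)
  with assms show ?thesis
    unfolding in_D1p_def by (auto simp: Lp_norm_tendsto_0_iff intro: that)
qed

lemma in_D1pI:
  fixes u :: "real^'n::finite \<Rightarrow> real"
  assumes "1 < p" "p < real CARD('n)"
    "in_Lp (sobolev_conj TYPE('n) p) \<Omega> u" "in_Lp p \<Omega> Du" "\<And>n. \<phi> n \<in> test_functions \<Omega>"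
    "(\<lambda>n. LINT x|lebesgue_on \<Omega>. norm (grad (\<phi> n) x - Du x) powr p) \<longlonglongrightarrow> 0"
    "(\<lambda>n. LINT x|lebesgue_on \<Omega>. norm (\<phi> n x - u x) powr sobolev_conj TYPE('n) p) \<longlonglongrightarrow> 0"
  shows "in_D1p \<Omega> p u Du"
proof -
  have "0 < sobolev_conj TYPE('n) p" using assms by (simp add: sobolev_conj_def)
  then have u: "(\<lambda>n. Lp_norm (sobolev_conj TYPE('n) p) \<Omega> (\<lambda>x. \<phi> n x - u x)) \<longlonglongrightarrow> 0"
    using assms(7) by (rule Lp_norm_tendsto_0_iff[THEN iffD2])
  have "0 < p" using assms(1) by simp
  then have Du: "(\<lambda>n. Lp_norm p \<Omega> (\<lambda>x. grad (\<phi> n) x - Du x)) \<longlonglongrightarrow> 0"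
    using assms(6) by (rule Lp_norm_tendsto_0_iff[THEN iffD2])
  show ?thesis
    unfolding in_D1p_def
    by (intro conjI exI[of _ \<phi>] allI assms(3,4,5) u Du)
qed

text \<open>The factor 4 comes from using $|a+b|^r \le 2^r(|a|^r+|b|^r)$ instead of Minkowski's inequality.\<close>

lemma sobolev_D1p:
  fixes u :: "real^'n::finite \<Rightarrow> real"
  assumes u: "in_D1p \<Omega> p u Du" and p: "1 < p" "p < real CARD('n)" and \<Omega>: "\<Omega> \<in> sets lebesgue"
  defines "N \<equiv> real CARD('n)"
  shows "(LINT x|lebesgue_on \<Omega>. norm (u x) powr sobolev_conj TYPE('n) p) powr ((N - p) / N) \<le>
     (4 * p * (N - 1) / (N - p)) powr p * (LINT x|lebesgue_on \<Omega>. norm (Du x) powr p)"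
proof -
  define r where "r = sobolev_conj TYPE('n) p"
  define c where "c = p * (N - 1) / (N - p)"
  have N: "p < N" "1 < N" and r: "0 < r" "r * ((N - p) / N) = p" and c: "0 < c"
    using p by (auto simp: N_def r_def c_def sobolev_conj_def)
  obtain \<phi> where \<phi>: "\<And>n. \<phi> n \<in> test_functions \<Omega>"
    "(\<lambda>n. LINT x|lebesgue_on \<Omega>. norm (grad (\<phi> n) x - Du x) powr p) \<longlonglongrightarrow> 0"
    "(\<lambda>n. LINT x|lebesgue_on \<Omega>. norm (\<phi> n x - u x) powr r) \<longlonglongrightarrow> 0"
    by (rule in_D1pD[OF u p, folded r_def]) (rule that)
  have Lp: "in_Lp r \<Omega> u" "in_Lp p \<Omega> Du" using u by (auto simp: in_D1p_def r_def)
  define E D where "E = (LINT x|lebesgue_on \<Omega>. norm (u x) powr r)"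
    and "D = (LINT x|lebesgue_on \<Omega>. norm (Du x) powr p)"
  define e d where "e n = (LINT x|lebesgue_on \<Omega>. norm (\<phi> n x - u x) powr r)"
    and "d n = (LINT x|lebesgue_on \<Omega>. norm (grad (\<phi> n) x - Du x) powr p)" for n
  have nn: "0 \<le> E" "0 \<le> D" "0 \<le> d n" for n by (auto simp: E_def D_def d_def)
  define \<kappa> where "\<kappa> = N / (N - p)"
  have \<kappa>: "0 < \<kappa>" "(N - p) / N * \<kappa> = 1" "1 / \<kappa> = (N - p) / N" using N p by (auto simp: \<kappa>_def)
  \<comment> \<open>Sobolev's inequality is applied to the test functions only. The errors e n and d
    n, both tending to 0, account for passing from u to \<phi> n on the left and from the gradient
    of \<phi> n to Du on the right.\<close>
  have bound: "E \<le> 2 powr r * (e n + (c powr p * (2 powr p * (d n + D))) powr \<kappa>)" for n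
  proof -
    have "E = (LINT x|lebesgue_on \<Omega>. norm (- (\<phi> n x - u x) + \<phi> n x) powr r)" by (simp add: E_def)
    also have "\<dots> \<le> 2 powr r * ((LINT x|lebesgue_on \<Omega>. norm (- (\<phi> n x - u x)) powr r) +
        (LINT x|lebesgue_on \<Omega>. norm (\<phi> n x) powr r))"
      using test_functions_in_Lp(1)[OF \<phi>(1) \<Omega> r(1)] Lp(1)
      by (intro integral_powr_add_le in_Lp_uminus in_Lp_diff r(1))
    also have "(LINT x|lebesgue_on \<Omega>. norm (- (\<phi> n x - u x)) powr r) = e n"
      by (simp add: e_def norm_minus_commute abs_minus_commute)
    also have "(LINT x|lebesgue_on \<Omega>. norm (\<phi> n x) powr r) \<le>
        (c powr p * (2 powr p * (d n + D))) powr \<kappa>"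
    proof -
      let ?F = "LINT x|lebesgue_on \<Omega>. norm (\<phi> n x) powr r"
      have "(LINT x|lebesgue_on \<Omega>. norm (grad (\<phi> n) x) powr p) =
          (LINT x|lebesgue_on \<Omega>. norm ((grad (\<phi> n) x - Du x) + Du x) powr p)" by simp
      also have "\<dots> \<le> 2 powr p * (d n + D)"
        unfolding d_def D_def using test_functions_in_Lp(2)[OF \<phi>(1) \<Omega>] Lp(2) p
        by (intro integral_powr_add_le in_Lp_diff) auto
      finally have "c powr p * (LINT x|lebesgue_on \<Omega>. norm (grad (\<phi> n) x) powr p) \<le>
          c powr p * (2 powr p * (d n + D))" by (rule mult_left_mono) simp
      moreover have "?F powr ((N - p) / N) \<le> c powr p * (LINT x|lebesgue_on \<Omega>. norm (grad (\<phi> n) x) powr p)"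
        using sobolev_test_function[OF p \<phi>(1) \<Omega>, of n] by (simp add: r_def c_def N_def)
      ultimately have "?F powr ((N - p) / N) \<le> c powr p * (2 powr p * (d n + D))"
        by (rule order_trans[rotated])
      then have "(?F powr ((N - p) / N)) powr \<kappa> \<le> (c powr p * (2 powr p * (d n + D))) powr \<kappa>"
        using \<kappa> by (intro powr_mono2) auto
      moreover have "(?F powr ((N - p) / N)) powr \<kappa> = ?F"
        unfolding powr_powr \<kappa>(2) by simp
      ultimately show ?thesis by simp
    qed
    finally show ?thesis by simp
  qed
  have "(\<lambda>n. 2 powr r * (e n + (c powr p * (2 powr p * (d n + D))) powr \<kappa>)) \<longlonglongrightarrow>
      2 powr r * (0 + (c powr p * (2 powr p * (0 + D))) powr \<kappa>)"
    using \<phi>(2,3) \<kappa> nn unfolding e_def[symmetric] d_def[symmetric]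
    by (intro tendsto_intros tendsto_powr') auto
  then have "E \<le> 2 powr r * (0 + (c powr p * (2 powr p * (0 + D))) powr \<kappa>)"
    by (rule LIMSEQ_le_const) (use bound in auto)
  then have "E powr (1 / \<kappa>) \<le> (2 powr r * (c powr p * (2 powr p * D)) powr \<kappa>) powr (1 / \<kappa>)"
    using nn \<kappa>(1) by (intro powr_mono2) auto
  also have "\<dots> = 2 powr (r * (1 / \<kappa>)) * (c powr p * (2 powr p * D)) powr (\<kappa> * (1 / \<kappa>))"
    using nn by (subst powr_mult) (simp_all only: powr_powr)
  also have "\<dots> = 2 powr p * (c powr p * (2 powr p * D))"
  proof -
    have "r * (1 / \<kappa>) = p" "\<kappa> * (1 / \<kappa>) = 1" using r(2) \<kappa>(1) unfolding \<kappa>(3)[symmetric] by auto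
    then show ?thesis using nn by simp
  qed
  also have "\<dots> = (4 * c) powr p * D"
  proof -
    have "(4 :: real) powr p = 2 powr p * 2 powr p" by (simp flip: powr_mult)
    then show ?thesis using c by (simp add: powr_mult)
  qed
  finally show ?thesis by (simp add: E_def D_def r_def c_def \<kappa>(3) mult.assoc)
qed

text \<open>
  Composing a test function with \<open>F\<close> destroys smoothness. Composing it with a polynomial without
  constant term does not, and on the range of a test function such polynomials approximate \<open>F\<close>
  in the $C^1$ norm (approximate $g = F'$ by Weierstrass and integrate).
\<close>

lemma in_D1p_chain:
  fixes u :: "real^'n::finite \<Rightarrow> real" and F g :: "real \<Rightarrow> real"
  assumes u: "in_D1p \<Omega> p u Du" and p: "1 < p" "p < real CARD('n)" and \<Omega>: "\<Omega> \<in> sets lebesgue"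
    and F: "F 0 = 0" "\<And>t. (F has_real_derivative g t) (at t)"
    and g: "continuous_on UNIV g" "\<And>t. \<bar>g t\<bar> \<le> c"
  shows "in_D1p \<Omega> p (\<lambda>x. F (u x)) (\<lambda>x. g (u x) *\<^sub>R Du x)"
proof -
  let ?M = "lebesgue_on \<Omega>"
  define r where "r = sobolev_conj TYPE('n) p"
  have r: "0 < r" using p by (auto simp: r_def sobolev_conj_def)
  have c: "0 \<le> c" using g(2)[of 0] by linarith
  have Lp: "in_Lp r \<Omega> u" "in_Lp p \<Omega> Du" using u by (auto simp: in_D1p_def r_def)
  obtain \<phi> where \<phi>: "\<And>n. \<phi> n \<in> test_functions \<Omega>"
    "(\<lambda>n. LINT x|?M. norm (grad (\<phi> n) x - Du x) powr p) \<longlonglongrightarrow> 0"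
    "(\<lambda>n. LINT x|?M. norm (\<phi> n x - u x) powr r) \<longlonglongrightarrow> 0"
    by (rule in_D1pD[OF u p, folded r_def]) (rule that)
  have Fc: "continuous_on UNIV F"
    using F(2) by (auto simp: continuous_on_eq_continuous_at intro: DERIV_isCont)
  note [measurable] = g(1)[THEN borel_measurable_continuous_onI] Fc[THEN borel_measurable_continuous_onI]
    Lp[unfolded in_Lp_def, THEN conjunct1]
  have F_lip: "\<bar>F s - F t\<bar> \<le> c * \<bar>s - t\<bar>" for s t
    using field_differentiable_bound[of UNIV F g c s t] F(2) g(2) by auto
  have "integrable ?M (\<lambda>x. norm (\<phi> n x - u x) powr r)" for n
    using in_Lp_diff[OF r test_functions_in_Lp(1)[OF \<phi>(1) \<Omega> r] Lp(1)] by (simp add: in_Lp_def)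
  \<comment> \<open>As g is merely continuous, convergence of g (\<phi> n) to g u is available only
    pointwise. A subsequence converging almost everywhere makes dominated convergence applicable to
    the gradients.\<close>
  then obtain s :: "nat \<Rightarrow> nat" where s: "strict_mono s"
    "AE x in ?M. (\<lambda>n. norm (\<phi> (s n) x - u x) powr r) \<longlonglongrightarrow> 0"
    using tendsto_L1_AE_subseq[of ?M "\<lambda>n x. norm (\<phi> n x - u x) powr r"] \<phi>(3) by auto
  define \<psi> where "\<psi> n = \<phi> (s n)" for n
  define \<epsilon> where "\<epsilon> n = inverse (real (Suc n))" for n
  have \<epsilon>: "0 < \<epsilon> n" "\<epsilon> n \<le> 1" "\<epsilon> \<longlonglongrightarrow> 0" for n
    using LIMSEQ_inverse_real_of_nat by (auto simp: \<epsilon>_def [abs_def] field_simps)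
  have \<psi>: "\<And>n. \<psi> n \<in> test_functions \<Omega>"
    "(\<lambda>n. LINT x|?M. norm (grad (\<psi> n) x - Du x) powr p) \<longlonglongrightarrow> 0"
    "(\<lambda>n. LINT x|?M. norm (\<psi> n x - u x) powr r) \<longlonglongrightarrow> 0"
    unfolding \<psi>_def using \<phi> LIMSEQ_subseq_LIMSEQ[OF \<phi>(2) s(1)] LIMSEQ_subseq_LIMSEQ[OF \<phi>(3) s(1)]
    by (auto simp: o_def)
  have AE: "AE x in ?M. (\<lambda>n. \<psi> n x) \<longlonglongrightarrow> u x"
    using s(2)
  proof eventually_elim
    case (elim x)
    then have "(\<lambda>n. norm (\<psi> n x - u x)) \<longlonglongrightarrow> 0" using r by (simp add: tendsto_powr_0_iff \<psi>_def)
    then show ?case using Lim_null tendsto_norm_zero_iff by blast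
  qed
  have \<psi>_meas [measurable]: "\<psi> n \<in> borel_measurable ?M" for n
    using test_functions_in_Lp(1)[OF \<psi>(1) \<Omega> r] by (simp add: in_Lp_def)
  \<comment> \<open>The error in F is measured relative to |\<psi> n x|: a uniform error \<epsilon>
    n need not be small in the Lebesgue norm, since the supports of the \<psi> n may grow.\<close>
  define A where "A n a m \<longleftrightarrow> (\<forall>x. \<bar>g (\<psi> n x) - (\<Sum>i\<le>m. a i * \<psi> n x ^ i)\<bar> \<le> \<epsilon> n \<and>
      \<bar>F (\<psi> n x) - (\<Sum>i\<le>m. a i / real (Suc i) * \<psi> n x ^ Suc i)\<bar> \<le> \<epsilon> n * \<bar>\<psi> n x\<bar>)"
    for n :: nat and a :: "nat \<Rightarrow> real" and m :: nat
  have "\<exists>a m. A n a m" for n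
  proof -
    obtain K where K: "compact K" "\<And>x. x \<notin> K \<Longrightarrow> \<psi> n x = 0"
      using test_functions_support[OF \<psi>(1)] by metis
    have "bounded (\<psi> n ` K)"
      by (intro compact_imp_bounded compact_continuous_image K
          continuous_on_subset[OF test_functions_continuous(1)[OF \<psi>(1)]]) auto
    then obtain R where R: "\<And>x. x \<in> K \<Longrightarrow> \<bar>\<psi> n x\<bar> \<le> R" unfolding bounded_iff by auto
    have R': "\<psi> n x \<in> {- \<bar>R\<bar>..\<bar>R\<bar>}" for x
      using R[of x] K(2)[of x] by (cases "x \<in> K") auto
    obtain q where q: "real_polynomial_function q" "\<And>t. t \<in> {- \<bar>R\<bar>..\<bar>R\<bar>} \<Longrightarrow> \<bar>g t - q t\<bar> < \<epsilon> n"
      using Stone_Weierstrass_real_polynomial_function[of "{- \<bar>R\<bar>..\<bar>R\<bar>}" g "\<epsilon> n"] g(1) \<epsilon>(1)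
      by (auto intro: continuous_on_subset)
    obtain a m where am: "q = (\<lambda>t. \<Sum>i\<le>m. a i * t ^ i)"
      using q(1) unfolding real_polynomial_function_iff_sum by blast
    \<comment> \<open>The antiderivative of q that vanishes at 0. As F vanishes there too, the mean
      value inequality turns the uniform error of q into an error proportional to |t|.\<close>
    define P where "P t = (\<Sum>i\<le>m. a i / real (Suc i) * t ^ Suc i)" for t
    have P: "(P has_real_derivative q t) (at t)" for t
    proof -
      have "((\<lambda>t. a i / real (Suc i) * t ^ Suc i) has_real_derivative a i * t ^ i) (at t)" for i
        using DERIV_cmult[OF DERIV_pow[of "Suc i" t UNIV], of "a i / real (Suc i)"] by (simp del: of_nat_Suc)
      then show ?thesis unfolding P_def [abs_def] am by (intro DERIV_sum) auto
    qed
    have "\<bar>F t - P t\<bar> \<le> \<epsilon> n * \<bar>t\<bar>" if "t \<in> {- \<bar>R\<bar>..\<bar>R\<bar>}" for t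
    proof -
      have "norm ((\<lambda>t. F t - P t) t - (\<lambda>t. F t - P t) 0) \<le> \<epsilon> n * norm (t - 0)"
      proof (rule field_differentiable_bound[where f' = "\<lambda>t. g t - q t"])
        show "((\<lambda>t. F t - P t) has_field_derivative g z - q z) (at z within {- \<bar>R\<bar>..\<bar>R\<bar>})" for z
          by (intro derivative_intros DERIV_subset[OF F(2)] DERIV_subset[OF P]) auto
      qed (use that q(2) in \<open>auto intro: less_imp_le\<close>)
      then show ?thesis by (simp add: F(1) P_def)
    qed
    with R' q(2) have "\<bar>g (\<psi> n x) - q (\<psi> n x)\<bar> \<le> \<epsilon> n \<and> \<bar>F (\<psi> n x) - P (\<psi> n x)\<bar> \<le> \<epsilon> n * \<bar>\<psi> n x\<bar>" for x
      by (blast intro: less_imp_le)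
    then show ?thesis unfolding A_def P_def am by blast
  qed
  then obtain a m where "\<And>n. A n (a n) (m n)" by metis
  then have approx:
    "\<And>n x. \<bar>g (\<psi> n x) - (\<Sum>i\<le>m n. a n i * \<psi> n x ^ i)\<bar> \<le> \<epsilon> n"
    "\<And>n x. \<bar>F (\<psi> n x) - (\<Sum>i\<le>m n. a n i / real (Suc i) * \<psi> n x ^ Suc i)\<bar> \<le> \<epsilon> n * \<bar>\<psi> n x\<bar>"
    unfolding A_def by blast+
  define \<theta> where "\<theta> n x = (\<Sum>i\<le>m n. a n i / real (Suc i) * \<psi> n x ^ Suc i)" for n x
  define q where "q n x = (\<Sum>i\<le>m n. a n i * \<psi> n x ^ i)" for n x
  have \<theta>: "\<theta> n \<in> test_functions \<Omega>" for n
    unfolding \<theta>_def [abs_def] by (intro test_functions_polynomial \<psi>)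
  have grad_\<theta>: "grad (\<theta> n) x = q n x *\<^sub>R grad (\<psi> n) x" for n x
  proof (rule grad_eqI)
    have "((\<lambda>x. a n i / real (Suc i) * \<psi> n x ^ Suc i) has_derivative
        (\<lambda>h. a n i * \<psi> n x ^ i * (grad (\<psi> n) x \<bullet> h))) (at x)" for i
    proof -
      have "((\<lambda>t. a n i / real (Suc i) * t ^ Suc i) has_real_derivative a n i * \<psi> n x ^ i) (at (\<psi> n x))"
        using DERIV_cmult[OF DERIV_pow[of "Suc i" "\<psi> n x" UNIV], of "a n i / real (Suc i)"]
        by (simp del: of_nat_Suc)
      from has_derivative_compose[OF test_functions_derivative[OF \<psi>(1)] this[THEN has_field_derivative_imp_has_derivative]]
      show ?thesis by simp
    qed
    then have "(\<theta> n has_derivative (\<lambda>h. \<Sum>i\<le>m n. a n i * \<psi> n x ^ i * (grad (\<psi> n) x \<bullet> h))) (at x)"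
      unfolding \<theta>_def [abs_def] by (intro has_derivative_sum) auto
    then show "(\<theta> n has_derivative (\<lambda>h. q n x *\<^sub>R grad (\<psi> n) x \<bullet> h)) (at x)"
      by (simp add: q_def sum_distrib_right)
  qed
  show ?thesis
  proof (rule in_D1pI[OF p _ _ \<theta>])
    show "in_Lp (sobolev_conj TYPE('n) p) \<Omega> (\<lambda>x. F (u x))"
      unfolding r_def[symmetric] in_Lp_def
    proof
      have "integrable ?M (\<lambda>x. c powr r * norm (u x) powr r)" using Lp by (auto simp: in_Lp_def)
      then show "integrable ?M (\<lambda>x. norm (F (u x)) powr r)"
        by (rule Bochner_Integration.integrable_bound)
          (use F_lip[of _ 0] F(1) c r in \<open>auto simp: powr_mult[symmetric] intro!: powr_mono2\<close>)
    qed measurable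
    show "in_Lp p \<Omega> (\<lambda>x. g (u x) *\<^sub>R Du x)"
      unfolding in_Lp_def
    proof
      have "integrable ?M (\<lambda>x. c powr p * norm (Du x) powr p)" using Lp by (auto simp: in_Lp_def)
      then show "integrable ?M (\<lambda>x. norm (g (u x) *\<^sub>R Du x) powr p)"
        by (rule Bochner_Integration.integrable_bound)
          (use g(2) c p in \<open>auto simp: powr_mult[symmetric] intro!: powr_mono2 mult_right_mono\<close>)
    qed measurable
    show "(\<lambda>n. LINT x|?M. norm (\<theta> n x - F (u x)) powr sobolev_conj TYPE('n) p) \<longlonglongrightarrow> 0"
      unfolding r_def[symmetric]
    proof (rule tendsto_sandwich[OF _ _ tendsto_const])
      let ?B = "\<lambda>n. 2 powr r * ((1 + c) powr r * (LINT x|?M. norm (\<psi> n x - u x) powr r) +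
        \<epsilon> n powr r * (LINT x|?M. norm (u x) powr r))"
      have "(\<lambda>n. \<epsilon> n powr r) \<longlonglongrightarrow> 0" using \<epsilon> r by (subst tendsto_powr_0_iff) (auto intro: less_imp_le)
      then have "?B \<longlonglongrightarrow> 2 powr r * ((1 + c) powr r * 0 + 0 * (LINT x|?M. norm (u x) powr r))"
        by (intro tendsto_intros \<psi>(3))
      then show "?B \<longlonglongrightarrow> 0" by simp
      have "(LINT x|?M. norm (\<theta> n x - F (u x)) powr r) \<le> ?B n" for n
      proof -
        have int: "integrable ?M (\<lambda>x. norm (\<psi> n x - u x) powr r)" "integrable ?M (\<lambda>x. norm (u x) powr r)"
          using Lp in_Lp_diff[OF r test_functions_in_Lp(1)[OF \<psi>(1) \<Omega> r] Lp(1)] by (auto simp: in_Lp_def)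
        have "(LINT x|?M. norm (\<theta> n x - F (u x)) powr r) \<le> (LINT x|?M. 2 powr r *
          ((1 + c) powr r * norm (\<psi> n x - u x) powr r + \<epsilon> n powr r * norm (u x) powr r))"
        proof (intro integral_mono')
          fix x
          have "\<bar>\<theta> n x - F (u x)\<bar> \<le> \<epsilon> n * \<bar>\<psi> n x\<bar> + c * \<bar>\<psi> n x - u x\<bar>"
            using approx(2)[of n x] F_lip[of "\<psi> n x" "u x"] unfolding \<theta>_def by linarith
          also have "\<epsilon> n * \<bar>\<psi> n x\<bar> \<le> \<epsilon> n * (\<bar>\<psi> n x - u x\<bar> + \<bar>u x\<bar>)"
            using \<epsilon>(1)[of n] by (intro mult_left_mono) auto
          also have "\<dots> \<le> 1 * \<bar>\<psi> n x - u x\<bar> + \<epsilon> n * \<bar>u x\<bar>"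
            unfolding distrib_left using \<epsilon>(2)[of n] by (intro add_right_mono mult_right_mono) auto
          finally have "\<bar>\<theta> n x - F (u x)\<bar> \<le> norm ((1 + c) * \<bar>\<psi> n x - u x\<bar> + \<epsilon> n * \<bar>u x\<bar>)"
            using c \<epsilon>(1)[of n] by (simp add: algebra_simps)
          then have "norm (\<theta> n x - F (u x)) powr r \<le> norm ((1 + c) * \<bar>\<psi> n x - u x\<bar> + \<epsilon> n * \<bar>u x\<bar>) powr r"
            using r by (intro powr_mono2) auto
          also have "\<dots> \<le> 2 powr r * (norm ((1 + c) * \<bar>\<psi> n x - u x\<bar>) powr r + norm (\<epsilon> n * \<bar>u x\<bar>) powr r)"
            by (rule powr_norm_add_le[OF r])
          also have "\<dots> = 2 powr r * ((1 + c) powr r * norm (\<psi> n x - u x) powr r + \<epsilon> n powr r * norm (u x) powr r)"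
            using c \<epsilon>(1)[of n] by (simp add: powr_mult abs_mult)
          finally show "norm (\<theta> n x - F (u x)) powr r \<le> \<dots>" .
        qed (use int in auto)
        then show ?thesis using int by simp
      qed
      then show "\<forall>\<^sub>F n in sequentially. (LINT x|?M. norm (\<theta> n x - F (u x)) powr r) \<le> ?B n" by simp
    qed simp
    show "(\<lambda>n. LINT x|?M. norm (grad (\<theta> n) x - g (u x) *\<^sub>R Du x) powr p) \<longlonglongrightarrow> 0"
    proof (rule tendsto_sandwich[OF _ _ tendsto_const])
      \<comment> \<open>With q n the derivative of the approximating polynomial at \<psi> n, the
        gradient error splits into q n times (grad (\<psi> n) - Du), controlled by |q n| <= 1 + c,
        and (q n - g u) times Du, controlled by ?h. The latter vanishes in the limit by dominated
        convergence; its majorant 1 + 2 * c uses \<epsilon> n <= 1 and the bound of g twice.\<close>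
      let ?h = "\<lambda>n x. (\<epsilon> n + \<bar>g (\<psi> n x) - g (u x)\<bar>) powr p * norm (Du x) powr p"
      let ?B = "\<lambda>n. 2 powr p * ((1 + c) powr p * (LINT x|?M. norm (grad (\<psi> n) x - Du x) powr p) +
        (LINT x|?M. ?h n x))"
      have dom: "integrable ?M (\<lambda>x. (1 + 2 * c) powr p * norm (Du x) powr p)"
        using Lp by (auto simp: in_Lp_def)
      have conv: "AE x in ?M. (\<lambda>n. ?h n x) \<longlonglongrightarrow> 0" using AE
      proof eventually_elim
        case (elim x)
        have "(\<lambda>n. g (\<psi> n x)) \<longlonglongrightarrow> g (u x)"
          using g(1) elim by (intro continuous_on_tendsto_compose[of UNIV g]) auto
        then have "(\<lambda>n. \<epsilon> n + \<bar>g (\<psi> n x) - g (u x)\<bar>) \<longlonglongrightarrow> 0 + \<bar>g (u x) - g (u x)\<bar>"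
          by (intro tendsto_intros \<epsilon>)
        then have "(\<lambda>n. (\<epsilon> n + \<bar>g (\<psi> n x) - g (u x)\<bar>) powr p) \<longlonglongrightarrow> 0"
          using p \<epsilon>(1) by (subst tendsto_powr_0_iff) (auto intro!: add_nonneg_nonneg intro: less_imp_le)
        then show ?case by (rule tendsto_mult_left_zero)
      qed
      have bd: "norm (?h n x) \<le> (1 + 2 * c) powr p * norm (Du x) powr p" for n x
        using p c \<epsilon>(1,2)[of n] g(2)[of "\<psi> n x"] g(2)[of "u x"] by (auto intro!: mult_right_mono powr_mono2)
      have int_h: "integrable ?M (?h n)" for n
        by (rule Bochner_Integration.integrable_bound[OF dom]) (use bd in \<open>auto simp: abs_mult\<close>)
      have "(\<lambda>n. LINT x|?M. ?h n x) \<longlonglongrightarrow> (LINT x|?M. 0)"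
        by (rule integral_dominated_convergence[OF _ _ dom conv]) (use bd in auto)
      then have "?B \<longlonglongrightarrow> 2 powr p * ((1 + c) powr p * 0 + (LINT x|?M. 0))"
        by (intro tendsto_intros \<psi>(2))
      then show "?B \<longlonglongrightarrow> 0" by simp
      have "(LINT x|?M. norm (grad (\<theta> n) x - g (u x) *\<^sub>R Du x) powr p) \<le> ?B n" for n
      proof -
        have int: "integrable ?M (\<lambda>x. norm (grad (\<psi> n) x - Du x) powr p)"
        proof -
          have "0 < p" using p by simp
          from in_Lp_diff[OF this test_functions_in_Lp(2)[OF \<psi>(1) \<Omega> this] Lp(2)]
          show ?thesis by (simp add: in_Lp_def)
        qed
        have "(LINT x|?M. norm (grad (\<theta> n) x - g (u x) *\<^sub>R Du x) powr p) \<le> (LINT x|?M. 2 powr p *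
          ((1 + c) powr p * norm (grad (\<psi> n) x - Du x) powr p + ?h n x))"
        proof (intro integral_mono')
          fix x
          have q: "\<bar>q n x - g (\<psi> n x)\<bar> \<le> \<epsilon> n" using approx(1)[of n x] by (simp add: q_def)
          let ?w = "grad (\<psi> n) x - Du x"
          have "grad (\<theta> n) x - g (u x) *\<^sub>R Du x = q n x *\<^sub>R ?w + (q n x - g (u x)) *\<^sub>R Du x"
            by (simp add: grad_\<theta> algebra_simps)
          then have "norm (grad (\<theta> n) x - g (u x) *\<^sub>R Du x) \<le> \<bar>q n x\<bar> * norm ?w + \<bar>q n x - g (u x)\<bar> * norm (Du x)"
            by (metis norm_scaleR norm_triangle_ineq)
          also have "\<dots> \<le> (1 + c) * norm ?w + (\<epsilon> n + \<bar>g (\<psi> n x) - g (u x)\<bar>) * norm (Du x)"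
            using q \<epsilon>(2)[of n] g(2)[of "\<psi> n x"] by (intro add_mono mult_right_mono norm_ge_zero) linarith+
          finally have "norm (grad (\<theta> n) x - g (u x) *\<^sub>R Du x) \<le>
              norm ((1 + c) * norm ?w + (\<epsilon> n + \<bar>g (\<psi> n x) - g (u x)\<bar>) * norm (Du x))"
            by simp
          then have "norm (grad (\<theta> n) x - g (u x) *\<^sub>R Du x) powr p \<le>
              norm ((1 + c) * norm ?w + (\<epsilon> n + \<bar>g (\<psi> n x) - g (u x)\<bar>) * norm (Du x)) powr p"
            using p by (intro powr_mono2) auto
          also have "\<dots> \<le> 2 powr p * (norm ((1 + c) * norm ?w) powr p +
              norm ((\<epsilon> n + \<bar>g (\<psi> n x) - g (u x)\<bar>) * norm (Du x)) powr p)"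
            using p by (intro powr_norm_add_le) simp
          also have "\<dots> = 2 powr p * ((1 + c) powr p * norm ?w powr p + ?h n x)"
            using c \<epsilon>(1)[of n] by (simp add: powr_mult abs_mult)
          finally show "norm (grad (\<theta> n) x - g (u x) *\<^sub>R Du x) powr p \<le> \<dots>" .
        qed (use int int_h in auto)
        also have "\<dots> = ?B n" using int int_h by simp
        finally show ?thesis .
      qed
      then show "\<forall>\<^sub>F n in sequentially. (LINT x|?M. norm (grad (\<theta> n) x - g (u x) *\<^sub>R Du x) powr p) \<le> ?B n"
        by simp
    qed simp
  qed
qed

subsection \<open>Truncated powers\<close>

text \<open>A substitute for min(|t|, L), rational on each half line. It vanishes at 0 like |t|, so
  multiplying a positive power of it by t gives a continuously differentiable function.\<close>

definition trunc :: "real \<Rightarrow> real \<Rightarrow> real" where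
  "trunc L t = \<bar>t\<bar> * L / (L + \<bar>t\<bar>)"

definition trunc_power :: "real \<Rightarrow> real \<Rightarrow> real \<Rightarrow> real" where
  "trunc_power L s t = t * trunc L t powr s"

definition trunc_power_deriv :: "real \<Rightarrow> real \<Rightarrow> real \<Rightarrow> real" where
  "trunc_power_deriv L s t = trunc L t powr s * (1 + s * L / (L + \<bar>t\<bar>))"

lemma trunc_bounds:
  assumes "0 < L" shows "0 \<le> trunc L t" "trunc L t \<le> L" "trunc L t \<le> \<bar>t\<bar>"
proof -
  have pos: "0 < L + \<bar>t\<bar>" using assms by simp
  show "0 \<le> trunc L t" using assms by (simp add: trunc_def)
  have "\<bar>t\<bar> * L \<le> L * (L + \<bar>t\<bar>)" "\<bar>t\<bar> * L \<le> \<bar>t\<bar> * (L + \<bar>t\<bar>)"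
    using assms by (auto simp: algebra_simps)
  then show "trunc L t \<le> L" "trunc L t \<le> \<bar>t\<bar>"
    using pos by (auto simp: trunc_def divide_le_eq)
qed

lemma continuous_on_trunc: "0 < L \<Longrightarrow> continuous_on S (trunc L)"
  unfolding trunc_def [abs_def] by (intro continuous_intros) (auto simp: add_pos_nonneg intro!: less_imp_neq[symmetric])

lemma continuous_on_trunc_powr: "0 < L \<Longrightarrow> 0 < s \<Longrightarrow> continuous_on S (\<lambda>t. trunc L t powr s)"
  by (intro continuous_on_powr' continuous_on_trunc continuous_on_const) (auto simp: trunc_bounds)

lemma continuous_on_trunc_power_deriv:
  "0 < L \<Longrightarrow> 0 < s \<Longrightarrow> continuous_on S (trunc_power_deriv L s)"
  unfolding trunc_power_deriv_def [abs_def]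
  by (intro continuous_intros continuous_on_trunc_powr) (auto simp: add_pos_nonneg intro!: less_imp_neq[symmetric])

text \<open>All three follow from s * L / (L + |t|) lying between 0 and s. The lower bound keeps the
  coercive gradient term, the second bound serves the a1 and a2 terms and the Sobolev inequality,
  and the third opens the way to \<open>in_D1p_chain\<close>.\<close>

lemma trunc_power_deriv_bounds:
  assumes "0 < L" "0 < s"
  shows "trunc L t powr s \<le> trunc_power_deriv L s t"
    "trunc_power_deriv L s t \<le> (1 + s) * trunc L t powr s"
    "\<bar>trunc_power_deriv L s t\<bar> \<le> (1 + s) * L powr s"
proof -
  have "0 \<le> s * L / (L + \<bar>t\<bar>)" "s * L / (L + \<bar>t\<bar>) \<le> s"
    using assms by (auto simp: divide_le_eq add_pos_nonneg)
  then show 1: "trunc L t powr s \<le> trunc_power_deriv L s t"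
    "trunc_power_deriv L s t \<le> (1 + s) * trunc L t powr s"
    unfolding trunc_power_deriv_def using mult_left_mono[of 1 "1 + s * L / (L + \<bar>t\<bar>)" "trunc L t powr s"]
      mult_left_mono[of "1 + s * L / (L + \<bar>t\<bar>)" "1 + s" "trunc L t powr s"]
    by (auto simp: mult.commute)
  have "(1 + s) * trunc L t powr s \<le> (1 + s) * L powr s"
    using assms trunc_bounds[OF assms(1)] by (intro mult_left_mono powr_mono2) auto
  moreover have "0 \<le> trunc L t powr s" by simp
  ultimately show "\<bar>trunc_power_deriv L s t\<bar> \<le> (1 + s) * L powr s" using 1 by linarith
qed

text \<open>The product rule for t > 0, oddness of the truncated power for t < 0, and
  \<open>DERIV_mult_at_0\<close> at the origin.\<close>

lemma DERIV_trunc_power: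
  assumes "0 < L" "0 < s"
  shows "(trunc_power L s has_real_derivative trunc_power_deriv L s t) (at t)"
proof -
  have pos: "(trunc_power L s has_real_derivative trunc_power_deriv L s t) (at t)" if "0 < t" for t
  proof -
    have Lt: "0 < L + t" using assms that by simp
    have 1: "((\<lambda>t. t * L / (L + t)) has_real_derivative (L\<^sup>2 / (L + t)\<^sup>2)) (at t)"
      using Lt by (auto intro!: derivative_eq_intros simp: power2_eq_square divide_simps) (simp add: algebra_simps)
    have \<mu>: "0 < t * L / (L + t)" using Lt that assms by simp
    have 2: "((\<lambda>t. (t * L / (L + t)) powr s) has_real_derivative
        (s * (t * L / (L + t)) powr (s - 1) * (L\<^sup>2 / (L + t)\<^sup>2))) (at t)"
      by (rule DERIV_chain2[OF has_real_derivative_powr[OF \<mu>] 1])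
    have "((\<lambda>t. t * (t * L / (L + t)) powr s) has_real_derivative trunc_power_deriv L s t) (at t)"
    proof (rule DERIV_cong[OF DERIV_mult[OF DERIV_ident 2]])
      define P where "P = (t * L / (L + t)) powr s"
      have "(t * L / (L + t)) powr (s - 1) = P / (t * L / (L + t))"
        unfolding P_def using \<mu> Lt that assms by (simp add: powr_diff)
      moreover have "trunc_power_deriv L s t = P * (1 + s * L / (L + t))"
        using that by (simp add: trunc_power_deriv_def trunc_def P_def)
      moreover have "1 * P + s * (P / (t * L / (L + t))) * (L\<^sup>2 / (L + t)\<^sup>2) * t = P * (1 + s * L / (L + t))"
        using that Lt assms by (simp add: power2_eq_square divide_simps) (simp add: algebra_simps)
      ultimately show "1 * (t * L / (L + t)) powr s + s * (t * L / (L + t)) powr (s - 1) * (L\<^sup>2 / (L + t)\<^sup>2) * t =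
          trunc_power_deriv L s t"
        by (simp only: P_def)
    qed
    then show ?thesis
      by (rule has_field_derivative_transform_within_open[where S = "{0<..}"])
        (use that in \<open>auto simp: trunc_power_def trunc_def\<close>)
  qed
  consider "t = 0" | "0 < t" | "t < 0" by linarith
  then show ?thesis
  proof cases
    case 1
    have "isCont (\<lambda>t. trunc L t powr s) 0"
      using continuous_on_trunc_powr[OF assms, of UNIV] by (simp add: continuous_on_eq_continuous_at)
    from DERIV_mult_at_0[OF this] show ?thesis
      using 1 assms by (simp add: trunc_power_def [abs_def] trunc_power_deriv_def trunc_def)
  next
    case 2
    then show ?thesis by (rule pos)
  next
    case 3
    then have "((\<lambda>x. trunc_power L s (- x)) has_real_derivative - trunc_power_deriv L s (- t)) (at t)"
      using pos[of "- t"] by (simp add: DERIV_mirror)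
    from DERIV_minus[OF this] show ?thesis
      by (simp add: trunc_power_def [abs_def] trunc_power_deriv_def trunc_def)
  qed
qed

lemma trunc_tendsto: "(\<lambda>n. trunc (real (Suc n)) t) \<longlonglongrightarrow> \<bar>t\<bar>"
proof -
  have "(\<lambda>n. \<bar>t\<bar> / (1 + \<bar>t\<bar> * inverse (real (Suc n)))) \<longlonglongrightarrow> \<bar>t\<bar> / (1 + \<bar>t\<bar> * 0)"
    by (intro tendsto_intros LIMSEQ_inverse_real_of_nat) auto
  moreover have "\<bar>t\<bar> / (1 + \<bar>t\<bar> * inverse (real (Suc n))) = trunc (real (Suc n)) t" for n
    by (simp add: trunc_def field_simps)
  ultimately show ?thesis by simp
qed

subsection \<open>Elementary inequalities and Lebesgue norms\<close>

text \<open>A crude Young inequality: if y <= \<epsilon> x the first term dominates, otherwise x < y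
  / \<epsilon> and the second one does.\<close>

lemma young_eps:
  fixes x y \<epsilon> p :: real
  assumes "0 \<le> x" "0 \<le> y" "0 < \<epsilon>" "1 < p"
  shows "x powr (p - 1) * y \<le> \<epsilon> * x powr p + \<epsilon> powr (1 - p) * y powr p"
proof (cases "y \<le> \<epsilon> * x")
  case True
  have "x powr (p - 1) * y \<le> x powr (p - 1) * (\<epsilon> * x)" using True by (intro mult_left_mono) auto
  also have "\<dots> = \<epsilon> * (x powr (p - 1) * x powr 1)" using assms by simp
  also have "\<dots> = \<epsilon> * x powr p" unfolding powr_add[symmetric] by simp
  finally show ?thesis by (smt (verit) mult_nonneg_nonneg powr_ge_zero)
next
  case False
  then have xy: "x \<le> y / \<epsilon>" using assms by (simp add: field_simps)
  have "x powr (p - 1) * y \<le> (y / \<epsilon>) powr (p - 1) * y"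
    using xy assms by (intro mult_right_mono powr_mono2) auto
  also have "\<dots> = \<epsilon> powr (1 - p) * (y powr (p - 1) * y powr 1)"
    using assms powr_minus[of \<epsilon> "p - 1"] by (simp add: powr_divide field_simps)
  also have "\<dots> = \<epsilon> powr (1 - p) * y powr p" unfolding powr_add[symmetric] by simp
  finally show ?thesis using assms by (smt (verit) mult_nonneg_nonneg powr_ge_zero)
qed

text \<open>If E <= X, the constant is at least 1. Otherwise X is at most the mixed term, and
  dividing by E to the power \<theta> leaves E^(1-\<theta>) <= 2 Q X^(1-\<theta>). The result is
  linear in X with an explicit constant, for every size of Q.\<close>

lemma absorb_interpolated:
  fixes E X Q \<theta> :: real
  assumes "0 \<le> E" "0 \<le> X" "1 \<le> Q" "0 < \<theta>" "\<theta> < 1" "E \<le> Q * (X + E powr \<theta> * X powr (1 - \<theta>))"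
  shows "E \<le> (2 * Q) powr (1 / (1 - \<theta>)) * X"
proof (cases "E \<le> X")
  case True
  have "1 \<le> (2 * Q) powr (1 / (1 - \<theta>))" using assms by (intro ge_one_powr_ge_zero) auto
  then have "1 * X \<le> (2 * Q) powr (1 / (1 - \<theta>)) * X" using assms by (intro mult_right_mono) auto
  with True show ?thesis by simp
next
  case False
  then have E: "0 < E" using assms by linarith
  have "X = X powr \<theta> * X powr (1 - \<theta>)" using assms by (simp add: powr_add[symmetric])
  also have "\<dots> \<le> E powr \<theta> * X powr (1 - \<theta>)"
    using False assms by (intro mult_right_mono powr_mono2) auto
  finally have "E \<le> Q * (2 * (E powr \<theta> * X powr (1 - \<theta>)))"
    using assms(3,6) mult_left_mono[of "X + E powr \<theta> * X powr (1 - \<theta>)" "2 * (E powr \<theta> * X powr (1 - \<theta>))" Q]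
    by linarith
  then have "E / E powr \<theta> \<le> 2 * Q * X powr (1 - \<theta>)"
    using E by (simp add: divide_le_eq mult_ac)
  moreover have "E / E powr \<theta> = E powr (1 - \<theta>)" using E by (simp add: powr_diff)
  ultimately have "(E powr (1 - \<theta>)) powr (1 / (1 - \<theta>)) \<le> (2 * Q * X powr (1 - \<theta>)) powr (1 / (1 - \<theta>))"
    using assms by (intro powr_mono2) auto
  moreover have "(E powr (1 - \<theta>)) powr (1 / (1 - \<theta>)) = E"
    using assms by (simp add: powr_powr)
  moreover have "(2 * Q * X powr (1 - \<theta>)) powr (1 / (1 - \<theta>)) = (2 * Q) powr (1 / (1 - \<theta>)) * X"
    using assms by (simp add: powr_mult powr_powr)
  ultimately show ?thesis by simp
qed

text \<open>Lets the truncation level tend to infinity. Finiteness of the limit integral is part of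
  the gain: it is the hypothesis of the next iteration step.\<close>

lemma
  fixes f :: "nat \<Rightarrow> 'a \<Rightarrow> real"
  assumes int: "\<And>n. integrable M (f n)" and nn: "\<And>n x. 0 \<le> f n x"
    and lim: "\<And>x. (\<lambda>n. f n x) \<longlonglongrightarrow> g x" and B: "\<And>n. (\<integral>x. f n x \<partial>M) \<le> B"
  shows Fatou_integrable: "integrable M g" and Fatou_integral_le: "(\<integral>x. g x \<partial>M) \<le> B"
proof -
  note [measurable] = borel_measurable_integrable[OF int]
  have [measurable]: "g \<in> borel_measurable M" by (rule borel_measurable_LIMSEQ_real[OF lim]) measurable
  have g: "0 \<le> g x" for x using lim nn by (intro LIMSEQ_le_const[OF lim]) auto
  have "0 \<le> B" by (intro order_trans[OF Bochner_Integration.integral_nonneg B[of 0]] nn)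
  have "(\<integral>\<^sup>+x. ennreal (g x) \<partial>M) = (\<integral>\<^sup>+x. liminf (\<lambda>n. ennreal (f n x)) \<partial>M)"
    using lim by (intro nn_integral_cong lim_imp_Liminf[symmetric] tendsto_ennrealI) auto
  also have "\<dots> \<le> liminf (\<lambda>n. \<integral>\<^sup>+x. ennreal (f n x) \<partial>M)"
    by (intro nn_integral_liminf) measurable
  also have "\<dots> \<le> liminf (\<lambda>n. ennreal B)"
    using B nn by (intro Liminf_mono always_eventually allI) (simp add: nn_integral_eq_integral[OF int] ennreal_leI)
  also have "\<dots> = ennreal B" by (simp add: Liminf_const)
  finally have le: "(\<integral>\<^sup>+x. ennreal (g x) \<partial>M) \<le> ennreal B" .
  then show *: "integrable M g"
    using g by (intro integrableI_nonneg) (auto simp: le_less_trans[OF _ ennreal_less_top])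
  show "(\<integral>x. g x \<partial>M) \<le> B"
    using le g \<open>0 \<le> B\<close> by (subst (asm) nn_integral_eq_integral[OF *]) auto
qed

section \<open>The essential supremum norm and interpolation with it\<close>

lemma in_LinfD:
  assumes "in_Linf \<Omega> f"
  shows "AE x in lebesgue_on \<Omega>. \<bar>f x\<bar> \<le> Linf_norm \<Omega> f" "0 \<le> Linf_norm \<Omega> f"
proof -
  let ?e = "esssup (lebesgue_on \<Omega>) (\<lambda>x. ereal \<bar>f x\<bar>)"
  have [measurable]: "f \<in> borel_measurable (lebesgue_on \<Omega>)" and fin: "?e < \<infinity>"
    using assms by (auto simp: in_Linf_def)
  have AE: "AE x in lebesgue_on \<Omega>. ereal \<bar>f x\<bar> \<le> ?e" by (rule esssup_AE)
  then show "AE x in lebesgue_on \<Omega>. \<bar>f x\<bar> \<le> Linf_norm \<Omega> f"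
    by eventually_elim (use fin in \<open>cases ?e, auto simp: Linf_norm_def\<close>)
  show "0 \<le> Linf_norm \<Omega> f"
  proof (cases ?e)
    case (real r)
    show ?thesis
    proof (rule ccontr)
      assume neg: "\<not> 0 \<le> Linf_norm \<Omega> f"
      \<comment> \<open>A negative bound r for |f| can hold almost everywhere only if the space is
        null; then r - 1 is a bound as well, contradicting minimality of the essential
        supremum.\<close>
      have "AE x in lebesgue_on \<Omega>. ereal \<bar>f x\<bar> \<le> ereal (r - 1)"
        using AE by eventually_elim (use real neg in \<open>auto simp: Linf_norm_def\<close>)
      then have "?e \<le> ereal (r - 1)" by (intro esssup_I) auto
      with real show False by simp
    qed
  qed (auto simp: Linf_norm_def)
qed

lemma in_LinfI:
  assumes [measurable]: "f \<in> borel_measurable (lebesgue_on \<Omega>)"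
    and "AE x in lebesgue_on \<Omega>. \<bar>f x\<bar> \<le> R" "0 \<le> R"
  shows "in_Linf \<Omega> f" "Linf_norm \<Omega> f \<le> R"
proof -
  let ?e = "esssup (lebesgue_on \<Omega>) (\<lambda>x. ereal \<bar>f x\<bar>)"
  have "?e \<le> ereal R" using assms by (intro esssup_I) auto
  then show "in_Linf \<Omega> f" "Linf_norm \<Omega> f \<le> R"
    using assms(3) by (cases ?e; auto simp: in_Linf_def Linf_norm_def)+
qed

text \<open>Pointwise, |f|^\<sigma> <= K^(\<sigma>-\<rho>) |f|^\<rho>. The bound K does not involve
  \<sigma>, so the norms of a2 and b3 that occur along the iteration stay under one constant
  although the exponents tend to infinity.\<close>

lemma
  assumes Lp: "in_Lp \<rho> \<Omega> f" and Linf: "in_Linf \<Omega> f" and K: "Lp_norm \<rho> \<Omega> f + Linf_norm \<Omega> f \<le> K" "0 < K"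
    and \<sigma>: "0 < \<rho>" "\<rho> \<le> \<sigma>"
  shows integrable_powr_interpolate: "integrable (lebesgue_on \<Omega>) (\<lambda>x. \<bar>f x\<bar> powr \<sigma>)"
    and integral_powr_interpolate: "(LINT x|lebesgue_on \<Omega>. \<bar>f x\<bar> powr \<sigma>) powr (1 / \<sigma>) \<le> K"
proof -
  have [measurable]: "f \<in> borel_measurable (lebesgue_on \<Omega>)" and int: "integrable (lebesgue_on \<Omega>) (\<lambda>x. \<bar>f x\<bar> powr \<rho>)"
    using Lp by (auto simp: in_Lp_def)
  have "Lp_norm \<rho> \<Omega> f \<le> K" "Linf_norm \<Omega> f \<le> K"
    using K in_LinfD(2)[OF Linf] by (auto simp: Lp_norm_def intro: order_trans[rotated])
  note LK = this
  have AE: "AE x in lebesgue_on \<Omega>. \<bar>f x\<bar> powr \<sigma> \<le> K powr (\<sigma> - \<rho>) * \<bar>f x\<bar> powr \<rho>"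
    using in_LinfD(1)[OF Linf]
  proof eventually_elim
    case (elim x)
    have "\<bar>f x\<bar> powr \<sigma> = \<bar>f x\<bar> powr (\<sigma> - \<rho>) * \<bar>f x\<bar> powr \<rho>" by (simp add: powr_add[symmetric])
    also have "\<dots> \<le> K powr (\<sigma> - \<rho>) * \<bar>f x\<bar> powr \<rho>"
      using elim LK \<sigma> by (intro mult_right_mono powr_mono2) auto
    finally show ?case .
  qed
  show int\<sigma>: "integrable (lebesgue_on \<Omega>) (\<lambda>x. \<bar>f x\<bar> powr \<sigma>)"
    using AE by (intro Bochner_Integration.integrable_bound[OF integrable_mult_right[OF int, of "K powr (\<sigma> - \<rho>)"]]) auto
  have "(LINT x|lebesgue_on \<Omega>. \<bar>f x\<bar> powr \<sigma>) \<le> (LINT x|lebesgue_on \<Omega>. K powr (\<sigma> - \<rho>) * \<bar>f x\<bar> powr \<rho>)"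
    using AE int by (intro integral_mono_AE int\<sigma> integrable_mult_right) auto
  also have "\<dots> = K powr (\<sigma> - \<rho>) * (LINT x|lebesgue_on \<Omega>. \<bar>f x\<bar> powr \<rho>)" by simp
  also have "(LINT x|lebesgue_on \<Omega>. \<bar>f x\<bar> powr \<rho>) = Lp_norm \<rho> \<Omega> f powr \<rho>"
    using \<sigma> by (simp add: Lp_norm_def powr_powr)
  also have "K powr (\<sigma> - \<rho>) * Lp_norm \<rho> \<Omega> f powr \<rho> \<le> K powr (\<sigma> - \<rho>) * K powr \<rho>"
    using LK \<sigma> by (intro mult_left_mono powr_mono2) (auto simp: Lp_norm_def)
  also have "\<dots> = K powr \<sigma>" by (simp add: powr_add[symmetric])
  finally have "(LINT x|lebesgue_on \<Omega>. \<bar>f x\<bar> powr \<sigma>) powr (1 / \<sigma>) \<le> (K powr \<sigma>) powr (1 / \<sigma>)"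
    using \<sigma> by (intro powr_mono2) auto
  then show "(LINT x|lebesgue_on \<Omega>. \<bar>f x\<bar> powr \<sigma>) powr (1 / \<sigma>) \<le> K" using K \<sigma> by (simp add: powr_powr)
qed

subsection \<open>The energy estimate\<close>

text \<open>Av and Bv stand for the values of A and B at (x, u, Du), w for the power m - p of the
  truncation, g for the derivative of the truncated power. The b1 term is split by
  \<open>young_eps\<close> with \<epsilon> = lam / (2 * K); as b1 <= K, this costs at most half of
  the coercive term.\<close>

lemma energy_pointwise:
  fixes \<xi> Av :: "'v::real_inner" and \<zeta> Bv :: real
  assumes p: "1 < p" and "0 < lam" "0 < K"
    and A: "Av \<bullet> \<xi> \<ge> lam * norm \<xi> powr p - a1 * \<bar>\<zeta>\<bar> powr p - a2"
    and B: "\<bar>Bv\<bar> \<le> b1 * norm \<xi> powr (p - 1) + b2 * \<bar>\<zeta>\<bar> powr (p - 1) + b3"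
    and nn: "0 \<le> a1" "0 \<le> a2" "0 \<le> b1" "0 \<le> b2" "0 \<le> b3" and b1: "b1 \<le> K"
    and w: "0 \<le> w" "w \<le> g" "g \<le> m * w"
  shows "lam / 2 * (norm \<xi> powr p * w) - (m * (a1 * (\<bar>\<zeta>\<bar> powr p * w)) + m * (a2 * w)
      + K * (lam / (2 * K)) powr (1 - p) * (\<bar>\<zeta>\<bar> powr p * w) + b2 * (\<bar>\<zeta>\<bar> powr p * w) + b3 * (\<bar>\<zeta>\<bar> * w))
    \<le> g * (Av \<bullet> \<xi>) - Bv * (\<zeta> * w)"
proof -
  have g: "0 \<le> g" using w by linarith
  have \<zeta>: "\<bar>\<zeta>\<bar> powr (p - 1) * \<bar>\<zeta>\<bar> = \<bar>\<zeta>\<bar> powr p"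
  proof -
    have "\<bar>\<zeta>\<bar> powr (p - 1) * \<bar>\<zeta>\<bar> = \<bar>\<zeta>\<bar> powr (p - 1) * \<bar>\<zeta>\<bar> powr 1" by simp
    then show ?thesis unfolding powr_add[symmetric] by simp
  qed
  have "g * (lam * norm \<xi> powr p) - g * (a1 * \<bar>\<zeta>\<bar> powr p + a2) \<le> g * (Av \<bullet> \<xi>)"
    using mult_left_mono[OF A g] by (simp add: algebra_simps)
  moreover have "w * (lam * norm \<xi> powr p) \<le> g * (lam * norm \<xi> powr p)"
    using w assms by (intro mult_right_mono) auto
  moreover have "g * (a1 * \<bar>\<zeta>\<bar> powr p + a2) \<le> (m * w) * (a1 * \<bar>\<zeta>\<bar> powr p + a2)"
    using w nn by (intro mult_right_mono) auto
  moreover have "Bv * (\<zeta> * w) \<le> (lam / 2 * norm \<xi> powr p + K * (lam / (2 * K)) powr (1 - p) * \<bar>\<zeta>\<bar> powr p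
      + b2 * \<bar>\<zeta>\<bar> powr p + b3 * \<bar>\<zeta>\<bar>) * w"
  proof -
    have "Bv * (\<zeta> * w) \<le> \<bar>Bv\<bar> * \<bar>\<zeta>\<bar> * w"
      using w by (metis abs_ge_self abs_mult abs_of_nonneg mult.assoc)
    also have "\<dots> \<le> (b1 * norm \<xi> powr (p - 1) + b2 * \<bar>\<zeta>\<bar> powr (p - 1) + b3) * \<bar>\<zeta>\<bar> * w"
      using B w by (intro mult_right_mono) auto
    also have "(b1 * norm \<xi> powr (p - 1) + b2 * \<bar>\<zeta>\<bar> powr (p - 1) + b3) * \<bar>\<zeta>\<bar> =
        b1 * (norm \<xi> powr (p - 1) * \<bar>\<zeta>\<bar>) + b2 * (\<bar>\<zeta>\<bar> powr (p - 1) * \<bar>\<zeta>\<bar>) + b3 * \<bar>\<zeta>\<bar>"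
      by (simp add: algebra_simps)
    also have "\<dots> * w \<le> (K * (lam / (2 * K) * norm \<xi> powr p + (lam / (2 * K)) powr (1 - p) * \<bar>\<zeta>\<bar> powr p)
        + b2 * \<bar>\<zeta>\<bar> powr p + b3 * \<bar>\<zeta>\<bar>) * w"
      unfolding \<zeta> using assms by (intro mult_right_mono add_right_mono mult_mono young_eps) auto
    finally show ?thesis using assms by (simp add: algebra_simps)
  qed
  ultimately show ?thesis by (simp add: algebra_simps)
qed

text \<open>The inner product collects the Sobolev constant of \<open>sobolev_D1p\<close>, the
  factor 2 / lam that isolates the gradient integral, and the data constant of
  \<open>energy_truncated\<close>. The doubling and the outer exponent come from
  \<open>absorb_interpolated\<close> with \<theta> = N / q, and \<open>max 1\<close> secures its
  hypothesis on Q.\<close>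

definition moser_const :: "real \<Rightarrow> real \<Rightarrow> real \<Rightarrow> real \<Rightarrow> real \<Rightarrow> real" where
  "moser_const N p q lam K =
    (2 * max 1 ((4 * p * (N - 1) / (N - p)) powr p * (2 / lam) * (2 * K + K * (lam / (2 * K)) powr (1 - p))))
      powr (1 / (1 - N / q))"

text \<open>One number K dominates all norms of the data, so that every constant below depends on
  the data through K alone; K >= 1 also makes lam / (2 * K) a legitimate Young parameter.\<close>

locale bounded_data =
  fixes \<Omega> :: "(real^'n::finite) set"
    and A :: "real^'n \<Rightarrow> real \<Rightarrow> real^'n \<Rightarrow> real^'n"
    and B :: "real^'n \<Rightarrow> real \<Rightarrow> real^'n \<Rightarrow> real"
    and a1 a2 b1 b2 b3 u :: "real^'n \<Rightarrow> real" and Du :: "real^'n \<Rightarrow> real^'n"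
    and p q \<beta> lam K :: real
  assumes p: "1 < p" "p < real CARD('n)" "p < \<beta>"
    and lam: "0 < lam" and q: "real CARD('n) < q" and K: "1 \<le> K"
    and \<Omega>: "\<Omega> \<in> sets lebesgue"
    and A_ge: "AE x in lebesgue_on \<Omega>. \<forall>\<zeta> \<xi>. A x \<zeta> \<xi> \<bullet> \<xi> \<ge> lam * norm \<xi> powr p - a1 x * \<bar>\<zeta>\<bar> powr p - a2 x"
    and B_le: "AE x in lebesgue_on \<Omega>. \<forall>\<zeta> \<xi>.
       \<bar>B x \<zeta> \<xi>\<bar> \<le> b1 x * norm \<xi> powr (p - 1) + b2 x * \<bar>\<zeta>\<bar> powr (p - 1) + b3 x"
    and data_nonneg: "AE x in lebesgue_on \<Omega>. 0 \<le> a1 x \<and> 0 \<le> a2 x \<and> 0 \<le> b1 x \<and> 0 \<le> b2 x \<and> 0 \<le> b3 x"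
    and b1: "in_Linf \<Omega> b1" "Linf_norm \<Omega> b1 \<le> K"
    and a1: "in_Lp (q / p) \<Omega> a1" "Lp_norm (q / p) \<Omega> a1 \<le> K"
    and b2: "in_Lp (q / p) \<Omega> b2" "Lp_norm (q / p) \<Omega> b2 \<le> K"
    and a2: "in_Lp (\<beta> / p) \<Omega> a2" "in_Linf \<Omega> a2" "Lp_norm (\<beta> / p) \<Omega> a2 + Linf_norm \<Omega> a2 \<le> K"
    and b3: "in_Lp (\<beta> / (p - 1)) \<Omega> b3" "in_Linf \<Omega> b3" "Lp_norm (\<beta> / (p - 1)) \<Omega> b3 + Linf_norm \<Omega> b3 \<le> K"
    and sol: "weak_solution \<Omega> p A B u Du"
begin

definition N :: real where "N = real CARD('n)"

lemma N: "1 < N" "p < N" "N < q" "p < q"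
  using p q by (auto simp: N_def)

lemma sobolev_conj_eq: "sobolev_conj TYPE('n) p = N * p / (N - p)"
  by (simp add: sobolev_conj_def N_def)

lemma sobolev_conj_pos: "0 < sobolev_conj TYPE('n) p"
  using N p by (simp add: sobolev_conj_eq)

lemma u_D1p: "in_D1p \<Omega> p u Du"
  using sol by (simp add: weak_solution_def)

lemma u_Lp: "in_Lp (sobolev_conj TYPE('n) p) \<Omega> u" "in_Lp p \<Omega> Du"
  using u_D1p by (auto simp: in_D1p_def)

lemma measurable_data [measurable]:
  "u \<in> borel_measurable (lebesgue_on \<Omega>)" "Du \<in> borel_measurable (lebesgue_on \<Omega>)"
  "a1 \<in> borel_measurable (lebesgue_on \<Omega>)" "a2 \<in> borel_measurable (lebesgue_on \<Omega>)"
  "b2 \<in> borel_measurable (lebesgue_on \<Omega>)" "b3 \<in> borel_measurable (lebesgue_on \<Omega>)"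
  using u_Lp a1 a2 b2 b3 by (auto simp: in_Lp_def)

lemma measurable_trunc [measurable]:
  "0 < L \<Longrightarrow> (\<lambda>x. trunc L (u x)) \<in> borel_measurable (lebesgue_on \<Omega>)"
  unfolding trunc_def by measurable

section \<open>Estimates for the truncated powers of the solution\<close>

text \<open>This is the absolute value of \<open>trunc_power L (s / p)\<close> at u; the chain rule
  therefore puts it within reach of the Sobolev inequality.\<close>

definition v :: "real \<Rightarrow> real \<Rightarrow> real^'n \<Rightarrow> real" where
  "v L s x = \<bar>u x\<bar> * trunc L (u x) powr (s / p)"

lemma v_powr: "v L s x powr p = \<bar>u x\<bar> powr p * trunc L (u x) powr s"
  using p by (simp add: v_def powr_mult powr_powr)

lemma measurable_v [measurable]: "0 < L \<Longrightarrow> v L s \<in> borel_measurable (lebesgue_on \<Omega>)"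
  unfolding v_def [abs_def] by measurable

lemma trunc_powr_le:
  assumes "0 < L" "0 < s"
  shows "trunc L (u x) powr s \<le> \<bar>u x\<bar> powr s" "trunc L (u x) powr s \<le> L powr s"
  using assms trunc_bounds[OF assms(1)] by (auto intro!: powr_mono2)

lemma v_powr_le:
  assumes "0 < L" "p < m"
  shows "v L (m - p) x powr p \<le> \<bar>u x\<bar> powr m"
proof -
  have "v L (m - p) x powr p \<le> \<bar>u x\<bar> powr p * \<bar>u x\<bar> powr (m - p)"
    unfolding v_powr using assms by (intro mult_left_mono trunc_powr_le) auto
  then show ?thesis by (simp add: powr_add[symmetric])
qed

text \<open>Used twice at each level m: with s = m - p for the function that tests the equation, and
  with s = (m - p) / p for the one in the Sobolev inequality.\<close>

lemma trunc_power_D1p: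
  assumes "0 < L" "0 < s"
  shows "in_D1p \<Omega> p (\<lambda>x. trunc_power L s (u x)) (\<lambda>x. trunc_power_deriv L s (u x) *\<^sub>R Du x)"
proof (rule in_D1p_chain[OF u_D1p p(1,2) \<Omega>])
  show "\<bar>trunc_power_deriv L s t\<bar> \<le> (1 + s) * L powr s" for t
    by (rule trunc_power_deriv_bounds(3)[OF assms])
qed (simp_all add: trunc_power_def DERIV_trunc_power[OF assms, unfolded trunc_power_def]
    DERIV_trunc_power[OF assms] continuous_on_trunc_power_deriv[OF assms])

text \<open>The gradient of the truncated power is at most (1 + s/p) times the truncation to the
  power s/p times |Du|. The factor is rounded up to s + p, which is just m for s = m - p.\<close>

lemma sobolev_truncated:
  assumes L: "0 < L" and s: "0 < s"
  defines "E \<equiv> LINT x|lebesgue_on \<Omega>. v L s x powr sobolev_conj TYPE('n) p"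
  shows "integrable (lebesgue_on \<Omega>) (\<lambda>x. v L s x powr sobolev_conj TYPE('n) p)"
    and "integrable (lebesgue_on \<Omega>) (\<lambda>x. norm (Du x) powr p * trunc L (u x) powr s)"
    and "E powr ((N - p) / N) \<le> (4 * p * (N - 1) / (N - p)) powr p * ((s + p) powr p *
      (LINT x|lebesgue_on \<Omega>. norm (Du x) powr p * trunc L (u x) powr s))"
proof -
  let ?M = "lebesgue_on \<Omega>" and ?r = "sobolev_conj TYPE('n) p"
  have sp: "0 < s / p" using s p by simp
  have D1p: "in_D1p \<Omega> p (\<lambda>x. trunc_power L (s / p) (u x)) (\<lambda>x. trunc_power_deriv L (s / p) (u x) *\<^sub>R Du x)"
    by (rule trunc_power_D1p[OF L sp])
  have v: "norm (trunc_power L (s / p) (u x)) = v L s x" for x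
    by (simp add: trunc_power_def v_def abs_mult)
  show "integrable ?M (\<lambda>x. v L s x powr ?r)"
    using D1p unfolding in_D1p_def in_Lp_def v by blast
  have Du: "integrable ?M (\<lambda>x. norm (Du x) powr p)" using u_Lp by (simp add: in_Lp_def)
  show int: "integrable ?M (\<lambda>x. norm (Du x) powr p * trunc L (u x) powr s)"
    by (rule Bochner_Integration.integrable_bound[OF integrable_mult_left[OF Du, of "L powr s"]])
      (use L s trunc_powr_le(2)[OF L s] in \<open>auto intro!: mult_left_mono\<close>)
  have "(LINT x|?M. norm (trunc_power_deriv L (s / p) (u x) *\<^sub>R Du x) powr p) \<le>
      (LINT x|?M. (s + p) powr p * (norm (Du x) powr p * trunc L (u x) powr s))"
  proof (intro integral_mono')
    fix x
    have "\<bar>trunc_power_deriv L (s / p) (u x)\<bar> \<le> (1 + s / p) * trunc L (u x) powr (s / p)"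
      using trunc_power_deriv_bounds(1,2)[OF L sp, of "u x"] by (smt (verit) powr_ge_zero)
    also have "\<dots> \<le> (s + p) * trunc L (u x) powr (s / p)"
    proof (intro mult_right_mono)
      have "s / p \<le> s" using s p by (simp add: divide_le_eq)
      then show "1 + s / p \<le> s + p" using p by linarith
    qed auto
    finally have "norm (trunc_power_deriv L (s / p) (u x) *\<^sub>R Du x) powr p \<le>
        ((s + p) * trunc L (u x) powr (s / p) * norm (Du x)) powr p"
      using p by (intro powr_mono2) (auto intro!: mult_right_mono)
    also have "\<dots> = (s + p) powr p * (norm (Du x) powr p * trunc L (u x) powr s)"
      using p s by (simp add: powr_mult powr_powr)
    finally show "norm (trunc_power_deriv L (s / p) (u x) *\<^sub>R Du x) powr p \<le> \<dots>" .
  qed (use int in auto)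
  also have "\<dots> = (s + p) powr p * (LINT x|?M. norm (Du x) powr p * trunc L (u x) powr s)" by simp
  finally have "(4 * p * (N - 1) / (N - p)) powr p *
      (LINT x|?M. norm (trunc_power_deriv L (s / p) (u x) *\<^sub>R Du x) powr p) \<le>
    (4 * p * (N - 1) / (N - p)) powr p * ((s + p) powr p * (LINT x|?M. norm (Du x) powr p * trunc L (u x) powr s))"
    by (rule mult_left_mono) simp
  with sobolev_D1p[OF D1p p(1,2) \<Omega>]
  show "E powr ((N - p) / N) \<le> (4 * p * (N - 1) / (N - p)) powr p * ((s + p) powr p *
      (LINT x|?M. norm (Du x) powr p * trunc L (u x) powr s))"
    unfolding E_def v N_def by linarith
qed

text \<open>Hoelder with weights p/q, (N-p)/q and 1 - N/q on |a|^(q/p), v^(Np/(N-p)) and v^p: the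
  powers of v add up to p. The hypothesis q > N makes the last weight positive, and the Sobolev
  quantity E^((N-p)/N) occurs only to the power N/q < 1, which is what allows the
  absorption.\<close>

lemma interpolation_truncated:
  assumes L: "0 < L" and m: "\<beta> \<le> m" and Y: "integrable (lebesgue_on \<Omega>) (\<lambda>x. \<bar>u x\<bar> powr m)"
    and a: "in_Lp (q / p) \<Omega> a" "Lp_norm (q / p) \<Omega> a \<le> K"
    and X: "(LINT x|lebesgue_on \<Omega>. \<bar>u x\<bar> powr m) \<le> X"
  defines "E \<equiv> LINT x|lebesgue_on \<Omega>. v L (m - p) x powr sobolev_conj TYPE('n) p"
  shows "integrable (lebesgue_on \<Omega>) (\<lambda>x. v L (m - p) x powr p)"
    and "(LINT x|lebesgue_on \<Omega>. v L (m - p) x powr p) \<le> X"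
    and "integrable (lebesgue_on \<Omega>) (\<lambda>x. \<bar>a x\<bar> * v L (m - p) x powr p)"
    and "(LINT x|lebesgue_on \<Omega>. \<bar>a x\<bar> * v L (m - p) x powr p) \<le>
      K * ((E powr ((N - p) / N)) powr (N / q) * X powr (1 - N / q))"
proof -
  let ?M = "lebesgue_on \<Omega>" and ?r = "sobolev_conj TYPE('n) p" and ?v = "v L (m - p)"
  have pm: "p < m" "0 < m - p" using p m by auto
  have v0: "0 \<le> ?v x" for x by (simp add: v_def)
  show vp: "integrable ?M (\<lambda>x. ?v x powr p)"
    by (rule Bochner_Integration.integrable_bound[OF Y]) (use L v_powr_le[OF L pm(1)] in auto)
  have "(LINT x|?M. ?v x powr p) \<le> (LINT x|?M. \<bar>u x\<bar> powr m)"
    by (intro integral_mono vp Y v_powr_le[OF L pm(1)])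
  then show vX: "(LINT x|?M. ?v x powr p) \<le> X" using X by linarith
  have vr: "integrable ?M (\<lambda>x. ?v x powr ?r)" by (rule sobolev_truncated(1)[OF L pm(2)])
  have ai: "integrable ?M (\<lambda>x. \<bar>a x\<bar> powr (q / p))" using a by (simp add: in_Lp_def)
  have e: "0 < p / q" "0 < (N - p) / q" "0 < 1 - N / q" "p / q + (N - p) / q + (1 - N / q) = 1"
    using N p by (auto simp: field_simps)
  have eq: "(\<bar>a x\<bar> powr (q / p)) powr (p / q) * (?v x powr ?r) powr ((N - p) / q) * (?v x powr p) powr (1 - N / q) =
      \<bar>a x\<bar> * ?v x powr p" for x
  proof -
    have "?r * ((N - p) / q) + p * (1 - N / q) = p"
      using N by (simp add: sobolev_conj_eq field_simps)
    then have "(?v x powr ?r) powr ((N - p) / q) * (?v x powr p) powr (1 - N / q) = ?v x powr p"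
      by (simp add: powr_powr powr_add[symmetric] del: times_divide_eq_right)
    moreover have "(\<bar>a x\<bar> powr (q / p)) powr (p / q) = \<bar>a x\<bar>" using N p by (simp add: powr_powr)
    ultimately show ?thesis by (simp add: mult.assoc)
  qed
  note H = Hoelder3[OF e ai vr vp, unfolded eq]
  show "integrable ?M (\<lambda>x. \<bar>a x\<bar> * ?v x powr p)" by (rule H(1)) auto
  have "(LINT x|?M. \<bar>a x\<bar> * ?v x powr p) \<le> (LINT x|?M. \<bar>a x\<bar> powr (q / p)) powr (p / q) * E powr ((N - p) / q) *
      (LINT x|?M. ?v x powr p) powr (1 - N / q)"
    unfolding E_def by (rule H(2)) auto
  also have "\<dots> \<le> K * E powr ((N - p) / q) * X powr (1 - N / q)"
    using a(2) e vX K unfolding Lp_norm_def by (intro mult_mono powr_mono2 order_refl) auto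
  also have "E powr ((N - p) / q) = (E powr ((N - p) / N)) powr (N / q)"
    using N by (simp add: powr_powr)
  finally show "(LINT x|?M. \<bar>a x\<bar> * ?v x powr p) \<le>
      K * ((E powr ((N - p) / N)) powr (N / q) * X powr (1 - N / q))" by (simp add: mult.assoc)
qed

text \<open>Used with $d = p$ for $a_2$ and $d = p - 1$ for $b_3$.\<close>

lemma inhomogeneity_truncated:
  assumes L: "0 < L" and m: "\<beta> \<le> m" and Y: "integrable (lebesgue_on \<Omega>) (\<lambda>x. \<bar>u x\<bar> powr m)"
    and d: "0 < d" "d \<le> p" and f: "in_Lp (\<beta> / d) \<Omega> f" "in_Linf \<Omega> f" "Lp_norm (\<beta> / d) \<Omega> f + Linf_norm \<Omega> f \<le> K"
  shows "integrable (lebesgue_on \<Omega>) (\<lambda>x. \<bar>f x\<bar> * (\<bar>u x\<bar> powr (p - d) * trunc L (u x) powr (m - p)))"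
    and "(LINT x|lebesgue_on \<Omega>. \<bar>f x\<bar> * (\<bar>u x\<bar> powr (p - d) * trunc L (u x) powr (m - p))) \<le>
      K * (LINT x|lebesgue_on \<Omega>. \<bar>u x\<bar> powr m) powr (1 - d / m)"
proof -
  let ?M = "lebesgue_on \<Omega>" and ?w = "\<lambda>x. \<bar>u x\<bar> powr (p - d) * trunc L (u x) powr (m - p)"
  have [measurable]: "f \<in> borel_measurable ?M" using f by (simp add: in_Lp_def)
  have pm: "p < m" "0 < m - p" "0 < m" using p m by auto
  \<comment> \<open>The weight d/m goes to f in L^(m/d), and 1 - d/m to |u|^m; the power of the
    latter integral that falls short of one originates here.\<close>
  have e: "0 < d / m" "0 < 1 - d / m" "d / m + (1 - d / m) = 1" using d pm by (auto simp: field_simps)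
  have K0: "0 < K" using K by simp
  have \<sigma>: "0 < \<beta> / d" "\<beta> / d \<le> m / d" using d p m by (auto intro: divide_right_mono)
  note fi = integrable_powr_interpolate[OF f K0 \<sigma>] integral_powr_interpolate[OF f K0 \<sigma>]
  have eq: "(\<bar>f x\<bar> powr (m / d)) powr (d / m) * (\<bar>u x\<bar> powr m) powr (1 - d / m) = \<bar>f x\<bar> * \<bar>u x\<bar> powr (m - d)" for x
  proof -
    have "m * (1 - d / m) = m - d" using pm by (simp add: field_simps)
    then show ?thesis using d pm by (simp add: powr_powr)
  qed
  note H = Hoelder2[OF e fi(1) Y, unfolded eq]
  have int: "integrable ?M (\<lambda>x. \<bar>f x\<bar> * \<bar>u x\<bar> powr (m - d))" by (rule H(1)) auto
  have le: "\<bar>f x\<bar> * ?w x \<le> \<bar>f x\<bar> * \<bar>u x\<bar> powr (m - d)" for x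
  proof -
    have "?w x \<le> \<bar>u x\<bar> powr (p - d) * \<bar>u x\<bar> powr (m - p)"
      using L pm by (intro mult_left_mono trunc_powr_le) auto
    then show ?thesis by (intro mult_left_mono) (auto simp: powr_add[symmetric])
  qed
  show int': "integrable ?M (\<lambda>x. \<bar>f x\<bar> * ?w x)"
    by (rule Bochner_Integration.integrable_bound[OF int]) (use L le in \<open>auto simp: abs_mult\<close>)
  have "(LINT x|?M. \<bar>f x\<bar> * ?w x) \<le> (LINT x|?M. \<bar>f x\<bar> * \<bar>u x\<bar> powr (m - d))"
    by (intro integral_mono int int' le)
  also have "\<dots> \<le> (LINT x|?M. \<bar>f x\<bar> powr (m / d)) powr (d / m) * (LINT x|?M. \<bar>u x\<bar> powr m) powr (1 - d / m)"
    by (rule H(2)) auto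
  also have "\<dots> \<le> K * (LINT x|?M. \<bar>u x\<bar> powr m) powr (1 - d / m)"
    using fi(2) by (intro mult_right_mono) auto
  finally show "(LINT x|?M. \<bar>f x\<bar> * ?w x) \<le> K * (LINT x|?M. \<bar>u x\<bar> powr m) powr (1 - d / m)" .
qed

lemma energy_truncated:
  assumes L: "0 < L" and m: "\<beta> \<le> m" and Y: "integrable (lebesgue_on \<Omega>) (\<lambda>x. \<bar>u x\<bar> powr m)"
  defines "X \<equiv> max (LINT x|lebesgue_on \<Omega>. \<bar>u x\<bar> powr m) ((LINT x|lebesgue_on \<Omega>. \<bar>u x\<bar> powr m) powr (1 - p / m))"
    and "E \<equiv> (LINT x|lebesgue_on \<Omega>. v L (m - p) x powr sobolev_conj TYPE('n) p) powr ((N - p) / N)"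
  shows "lam / 2 * (LINT x|lebesgue_on \<Omega>. norm (Du x) powr p * trunc L (u x) powr (m - p)) \<le>
    m * (2 * K + K * (lam / (2 * K)) powr (1 - p)) * (X + E powr (N / q) * X powr (1 - N / q))"
proof -
  let ?M = "lebesgue_on \<Omega>" and ?v = "v L (m - p)" and ?w = "\<lambda>x. trunc L (u x) powr (m - p)"
  define C where "C = K * (lam / (2 * K)) powr (1 - p)"
  define yy where "yy = (LINT x|?M. \<bar>u x\<bar> powr m)"
  define Z where "Z = E powr (N / q) * X powr (1 - N / q)"
  have pm: "p < m" "0 < m - p" "1 < m" using p m by auto
  have K0: "0 < K" using K by simp
  have C0: "0 \<le> C" using K by (simp add: C_def)
  have y0: "0 \<le> yy" by (simp add: yy_def)
  have X0: "0 \<le> X" "yy \<le> X" "yy powr (1 - p / m) \<le> X" using y0 by (auto simp: X_def yy_def max_def)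
  \<comment> \<open>The b3 term produces the exponent 1 - (p-1)/m, which lies between 1 - p/m and 1,
    so the maximum X of the two extreme powers covers it for small and for large integrals
    alike.\<close>
  have yX: "yy powr (1 - (p - 1) / m) \<le> X"
  proof (cases "1 \<le> yy")
    case True
    then have "yy powr (1 - (p - 1) / m) \<le> yy powr 1" using p pm by (intro powr_mono) auto
    then show ?thesis using X0 y0 by simp
  next
    case False
    have "yy powr (1 - (p - 1) / m) \<le> yy powr (1 - p / m)"
      using False y0 pm by (intro powr_mono') (auto simp: divide_right_mono)
    then show ?thesis using X0 by simp
  qed
  have Z0: "0 \<le> Z" by (simp add: Z_def)
  note v = interpolation_truncated[OF L m Y _ _ X0(2)[unfolded yy_def], folded E_def]
  have vp: "integrable ?M (\<lambda>x. ?v x powr p)" "(LINT x|?M. ?v x powr p) \<le> X"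
    by (rule v[OF a1])+
  have i1: "integrable ?M (\<lambda>x. \<bar>a1 x\<bar> * ?v x powr p)" "(LINT x|?M. \<bar>a1 x\<bar> * ?v x powr p) \<le> K * Z"
    unfolding Z_def by (rule v[OF a1])+
  have i2: "integrable ?M (\<lambda>x. \<bar>b2 x\<bar> * ?v x powr p)" "(LINT x|?M. \<bar>b2 x\<bar> * ?v x powr p) \<le> K * Z"
    unfolding Z_def by (rule v[OF b2])+
  \<comment> \<open>Where u x = 0 the first factor is \<open>0 powr 0 = 0\<close>, not 1, but there
    the truncation vanishes too.\<close>
  have upp: "\<bar>u x\<bar> powr (p - p) * ?w x = ?w x" for x
    using L pm by (auto simp: trunc_def)
  have i3: "integrable ?M (\<lambda>x. \<bar>a2 x\<bar> * ?w x)" "(LINT x|?M. \<bar>a2 x\<bar> * ?w x) \<le> K * X"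
  proof -
    note H = inhomogeneity_truncated[OF L m Y _ order_refl a2, unfolded upp, folded yy_def]
    show "integrable ?M (\<lambda>x. \<bar>a2 x\<bar> * ?w x)" using H(1) p by auto
    have "(LINT x|?M. \<bar>a2 x\<bar> * ?w x) \<le> K * yy powr (1 - p / m)" using H(2) p by auto
    also have "\<dots> \<le> K * X" using X0 K0 by (intro mult_left_mono) auto
    finally show "(LINT x|?M. \<bar>a2 x\<bar> * ?w x) \<le> K * X" .
  qed
  have i4: "integrable ?M (\<lambda>x. \<bar>b3 x\<bar> * (\<bar>u x\<bar> * ?w x))" "(LINT x|?M. \<bar>b3 x\<bar> * (\<bar>u x\<bar> * ?w x)) \<le> K * X"
  proof -
    note H = inhomogeneity_truncated[OF L m Y _ _ b3, folded yy_def]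
    have e: "\<bar>u x\<bar> powr (p - (p - 1)) = \<bar>u x\<bar>" for x by simp
    show "integrable ?M (\<lambda>x. \<bar>b3 x\<bar> * (\<bar>u x\<bar> * ?w x))" using H(1) p unfolding e by auto
    have "(LINT x|?M. \<bar>b3 x\<bar> * (\<bar>u x\<bar> * ?w x)) \<le> K * yy powr (1 - (p - 1) / m)" using H(2) p unfolding e by auto
    also have "\<dots> \<le> K * X" using yX K0 by (intro mult_left_mono) auto
    finally show "(LINT x|?M. \<bar>b3 x\<bar> * (\<bar>u x\<bar> * ?w x)) \<le> K * X" .
  qed
  have iDu: "integrable ?M (\<lambda>x. norm (Du x) powr p * ?w x)"
    by (rule sobolev_truncated(2)[OF L pm(2)])
  \<comment> \<open>The equation tested with the truncated power says that \<open>up\<close> has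
    integral 0. The structure conditions give low <= up almost everywhere, so the integral of
    \<open>low\<close> is at most 0, and its gradient term is bounded by the others.\<close>
  define low where "low x = lam / 2 * (norm (Du x) powr p * ?w x) - (m * (\<bar>a1 x\<bar> * ?v x powr p) + m * (\<bar>a2 x\<bar> * ?w x)
      + C * ?v x powr p + \<bar>b2 x\<bar> * ?v x powr p + \<bar>b3 x\<bar> * (\<bar>u x\<bar> * ?w x))" for x
  define up where "up x = trunc_power_deriv L (m - p) (u x) * (A x (u x) (Du x) \<bullet> Du x)
      - B x (u x) (Du x) * trunc_power L (m - p) (u x)" for x
  have D1p: "in_D1p \<Omega> p (\<lambda>x. trunc_power L (m - p) (u x)) (\<lambda>x. trunc_power_deriv L (m - p) (u x) *\<^sub>R Du x)"
    by (rule trunc_power_D1p[OF L pm(2)])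
  have weak: "integrable ?M (\<lambda>x. A x (u x) (Du x) \<bullet> (trunc_power_deriv L (m - p) (u x) *\<^sub>R Du x))"
    "integrable ?M (\<lambda>x. B x (u x) (Du x) * trunc_power L (m - p) (u x))"
    "(LINT x|?M. A x (u x) (Du x) \<bullet> (trunc_power_deriv L (m - p) (u x) *\<^sub>R Du x)) =
      (LINT x|?M. B x (u x) (Du x) * trunc_power L (m - p) (u x))"
    using sol D1p unfolding weak_solution_def by blast+
  have up: "up = (\<lambda>x. A x (u x) (Du x) \<bullet> (trunc_power_deriv L (m - p) (u x) *\<^sub>R Du x)
      - B x (u x) (Du x) * trunc_power L (m - p) (u x))"
    by (simp add: up_def [abs_def])
  have "integrable ?M up" "(LINT x|?M. up x) = 0"
    unfolding up using Bochner_Integration.integrable_diff[OF weak(1,2)]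
      Bochner_Integration.integral_diff[OF weak(1,2)] weak(3) by linarith+
  moreover have "integrable ?M low"
    unfolding low_def using iDu vp i1 i2 i3 i4 by auto
  moreover have "AE x in ?M. low x \<le> up x"
    using A_ge B_le data_nonneg in_LinfD(1)[OF b1(1)]
  proof eventually_elim
    case (elim x)
    have b1K: "b1 x \<le> K" using elim b1(2) by linarith
    have g: "trunc_power_deriv L (m - p) (u x) \<le> m * ?w x"
    proof -
      have "trunc_power_deriv L (m - p) (u x) \<le> (1 + (m - p)) * ?w x"
        by (rule trunc_power_deriv_bounds(2)[OF L pm(2)])
      also have "\<dots> \<le> m * ?w x" using p by (intro mult_right_mono) auto
      finally show ?thesis .
    qed
    show ?case
      unfolding low_def up_def C_def v_powr trunc_power_def
      using energy_pointwise[OF p(1) lam K0, of "Du x" "a1 x" "u x" "a2 x" "A x (u x) (Du x)" "B x (u x) (Du x)"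
          "b1 x" "b2 x" "b3 x" "?w x" "trunc_power_deriv L (m - p) (u x)" m]
        elim b1K g trunc_power_deriv_bounds(1)[OF L pm(2), of "u x"] by auto
  qed
  ultimately have "(LINT x|?M. low x) \<le> 0" using integral_mono_AE[of ?M low up] by simp
  also have "(LINT x|?M. low x) = lam / 2 * (LINT x|?M. norm (Du x) powr p * ?w x) -
      (m * (LINT x|?M. \<bar>a1 x\<bar> * ?v x powr p) + m * (LINT x|?M. \<bar>a2 x\<bar> * ?w x) + C * (LINT x|?M. ?v x powr p)
       + (LINT x|?M. \<bar>b2 x\<bar> * ?v x powr p) + (LINT x|?M. \<bar>b3 x\<bar> * (\<bar>u x\<bar> * ?w x)))"
    unfolding low_def using iDu vp i1 i2 i3 i4 by simp
  finally have "lam / 2 * (LINT x|?M. norm (Du x) powr p * ?w x) \<le>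
      m * (LINT x|?M. \<bar>a1 x\<bar> * ?v x powr p) + m * (LINT x|?M. \<bar>a2 x\<bar> * ?w x) + C * (LINT x|?M. ?v x powr p)
       + (LINT x|?M. \<bar>b2 x\<bar> * ?v x powr p) + (LINT x|?M. \<bar>b3 x\<bar> * (\<bar>u x\<bar> * ?w x))" by simp
  also have "\<dots> \<le> m * (K * Z) + m * (K * X) + C * X + K * Z + K * X"
    using i1 i2 i3 i4 vp C0 pm by (intro add_mono mult_left_mono) auto
  \<comment> \<open>As m > 1, every term may carry one factor m, and C * X may be enlarged to C * (X
    + Z); this leaves a single product.\<close>
  also have "\<dots> \<le> m * (K * Z) + m * (K * X) + (m * (C * (X + Z))) + m * (K * Z) + m * (K * X)"
  proof (intro add_mono order_refl)
    have 1: "1 * t \<le> m * t" if "0 \<le> t" for t using that pm by (intro mult_right_mono) auto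
    show "K * Z \<le> m * (K * Z)" "K * X \<le> m * (K * X)" using 1 K0 Z0 X0 by auto
    have "C * X \<le> C * (X + Z)" using C0 Z0 by (intro mult_left_mono) auto
    also have "\<dots> \<le> m * (C * (X + Z))" using 1[of "C * (X + Z)"] C0 Z0 X0 by auto
    finally show "C * X \<le> m * (C * (X + Z))" .
  qed
  also have "\<dots> = m * (2 * K + C) * (X + Z)" by (simp add: algebra_simps)
  finally show ?thesis by (simp add: C_def Z_def)
qed

text \<open>Sobolev contributes m^p and the energy estimate one more m; absorbing the power N/q of E
  raises m^(p+1) to 1/(1 - N/q). The resulting bound R is free of the truncation level L, so it
  survives the limit.\<close>

lemma moser_step:
  assumes m: "\<beta> \<le> m" and Y: "integrable (lebesgue_on \<Omega>) (\<lambda>x. \<bar>u x\<bar> powr m)"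
  defines "yy \<equiv> (LINT x|lebesgue_on \<Omega>. \<bar>u x\<bar> powr m)" and "\<kappa> \<equiv> N / (N - p)"
  shows "integrable (lebesgue_on \<Omega>) (\<lambda>x. \<bar>u x\<bar> powr (m * \<kappa>))"
    and "(LINT x|lebesgue_on \<Omega>. \<bar>u x\<bar> powr (m * \<kappa>)) powr (1 / \<kappa>) \<le>
      moser_const N p q lam K * m powr ((p + 1) / (1 - N / q)) * max yy (yy powr (1 - p / m))"
proof -
  let ?M = "lebesgue_on \<Omega>" and ?r = "sobolev_conj TYPE('n) p"
  define X where "X = max yy (yy powr (1 - p / m))"
  define S where "S = (4 * p * (N - 1) / (N - p)) powr p"
  define C where "C = 2 * K + K * (lam / (2 * K)) powr (1 - p)"
  define c where "c = max 1 (S * (2 / lam) * C)"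
  define R where "R = moser_const N p q lam K * m powr ((p + 1) / (1 - N / q)) * X"
  have pm: "p < m" "0 < m - p" "1 < m" using p m by auto
  have \<kappa>: "0 < \<kappa>" "1 / \<kappa> = (N - p) / N" using N p by (auto simp: \<kappa>_def)
  have \<theta>: "0 < N / q" "N / q < 1" using N by auto
  have X0: "0 \<le> X" by (simp add: X_def yy_def le_max_iff_disj)
  have S0: "0 \<le> S" by (simp add: S_def)
  have E: "(LINT x|?M. v L (m - p) x powr ?r) powr (1 / \<kappa>) \<le> R" if L: "0 < L" for L
  proof -
    define E where "E = (LINT x|?M. v L (m - p) x powr ?r) powr ((N - p) / N)"
    define I where "I = (LINT x|?M. norm (Du x) powr p * trunc L (u x) powr (m - p))"
    define T where "T = X + E powr (N / q) * X powr (1 - N / q)"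
    have T0: "0 \<le> T" using X0 by (simp add: T_def)
    have "lam / 2 * I \<le> m * C * T"
      unfolding T_def I_def C_def E_def X_def yy_def by (rule energy_truncated[OF L m Y])
    then have I: "I \<le> 2 / lam * (m * C * T)" using lam by (simp add: field_simps)
    have "E \<le> S * (m powr p * I)"
      using sobolev_truncated(3)[OF L pm(2)] unfolding E_def I_def S_def by simp
    also have "\<dots> \<le> S * (m powr p * (2 / lam * (m * C * T)))"
      using I S0 by (intro mult_left_mono) auto
    also have "\<dots> = (S * (2 / lam) * C) * (m powr p * m powr 1) * T" using pm by simp
    also have "\<dots> = (S * (2 / lam) * C) * m powr (p + 1) * T" unfolding powr_add[symmetric] ..
    also have "\<dots> \<le> c * m powr (p + 1) * T" unfolding c_def using T0 by (intro mult_right_mono) auto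
    finally have le: "E \<le> c * m powr (p + 1) * (X + E powr (N / q) * X powr (1 - N / q))" by (simp add: T_def)
    have "1 \<le> m powr (p + 1)" using pm p by (intro ge_one_powr_ge_zero) auto
    then have "1 \<le> c * m powr (p + 1)" using mult_mono[of 1 c 1 "m powr (p + 1)"] by (simp add: c_def)
    from absorb_interpolated[OF _ X0 this \<theta> le]
    have "E \<le> (2 * (c * m powr (p + 1))) powr (1 / (1 - N / q)) * X" by (simp add: E_def)
    also have "(2 * (c * m powr (p + 1))) powr (1 / (1 - N / q)) =
        (2 * c) powr (1 / (1 - N / q)) * m powr ((p + 1) / (1 - N / q))"
      by (simp add: mult.assoc[symmetric] powr_mult powr_powr)
    also have "(2 * c) powr (1 / (1 - N / q)) = moser_const N p q lam K"
      by (simp add: moser_const_def c_def S_def C_def)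
    finally show ?thesis by (simp add: E_def \<kappa> R_def)
  qed
  have "0 \<le> R" using E[of 1] by (smt (verit) powr_ge_zero)
  have int: "integrable ?M (\<lambda>x. v (real (Suc n)) (m - p) x powr ?r)" for n
    by (rule sobolev_truncated(1)) (use pm in auto)
  have nn: "0 \<le> v (real (Suc n)) (m - p) x powr ?r" for n x by simp
  \<comment> \<open>The truncated functions tend to |u|^(m/p), and m/p times the Sobolev exponent
    Np/(N-p) is m \<kappa>.\<close>
  have lim: "(\<lambda>n. v (real (Suc n)) (m - p) x powr ?r) \<longlonglongrightarrow> \<bar>u x\<bar> powr (m * \<kappa>)" for x
  proof -
    have "(\<lambda>n. v (real (Suc n)) (m - p) x powr ?r) \<longlonglongrightarrow> (\<bar>u x\<bar> * \<bar>u x\<bar> powr ((m - p) / p)) powr ?r"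
      unfolding v_def using pm p sobolev_conj_pos
      by (intro tendsto_powr' tendsto_intros trunc_tendsto always_eventually disjI2 conjI)
        (auto intro!: trunc_bounds eventuallyI)
    moreover have "(\<bar>u x\<bar> * \<bar>u x\<bar> powr ((m - p) / p)) powr ?r = \<bar>u x\<bar> powr (m * \<kappa>)"
    proof -
      have "\<bar>u x\<bar> * \<bar>u x\<bar> powr ((m - p) / p) = \<bar>u x\<bar> powr 1 * \<bar>u x\<bar> powr ((m - p) / p)" by simp
      also have "\<dots> = \<bar>u x\<bar> powr (m / p)" unfolding powr_add[symmetric] using p by (simp add: field_simps)
      moreover have "m / p * ?r = m * \<kappa>" using p N by (simp add: sobolev_conj_eq \<kappa>_def)
      ultimately show ?thesis by (simp only: powr_powr)
    qed
    ultimately show ?thesis by simp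
  qed
  have B: "(LINT x|?M. v (real (Suc n)) (m - p) x powr ?r) \<le> R powr \<kappa>" for n
  proof -
    let ?F = "LINT x|?M. v (real (Suc n)) (m - p) x powr ?r"
    have "(?F powr (1 / \<kappa>)) powr \<kappa> \<le> R powr \<kappa>" using E[of "real (Suc n)"] \<kappa> by (intro powr_mono2) auto
    then show ?thesis using \<kappa>(1) by (simp add: powr_powr)
  qed
  show "integrable ?M (\<lambda>x. \<bar>u x\<bar> powr (m * \<kappa>))"
    by (rule Fatou_integrable[OF int nn lim B])
  have "(LINT x|?M. \<bar>u x\<bar> powr (m * \<kappa>)) \<le> R powr \<kappa>"
    by (rule Fatou_integral_le[OF int nn lim B])
  then have "(LINT x|?M. \<bar>u x\<bar> powr (m * \<kappa>)) powr (1 / \<kappa>) \<le> (R powr \<kappa>) powr (1 / \<kappa>)"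
    using \<kappa>(1) by (intro powr_mono2) auto
  then show "(LINT x|?M. \<bar>u x\<bar> powr (m * \<kappa>)) powr (1 / \<kappa>) \<le>
      moser_const N p q lam K * m powr ((p + 1) / (1 - N / q)) * max yy (yy powr (1 - p / m))"
    using \<kappa>(1) \<open>0 \<le> R\<close> by (simp add: powr_powr R_def X_def)
qed

end

subsection \<open>Moser iteration\<close>

text \<open>With y = p/(\<beta> \<kappa>^j) <= p/\<beta>, the inequality -ln(1-y) <= y/(1-y) <= y/(1
  - p/\<beta>) bounds the logarithm of each factor by a term of a geometric series. The hypothesis p
  < \<beta> keeps the first, smallest factor positive.\<close>

lemma moser_exponents_ge:
  fixes \<kappa> \<beta> p :: real
  assumes "1 < \<kappa>" "0 < p" "p < \<beta>"
  shows "exp (- (p / (\<beta> - p) * (\<kappa> / (\<kappa> - 1)))) \<le> (\<Prod>j<k. 1 - p / (\<beta> * \<kappa> ^ j))"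
proof -
  define x where "x = 1 / \<kappa>"
  have x: "0 < x" "x < 1" using assms by (auto simp: x_def)
  have bound: "exp (- (p / (\<beta> - p) * x ^ j)) \<le> 1 - p / (\<beta> * \<kappa> ^ j)" for j
  proof -
    define y where "y = p / (\<beta> * \<kappa> ^ j)"
    have \<kappa>j: "1 \<le> \<kappa> ^ j" using assms by simp
    have y_eq: "y = p / \<beta> * x ^ j" by (simp add: y_def x_def power_one_over)
    have xj: "0 < x ^ j" "x ^ j \<le> 1" using x by (auto intro: power_le_one)
    have "y \<le> p / \<beta>" using xj assms mult_left_mono[of "x ^ j" 1 "p / \<beta>"] unfolding y_eq by simp
    moreover have p\<beta>: "p / \<beta> < 1" using assms by simp
    moreover have "0 < y" using xj assms unfolding y_eq by simp
    ultimately have y: "0 < y" "0 < 1 - p / \<beta>" "1 - p / \<beta> \<le> 1 - y" "0 < 1 - y"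
      by linarith+
    have "ln (1 / (1 - y)) \<le> 1 / (1 - y) - 1" using y by (intro ln_le_minus_one) auto
    also have "1 / (1 - y) - 1 = y / (1 - y)" using y by (simp add: field_simps)
    also have "\<dots> \<le> y / (1 - p / \<beta>)" using y by (intro divide_left_mono) auto
    also have "\<dots> = p / (\<beta> - p) * x ^ j" using assms unfolding y_eq by (simp add: field_simps)
    finally have "- (p / (\<beta> - p) * x ^ j) \<le> ln (1 - y)" using y by (simp add: ln_div)
    then have "exp (- (p / (\<beta> - p) * x ^ j)) \<le> exp (ln (1 - y))" by (simp only: exp_le_cancel_iff)
    then show ?thesis using y(4) by (simp only: exp_ln y_def)
  qed
  have "(\<Sum>j<k. x ^ j) = (1 - x ^ k) / (1 - x)" using x by (simp add: sum_gp_strict)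
  also have "\<dots> \<le> 1 / (1 - x)" using x by (intro divide_right_mono) auto
  also have "\<dots> = \<kappa> / (\<kappa> - 1)" using assms by (simp add: x_def field_simps)
  finally have "p / (\<beta> - p) * (\<Sum>j<k. x ^ j) \<le> p / (\<beta> - p) * (\<kappa> / (\<kappa> - 1))"
    using assms by (intro mult_left_mono) auto
  then have "exp (- (p / (\<beta> - p) * (\<kappa> / (\<kappa> - 1)))) \<le> exp (\<Sum>j<k. - (p / (\<beta> - p) * x ^ j))"
    by (simp add: sum_negf sum_distrib_left)
  also have "\<dots> = (\<Prod>j<k. exp (- (p / (\<beta> - p) * x ^ j)))" by (simp add: exp_sum)
  also have "\<dots> \<le> (\<Prod>j<k. 1 - p / (\<beta> * \<kappa> ^ j))" by (intro prod_mono conjI bound exp_ge_zero)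
  finally show ?thesis .
qed

text \<open>The logarithm of the j-th factor is an affine function of j times \<kappa>^(-j): a fixed
  power of m = \<beta> \<kappa>^j contributes only linear growth in j.\<close>

lemma summable_moser_factors:
  fixes \<kappa> \<beta> C \<tau> :: real
  assumes "1 < \<kappa>" "0 < \<beta>" "0 < C"
  shows "summable (\<lambda>j. ln ((C * (\<beta> * \<kappa> ^ j) powr \<tau>) powr (1 / (\<beta> * \<kappa> ^ j))))"
proof -
  define x where "x = 1 / \<kappa>"
  have x: "norm x < 1" using assms by (auto simp: x_def)
  have "summable (\<lambda>j. of_nat (Suc j) * x ^ j)"
    using geometric_deriv_sums[OF x] by (simp add: sums_iff)
  \<comment> \<open>The term j * x^j is written as Suc j * x^j - x^j, the first part being the
    differentiated geometric series.\<close>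
  then have "summable (\<lambda>j. (ln C + \<tau> * ln \<beta>) / \<beta> * x ^ j + \<tau> * ln \<kappa> / \<beta> * (of_nat (Suc j) * x ^ j - x ^ j))"
    using x by (intro summable_add summable_mult summable_diff summable_geometric)
  also have "(\<lambda>j. (ln C + \<tau> * ln \<beta>) / \<beta> * x ^ j + \<tau> * ln \<kappa> / \<beta> * (of_nat (Suc j) * x ^ j - x ^ j)) =
      (\<lambda>j. ln ((C * (\<beta> * \<kappa> ^ j) powr \<tau>) powr (1 / (\<beta> * \<kappa> ^ j))))"
  proof
    fix j
    have \<kappa>j: "0 < \<kappa> ^ j" using assms by simp
    have "ln ((C * (\<beta> * \<kappa> ^ j) powr \<tau>) powr (1 / (\<beta> * \<kappa> ^ j))) =
        (ln C + \<tau> * (ln \<beta> + real j * ln \<kappa>)) / (\<beta> * \<kappa> ^ j)"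
      using assms \<kappa>j by (simp add: ln_powr ln_mult ln_realpow)
    also have "\<dots> = (ln C + \<tau> * ln \<beta>) / \<beta> * x ^ j + \<tau> * ln \<kappa> / \<beta> * (of_nat (Suc j) * x ^ j - x ^ j)"
      using assms \<kappa>j by (simp add: x_def power_one_over field_simps)
    finally show "(ln C + \<tau> * ln \<beta>) / \<beta> * x ^ j + \<tau> * ln \<kappa> / \<beta> * (of_nat (Suc j) * x ^ j - x ^ j) =
      ln ((C * (\<beta> * \<kappa> ^ j) powr \<tau>) powr (1 / (\<beta> * \<kappa> ^ j)))" by simp
  qed
  finally show ?thesis .
qed

text \<open>The shape max(t, t^\<theta>) is stable under iteration: for t >= 1 it is t, for t < 1 it
  is t^\<theta>, and composing multiplies the exponents. Constants at least 1 only shrink when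
  raised to \<theta> k <= 1, so they can be pulled out unchanged.\<close>

lemma iterate_max_powr:
  fixes n c \<theta> :: "nat \<Rightarrow> real"
  assumes nn: "\<And>k. 0 \<le> n k" and c: "\<And>k. 1 \<le> c k" and \<theta>: "\<And>k. 0 < \<theta> k" "\<And>k. \<theta> k \<le> 1"
    and step: "\<And>k. n (Suc k) \<le> c k * max (n k) (n k powr \<theta> k)"
  shows "n k \<le> (\<Prod>j<k. c j) * max (n 0) (n 0 powr (\<Prod>j<k. \<theta> j))"
proof (induction k)
  case (Suc k)
  define P \<Theta> where "P = (\<Prod>j<k. c j)" and "\<Theta> = (\<Prod>j<k. \<theta> j)"
  have P: "1 \<le> P" unfolding P_def using c by (intro prod_ge_1) auto
  have "0 < \<Theta>" unfolding \<Theta>_def using \<theta>(1) by (intro prod_pos) auto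
  moreover have "\<Theta> \<le> 1" unfolding \<Theta>_def by (intro prod_le_1) (simp add: less_imp_le \<theta>)
  ultimately have \<Theta>: "0 < \<Theta>" "\<Theta> \<le> 1" .
  define V W where "V = max (n 0) (n 0 powr \<Theta>)" and "W = max (n 0) (n 0 powr (\<Theta> * \<theta> k))"
  have V0: "0 \<le> V" using nn[of 0] by (simp add: V_def)
  have \<Theta>': "0 < \<Theta> * \<theta> k" "\<Theta> * \<theta> k \<le> \<Theta>"
    using \<Theta> \<theta>[of k] mult_left_mono[of "\<theta> k" 1 \<Theta>] by auto
  have VW: "V \<le> W" "V powr \<theta> k \<le> W"
  proof -
    have "V \<le> W \<and> V powr \<theta> k \<le> W"
    proof (cases "1 \<le> n 0")
      case True
      have "n 0 powr a \<le> n 0" if "a \<le> 1" for a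
        using powr_mono[OF that True] True by simp
      then have "V = n 0" "n 0 powr \<theta> k \<le> n 0" using \<Theta> \<theta> by (auto simp: V_def)
      then show ?thesis by (simp add: W_def)
    next
      case False
      have mono: "n 0 powr a \<le> n 0 powr b" if "b \<le> a" for a b
        using False nn[of 0] that by (intro powr_mono') auto
      have "n 0 \<le> n 0 powr \<Theta>" using mono[OF \<Theta>(2)] nn[of 0] by simp
      then have "V = n 0 powr \<Theta>" by (simp add: V_def)
      then show ?thesis using mono[OF \<Theta>'(2)] by (simp add: W_def powr_powr)
    qed
    then show "V \<le> W" "V powr \<theta> k \<le> W" by auto
  qed
  have nk: "n k \<le> P * V" using Suc by (simp add: P_def \<Theta>_def V_def)
  have "n k powr \<theta> k \<le> (P * V) powr \<theta> k" using nk nn \<theta>(1)[of k] by (intro powr_mono2) auto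
  also have "\<dots> = P powr \<theta> k * V powr \<theta> k" using P V0 by (simp add: powr_mult)
  also have "\<dots> \<le> P powr 1 * W" using P \<theta>(2)[of k] VW by (intro mult_mono powr_mono) auto
  finally have "n k powr \<theta> k \<le> P * W" using P by simp
  moreover have "n k \<le> P * W" using nk P VW mult_left_mono[of V W P] by linarith
  ultimately have "max (n k) (n k powr \<theta> k) \<le> P * W" by simp
  then have "c k * max (n k) (n k powr \<theta> k) \<le> c k * (P * W)" using c[of k] by (intro mult_left_mono) auto
  with step[of k] have "n (Suc k) \<le> c k * (P * W)" by linarith
  then show ?case by (simp add: P_def W_def \<Theta>_def mult_ac)
qed (use nn in auto)

text \<open>Markov's inequality at a level R' > R bounds the measure of the set where |f| >= R' by
  (R/R')^(m k), which tends to 0. This argument is indifferent to the total measure of the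
  space.\<close>

lemma AE_bounded_if_powr_integrals_bounded:
  fixes f :: "'a \<Rightarrow> real" and m :: "nat \<Rightarrow> real"
  assumes [measurable]: "f \<in> borel_measurable M"
    and int: "\<And>k. integrable M (\<lambda>x. \<bar>f x\<bar> powr m k)"
    and R: "0 \<le> R" "\<And>k. (\<integral>x. \<bar>f x\<bar> powr m k \<partial>M) powr (1 / m k) \<le> R"
    and m: "\<And>k. 0 < m k" "filterlim m at_top sequentially"
  shows "AE x in M. \<bar>f x\<bar> \<le> R"
proof -
  have "AE x in M. \<bar>f x\<bar> < R'" if "R < R'" for R'
  proof -
    let ?S = "{x \<in> space M. R' \<le> \<bar>f x\<bar>}"
    have R': "0 < R'" using that R by simp
    have le: "emeasure M ?S \<le> ennreal ((R / R') powr m k)" for k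
    proof -
      have "?S \<subseteq> {x \<in> space M. R' powr m k \<le> \<bar>f x\<bar> powr m k}"
        using R' m(1)[of k] by (auto intro!: powr_mono2)
      then have "emeasure M ?S \<le> emeasure M {x \<in> space M. R' powr m k \<le> \<bar>f x\<bar> powr m k}"
        by (intro emeasure_mono) auto
      also have "\<dots> \<le> ennreal (1 / (R' powr m k) * (\<integral>x. \<bar>f x\<bar> powr m k \<partial>M))"
        using R' by (intro integral_Markov_inequality[OF int]) auto
      also have "\<dots> \<le> ennreal ((R / R') powr m k)"
      proof (rule ennreal_leI)
        let ?I = "\<integral>x. \<bar>f x\<bar> powr m k \<partial>M"
        have "?I = (?I powr (1 / m k)) powr m k" using m(1)[of k] by (simp add: powr_powr)
        also have "\<dots> \<le> R powr m k" using R m(1)[of k] by (intro powr_mono2) auto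
        finally show "1 / (R' powr m k) * ?I \<le> (R / R') powr m k"
          using R R' by (simp add: powr_divide divide_right_mono)
      qed
      finally show ?thesis .
    qed
    have "(\<lambda>k. (R / R') powr m k) \<longlonglongrightarrow> 0"
    proof (cases "R = 0")
      case False
      then have "0 < R / R'" "R / R' < 1" using R R' that by auto
      then have "ln (R / R') < 0" by simp
      then have "filterlim (\<lambda>k. ln (R / R') * m k) at_bot sequentially"
        by (intro filterlim_tendsto_neg_mult_at_bot[OF tendsto_const _ m(2)])
      then have "(\<lambda>k. exp (ln (R / R') * m k)) \<longlonglongrightarrow> 0"
        by (rule filterlim_compose[OF exp_at_bot])
      then show ?thesis using False R' by (simp add: powr_def mult.commute)
    qed simp
    then have "(\<lambda>k. ennreal ((R / R') powr m k)) \<longlonglongrightarrow> ennreal 0" by (rule tendsto_ennrealI)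
    then have "emeasure M ?S \<le> ennreal 0" by (rule LIMSEQ_le_const) (use le in auto)
    then have "emeasure M ?S = 0" by simp
    then show ?thesis by (subst AE_iff_measurable[where N = ?S]) (auto simp: not_less)
  qed
  then have "AE x in M. \<forall>n. \<bar>f x\<bar> < R + inverse (real (Suc n))"
    by (subst AE_all_countable) simp
  then show ?thesis
  proof eventually_elim
    case (elim x)
    have "(\<lambda>n. R + inverse (real (Suc n))) \<longlonglongrightarrow> R + 0"
      by (intro tendsto_intros LIMSEQ_inverse_real_of_nat)
    then show ?case using elim by (intro LIMSEQ_le_const[of _ R]) (auto intro: less_imp_le)
  qed
qed

text \<open>The constant of \<open>moser_step\<close> at m = \<beta> \<kappa>^j after the m-th root
  that turns integrals into norms.\<close>

definition moser_factor :: "real \<Rightarrow> real \<Rightarrow> real \<Rightarrow> real \<Rightarrow> real \<Rightarrow> real \<Rightarrow> nat \<Rightarrow> real" where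
  "moser_factor N p q \<beta> lam K j =
    (moser_const N p q lam K * (\<beta> * (N / (N - p)) ^ j) powr ((p + 1) / (1 - N / q)))
      powr (1 / (\<beta> * (N / (N - p)) ^ j))"

text \<open>The infinite product of the factors, written through logarithms. In this form it is
  visibly positive, which the monotone constant of the theorem relies on.\<close>

definition moser_bound :: "real \<Rightarrow> real \<Rightarrow> real \<Rightarrow> real \<Rightarrow> real \<Rightarrow> real \<Rightarrow> real" where
  "moser_bound N p q \<beta> lam K = exp (\<Sum>j. ln (moser_factor N p q \<beta> lam K j))"

lemma (in bounded_data) sup_bound:
  assumes u: "in_Lp \<beta> \<Omega> u"
  shows "in_Linf \<Omega> u"
    and "Linf_norm \<Omega> u \<le> moser_bound (real CARD('n)) p q \<beta> lam K *
      max (Lp_norm \<beta> \<Omega> u) (Lp_norm \<beta> \<Omega> u powr exp (- (real CARD('n) / (\<beta> - p))))"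
proof -
  let ?M = "lebesgue_on \<Omega>"
  define \<kappa> where "\<kappa> = N / (N - p)"
  define m where "m k = \<beta> * \<kappa> ^ k" for k
  define n where "n k = (LINT x|?M. \<bar>u x\<bar> powr m k) powr (1 / m k)" for k
  define c where "c = moser_factor N p q \<beta> lam K"
  define C where "C = moser_const N p q lam K"
  define \<tau> where "\<tau> = (p + 1) / (1 - N / q)"
  have c: "c k = (C * m k powr \<tau>) powr (1 / m k)" for k
    by (simp add: c_def moser_factor_def C_def \<tau>_def m_def \<kappa>_def)
  have \<kappa>: "1 < \<kappa>" using N p by (simp add: \<kappa>_def)
  have m: "\<beta> \<le> m k" "m (Suc k) = m k * \<kappa>" "1 < m k" "p < m k" for k
  proof -
    have "1 \<le> \<kappa> ^ k" using \<kappa> by simp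
    then have "\<beta> * 1 \<le> \<beta> * \<kappa> ^ k" using p by (intro mult_left_mono) auto
    then show "\<beta> \<le> m k" by (simp add: m_def)
    then show "1 < m k" "p < m k" using p by auto
  qed (simp add: m_def)
  have \<tau>: "0 < \<tau>" using N p by (simp add: \<tau>_def)
  have C: "1 \<le> C"
    unfolding C_def moser_const_def using N by (intro ge_one_powr_ge_zero) auto
  have c1: "1 \<le> c k" for k
  proof -
    have "1 \<le> m k powr \<tau>" using m(3)[of k] \<tau> by (intro ge_one_powr_ge_zero) auto
    then have "1 \<le> C * m k powr \<tau>" using C mult_mono[of 1 C 1 "m k powr \<tau>"] by simp
    then show ?thesis unfolding c using m(3)[of k] by (intro ge_one_powr_ge_zero) auto
  qed
  have int: "integrable ?M (\<lambda>x. \<bar>u x\<bar> powr m k)" for k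
  proof (induction k)
    case 0
    then show ?case using u by (simp add: in_Lp_def m_def)
  next
    case (Suc k)
    then show ?case using moser_step(1)[OF m(1) Suc] by (simp add: m(2) \<kappa>_def)
  qed
  have step: "n (Suc k) \<le> c k * max (n k) (n k powr (1 - p / m k))" for k
  proof -
    let ?y = "LINT x|?M. \<bar>u x\<bar> powr m k" and ?z = "LINT x|?M. \<bar>u x\<bar> powr m (Suc k)"
    have "?z powr (1 / \<kappa>) \<le> C * m k powr \<tau> * max ?y (?y powr (1 - p / m k))"
      using moser_step(2)[OF m(1) int] by (simp add: m(2) \<kappa>_def C_def \<tau>_def)
    then have "(?z powr (1 / \<kappa>)) powr (1 / m k) \<le> (C * m k powr \<tau> * max ?y (?y powr (1 - p / m k))) powr (1 / m k)"
      using m(3)[of k] by (intro powr_mono2) auto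
    also have "\<dots> = c k * max ?y (?y powr (1 - p / m k)) powr (1 / m k)"
      using C by (simp add: c powr_mult le_max_iff_disj)
    also have "max ?y (?y powr (1 - p / m k)) powr (1 / m k) =
        max (?y powr (1 / m k)) ((?y powr (1 - p / m k)) powr (1 / m k))"
    proof -
      have mono: "a powr (1 / m k) \<le> b powr (1 / m k)" if "0 \<le> a" "a \<le> b" for a b
        using that m(3)[of k] by (intro powr_mono2) auto
      show ?thesis using mono[of ?y "?y powr (1 - p / m k)"] mono[of "?y powr (1 - p / m k)" ?y]
        by (auto simp: max_def)
    qed
    also have "(?y powr (1 - p / m k)) powr (1 / m k) = n k powr (1 - p / m k)"
      by (simp only: n_def powr_powr mult.commute)
    also have "(?z powr (1 / \<kappa>)) powr (1 / m k) = n (Suc k)"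
      by (simp add: n_def powr_powr m(2) mult.commute)
    finally show ?thesis by (simp add: n_def)
  qed
  define \<theta> where "\<theta> = exp (- (real CARD('n) / (\<beta> - p)))"
  define P where "P = moser_bound N p q \<beta> lam K"
  define V where "V = max (n 0) (n 0 powr \<theta>)"
  have n0: "n 0 = Lp_norm \<beta> \<Omega> u" by (simp add: n_def m_def Lp_norm_def)
  have nn: "0 \<le> n k" for k by (simp add: n_def)
  have bound: "n k \<le> P * V" for k
  proof -
    define \<Theta> where "\<Theta> = (\<Prod>j<k. 1 - p / m j)"
    have \<theta>k: "0 < 1 - p / m j" "1 - p / m j \<le> 1" for j using m(3,4)[of j] p by auto
    have "n k \<le> (\<Prod>j<k. c j) * max (n 0) (n 0 powr \<Theta>)"
      unfolding \<Theta>_def by (rule iterate_max_powr) (rule nn c1 \<theta>k step)+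
    also have "\<dots> \<le> P * V"
    proof (rule mult_mono)
      have sum: "summable (\<lambda>j. ln (c j))"
        unfolding c m_def using \<kappa> p C by (intro summable_moser_factors) auto
      have "(\<Prod>j<k. c j) = exp (\<Sum>j<k. ln (c j))"
        using c1 by (simp add: exp_sum less_le_trans[OF zero_less_one])
      also have "\<dots> \<le> P"
        unfolding P_def moser_bound_def c_def[symmetric] using c1 by (simp add: sum_le_suminf[OF sum])
      finally show "(\<Prod>j<k. c j) \<le> P" .
      have "p / (\<beta> - p) * (\<kappa> / (\<kappa> - 1)) = real CARD('n) / (\<beta> - p)"
      proof -
        have "\<kappa> / (\<kappa> - 1) = N / p" using N p by (simp add: \<kappa>_def field_simps)
        then show ?thesis using p by (simp add: N_def)
      qed
      then have \<theta>\<Theta>: "\<theta> \<le> \<Theta>"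
        using moser_exponents_ge[OF \<kappa> _ p(3), of k] p unfolding \<theta>_def \<Theta>_def m_def by simp
      have \<Theta>1: "\<Theta> \<le> 1" unfolding \<Theta>_def using \<theta>k by (intro prod_le_1) (auto intro: less_imp_le)
      \<comment> \<open>The exponent reached after k steps varies with k and is replaced by its
        lower bound \<theta>: for n 0 >= 1 the maximum is n 0 anyway, and for n 0 < 1 a smaller
        exponent gives a larger power.\<close>
      show "max (n 0) (n 0 powr \<Theta>) \<le> V"
      proof (cases "1 \<le> n 0")
        case True
        then show ?thesis using powr_mono[OF \<Theta>1 True] by (simp add: V_def)
      next
        case False
        then show ?thesis using powr_mono'[OF \<theta>\<Theta> nn[of 0]] by (auto simp: V_def)
      qed
    qed (auto simp: P_def moser_bound_def nn le_max_iff_disj)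
    finally show ?thesis .
  qed
  have lim: "filterlim m at_top sequentially"
  proof -
    have "filterlim (\<lambda>k. \<kappa> ^ k) at_top sequentially"
      using \<kappa> by (intro filterlim_at_infinity_imp_filterlim_at_top filterlim_realpow_sequentially_gt1) auto
    then show ?thesis
      unfolding m_def [abs_def] using p by (intro filterlim_tendsto_pos_mult_at_top[OF tendsto_const]) auto
  qed
  have PV: "0 \<le> P * V" using bound[of 0] nn[of 0] by linarith
  have "AE x in ?M. \<bar>u x\<bar> \<le> P * V"
    using bound m(3) unfolding n_def
    by (intro AE_bounded_if_powr_integrals_bounded[OF _ int PV _ _ lim]) (auto intro: less_trans[OF zero_less_one])
  then show "in_Linf \<Omega> u"
    and "Linf_norm \<Omega> u \<le> moser_bound (real CARD('n)) p q \<beta> lam K *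
      max (Lp_norm \<beta> \<Omega> u) (Lp_norm \<beta> \<Omega> u powr exp (- (real CARD('n) / (\<beta> - p))))"
    using in_LinfI[OF _ _ PV, of u \<Omega>] by (auto simp: P_def V_def n0 \<theta>_def N_def)
qed

theorem theorem2p1:
  fixes p \<beta> :: real
  assumes "1 < p" "p < real CARD('n::finite)" "p < \<beta>"
  shows
    "\<exists>\<theta>\<^sub>0::real. 0 < \<theta>\<^sub>0 \<and> \<theta>\<^sub>0 \<le> 1 \<and>
      (\<forall>lam q::real. 0 < lam \<longrightarrow> real CARD('n) < q \<longrightarrow>
        (\<exists>C :: real \<times> real \<times> real \<times> real \<times> real \<Rightarrow> real. mono_on {0..} C \<and>
          (\<forall>(\<Omega> :: (real^'n) set)
            (A :: real^'n \<Rightarrow> real \<Rightarrow> real^'n \<Rightarrow> real^'n)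
            (B :: real^'n \<Rightarrow> real \<Rightarrow> real^'n \<Rightarrow> real)
            (a\<^sub>1 :: real^'n \<Rightarrow> real) (a\<^sub>2 :: real^'n \<Rightarrow> real)
            (b\<^sub>1 :: real^'n \<Rightarrow> real) (b\<^sub>2 :: real^'n \<Rightarrow> real) (b\<^sub>3 :: real^'n \<Rightarrow> real)
            (u :: real^'n \<Rightarrow> real) (Du :: real^'n \<Rightarrow> real^'n).
            open \<Omega> \<longrightarrow> connected \<Omega> \<longrightarrow> \<Omega> \<noteq> {} \<longrightarrow>
            caratheodory \<Omega> A \<longrightarrow> caratheodory \<Omega> B \<longrightarrow>
            (AE x in lebesgue_on \<Omega>. \<forall>\<zeta> \<xi>.
               A x \<zeta> \<xi> \<bullet> \<xi> \<ge> lam * norm \<xi> powr p - a\<^sub>1 x * \<bar>\<zeta>\<bar> powr p - a\<^sub>2 x) \<longrightarrow>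
            (AE x in lebesgue_on \<Omega>. \<forall>\<zeta> \<xi>.
               \<bar>B x \<zeta> \<xi>\<bar> \<le> b\<^sub>1 x * norm \<xi> powr (p - 1) + b\<^sub>2 x * \<bar>\<zeta>\<bar> powr (p - 1) + b\<^sub>3 x) \<longrightarrow>
            (AE x in lebesgue_on \<Omega>.
               0 \<le> a\<^sub>1 x \<and> 0 \<le> a\<^sub>2 x \<and> 0 \<le> b\<^sub>1 x \<and> 0 \<le> b\<^sub>2 x \<and> 0 \<le> b\<^sub>3 x) \<longrightarrow>
            in_Linf \<Omega> b\<^sub>1 \<longrightarrow> in_Lp (q / p) \<Omega> a\<^sub>1 \<longrightarrow> in_Lp (q / p) \<Omega> b\<^sub>2 \<longrightarrow>
            weak_solution \<Omega> p A B u Du \<longrightarrow>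
            in_Lp \<beta> \<Omega> u \<longrightarrow>
            in_Lp (\<beta> / p) \<Omega> a\<^sub>2 \<longrightarrow> in_Linf \<Omega> a\<^sub>2 \<longrightarrow>
            in_Lp (\<beta> / (p - 1)) \<Omega> b\<^sub>3 \<longrightarrow> in_Linf \<Omega> b\<^sub>3 \<longrightarrow>
            in_Linf \<Omega> u \<and>
            Linf_norm \<Omega> u \<le>
              C (Linf_norm \<Omega> b\<^sub>1, Lp_norm (q / p) \<Omega> a\<^sub>1, Lp_norm (q / p) \<Omega> b\<^sub>2,
                 Lp_norm (\<beta> / p) \<Omega> a\<^sub>2 + Linf_norm \<Omega> a\<^sub>2,
                 Lp_norm (\<beta> / (p - 1)) \<Omega> b\<^sub>3 + Linf_norm \<Omega> b\<^sub>3)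
              * max (Lp_norm \<beta> \<Omega> u) (Lp_norm \<beta> \<Omega> u powr \<theta>\<^sub>0))))"
proof -
  let ?N = "real CARD('n)"
  \<comment> \<open>Summing the bounds for the integer sizes up to the size of the data makes the constant monotone.\<close>
  define F where "F lam q i = moser_bound ?N p q \<beta> lam (real (Suc i))" for lam q :: real and i :: nat
  define total where "total = (\<lambda>(c1, c2, c3, c4, c5). c1 + (c2 + (c3 + (c4 + (c5 :: real)))) :: real)"
  define C where "C lam q d = (\<Sum>i\<le>nat \<lceil>total d\<rceil>. F lam q i)" for lam q :: real and d
  have F: "0 < F lam q i" for lam q i by (simp add: F_def moser_bound_def)
  have mono: "mono_on {0..} (C lam q)" for lam q
  proof (rule mono_onI)
    fix d e :: "real \<times> real \<times> real \<times> real \<times> real" assume "d \<le> e"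
    then have "total d \<le> total e"
      by (cases d; cases e) (auto simp: total_def intro!: add_mono)
    then have "nat \<lceil>total d\<rceil> \<le> nat \<lceil>total e\<rceil>" by (intro nat_mono ceiling_mono)
    then show "C lam q d \<le> C lam q e"
      unfolding C_def using F by (intro sum_mono2) (auto intro: less_imp_le)
  qed
  have F_le_C: "F lam q (nat \<lceil>total d\<rceil>) \<le> C lam q d" for lam q d
    unfolding C_def using F by (intro member_le_sum) (auto intro: less_imp_le)
  \<comment> \<open>The witness for the exponent involves only p, \<beta> and N, and so can be fixed
    before lam and q.\<close>
  show ?thesis
  proof (rule exI[of _ "exp (- (?N / (\<beta> - p)))"], intro conjI allI impI, goal_cases)
    case 1
    then show ?case by simp
  next
    case 2
    then show ?case using assms by simp
  next
    case (3 lam q)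
    note lam = 3(1) and q = 3(2)
    show ?case
    proof (rule exI[of _ "C lam q"], intro conjI mono allI impI)
      fix \<Omega> :: "(real^'n) set" and A B and a1 a2 b1 b2 b3 u :: "real^'n \<Rightarrow> real" and Du :: "real^'n \<Rightarrow> real^'n"
      assume "open \<Omega>"
        and A: "AE x in lebesgue_on \<Omega>. \<forall>\<zeta> \<xi>. A x \<zeta> \<xi> \<bullet> \<xi> \<ge> lam * norm \<xi> powr p - a1 x * \<bar>\<zeta>\<bar> powr p - a2 x"
        and B: "AE x in lebesgue_on \<Omega>. \<forall>\<zeta> \<xi>.
          \<bar>B x \<zeta> \<xi>\<bar> \<le> b1 x * norm \<xi> powr (p - 1) + b2 x * \<bar>\<zeta>\<bar> powr (p - 1) + b3 x"
        and nonneg: "AE x in lebesgue_on \<Omega>. 0 \<le> a1 x \<and> 0 \<le> a2 x \<and> 0 \<le> b1 x \<and> 0 \<le> b2 x \<and> 0 \<le> b3 x"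
        and b1: "in_Linf \<Omega> b1" and a1: "in_Lp (q / p) \<Omega> a1" and b2: "in_Lp (q / p) \<Omega> b2"
        and sol: "weak_solution \<Omega> p A B u Du" and u: "in_Lp \<beta> \<Omega> u"
        and a2: "in_Lp (\<beta> / p) \<Omega> a2" "in_Linf \<Omega> a2"
        and b3: "in_Lp (\<beta> / (p - 1)) \<Omega> b3" "in_Linf \<Omega> b3"
      define d where "d = (Linf_norm \<Omega> b1, Lp_norm (q / p) \<Omega> a1, Lp_norm (q / p) \<Omega> b2,
        Lp_norm (\<beta> / p) \<Omega> a2 + Linf_norm \<Omega> a2, Lp_norm (\<beta> / (p - 1)) \<Omega> b3 + Linf_norm \<Omega> b3)"
      \<comment> \<open>An integer that is at least 1 and at least every single norm, because the
        norms are nonnegative and \<open>total\<close> is their sum. The successor matches the index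
        shift in F.\<close>
      define K where "K = real (Suc (nat \<lceil>total d\<rceil>))"
      have nn: "0 \<le> Linf_norm \<Omega> b1" "0 \<le> Lp_norm (q / p) \<Omega> a1" "0 \<le> Lp_norm (q / p) \<Omega> b2"
        "0 \<le> Lp_norm (\<beta> / p) \<Omega> a2 + Linf_norm \<Omega> a2" "0 \<le> Lp_norm (\<beta> / (p - 1)) \<Omega> b3 + Linf_norm \<Omega> b3"
        using in_LinfD(2)[OF b1] in_LinfD(2)[OF a2(2)] in_LinfD(2)[OF b3(2)] by (auto simp: Lp_norm_def)
      have "total d \<le> real (nat \<lceil>total d\<rceil>)" by (rule real_nat_ceiling_ge)
      then have "total d \<le> K" by (simp add: K_def)
      then have le: "Linf_norm \<Omega> b1 \<le> K" "Lp_norm (q / p) \<Omega> a1 \<le> K" "Lp_norm (q / p) \<Omega> b2 \<le> K"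
        "Lp_norm (\<beta> / p) \<Omega> a2 + Linf_norm \<Omega> a2 \<le> K" "Lp_norm (\<beta> / (p - 1)) \<Omega> b3 + Linf_norm \<Omega> b3 \<le> K"
        using nn unfolding d_def total_def prod.case by linarith+
      interpret bounded_data \<Omega> A B a1 a2 b1 b2 b3 u Du p q \<beta> lam K
      proof
        show "\<Omega> \<in> sets lebesgue" using \<open>open \<Omega>\<close> by simp
        show "1 \<le> K" by (simp add: K_def)
      qed (fact assms lam q A B nonneg b1 a1 b2 a2 b3 sol le)+
      show "in_Linf \<Omega> u" by (rule sup_bound(1)[OF u])
      let ?V = "max (Lp_norm \<beta> \<Omega> u) (Lp_norm \<beta> \<Omega> u powr exp (- (?N / (\<beta> - p))))"
      have "Linf_norm \<Omega> u \<le> F lam q (nat \<lceil>total d\<rceil>) * ?V"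
        using sup_bound(2)[OF u] by (simp add: F_def K_def)
      also have "\<dots> \<le> C lam q d * ?V"
        by (intro mult_right_mono F_le_C) (simp add: le_max_iff_disj)
      finally show "Linf_norm \<Omega> u \<le> C lam q (Linf_norm \<Omega> b1, Lp_norm (q / p) \<Omega> a1, Lp_norm (q / p) \<Omega> b2,
          Lp_norm (\<beta> / p) \<Omega> a2 + Linf_norm \<Omega> a2, Lp_norm (\<beta> / (p - 1)) \<Omega> b3 + Linf_norm \<Omega> b3) * ?V"
        by (simp only: d_def)
    qed
  qed
qed

end
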